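(* Let $G\leq \mathrm{Sym}(\Omega)$ be a transitive permutation group on a finite set $\Omega$, let $\mathcal E$ be a homogeneous $G$-invariant Cartesian decomposition of $\Omega$, and let $\Gamma_0\in\mathcal E$. Then the following all hold. (a) If $\mathcal E$ is a blow-up decomposition for $G$ and $G$ is quasiprimitive on $\Omega$, then the component $G^{\Gamma_0}$ is quasiprimitive (on $\Gamma_0$) and $\mathrm{Soc}(G)=\prod_{\Gamma\in\mathcal E}\mathrm{Soc}(G^{\Gamma})$. (b) If $\mathcal E$ is a blow-up decomposition for $G$ and the component $G^{\Gamma_0}$ is quasiprimitive on $\Gamma_0$ and not of type HA, then $G$ is quasiprimitive on $\Omega$ and $\mathrm{Soc}(G)=\prod_{\Gamma\in\mathcal E}\mathrm{Soc}(G^{\Gamma})$. (c) The group $G$ is not quasiprimitive of type Sd. (d) If $G$ is quasiprimitive of type Cd, then $\mathcal E$ is a blow-up decomposition for $G$ and the component $G^{\Gamma_0}$ is quasiprimitive of type Sd or Cd.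
   Context: All groups and sets are finite; permutations act on the right. A permutation group is quasiprimitive if all its non-trivial normal subgroups are transitive. $\mathrm{Soc}(G)$ is the product of all minimal normal subgroups of $G$. Cartesian decompositions. A Cartesian decomposition of $\Omega$ is a set $\mathcal E=\{\Gamma_1,\dots,\Gamma_\ell\}$ of proper partitions of $\Omega$ (i.e. neither the one-part partition $\{\Omega\}$ nor the partition into singletons) such that $|\gamma_1\cap\dots\cap\gamma_\ell|=1$ for all $\gamma_1\in\Gamma_1,\dots,\gamma_\ell\in\Gamma_\ell$. It is homogeneous if all its partitions have the same number of parts. For $G\leq\mathrm{Sym}(\Omega)$, $\mathcal E$ is $G$-invariant if $G$ permutes the partitions in $\mathcal E$; it is a transitive $G$-invariant Cartesian decomposition if $G$ is transitive on $\mathcal E$. For $\Gamma\in\mathcal E$, $G_\Gamma=\{g\in G:\Gamma g=\Gamma\}$ and the component $G^\Gamma\leq \mathrm{Sym}(\Gamma)$ is the permutation group induced by $G_\Gamma$ on the set $\Gamma$ of parts. The set $\Omega$ is identified with $\Gamma_1\times\dots\times\Gamma_\ell$ by sending $\omega$ to the tuple of parts containing it. Normality and blow-ups. Let $M\leq\mathrm{Sym}(\Omega)$ be transitive and $\mathcal E$ an $M$-invariant Cartesian decomposition. $\mathcal E$ is $M$-normal if $M$ fixes each partition in $\mathcal E$ and $M=\prod_{\Gamma\in\mathcal E}M^\Gamma$, i.e. $M$, viewed as a group acting coordinatewise on $\prod_{\Gamma\in\mathcal E}\Gamma$, is the full direct product of the groups $M^\Gamma$ it induces on the coordinates; $M^\Gamma$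 is then identified with the subgroup of $M$ acting trivially on every $\Gamma'\in\mathcal E\setminus\{\Gamma\}$. A $G$-invariant Cartesian decomposition $\mathcal E$ is a blow-up decomposition for $G$ if it is transitive and there is a transitive normal subgroup $M$ of $G$ such that $\mathcal E$ is $M$-normal and $M^\Gamma=\mathrm{Soc}(G^\Gamma)$ for all $\Gamma\in\mathcal E$. In the formula $\mathrm{Soc}(G)=\prod_{\Gamma}\mathrm{Soc}(G^\Gamma)$, the right side is the group acting coordinatewise on $\prod_\Gamma\Gamma=\Omega$. Types. Let $G\leq\mathrm{Sym}(\Omega)$ be quasiprimitive, $M$ a minimal normal subgroup of $G$, $\omega\in\Omega$, and $M_\omega$ the stabiliser of $\omega$ in $M$. $G$ has type HA if $M$ is abelian (then $C_G(M)=M$). $G$ has type Sd if $M$ is non-abelian and non-simple, $C_G(M)=1$, and $M_\omega$ is a simple group that is a subdirect subgroup of $M$. $G$ has type Cd if $M$ is non-abelian and non-simple, $C_G(M)=1$, and $M_\omega$ is a non-simple subdirect subgroup of $M$. Here $M$ is a direct product $T_1\times\dots\times T_k$ of non-abelian simple groups, and a subgroup of $M$ is subdirect if it projects onto every $T_i$. *)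

theory Defs
  imports "HOL-Algebra.Algebra" "HOL-Library.Disjoint_Sets"
begin

text \<open>
  \<^const>\<open>BijGroup\<close> composes functions from right to left, so its multiplication is opposite to that of
  permutations acting on the right. None of the notions below depends on this choice.
\<close>

abbreviation perm_group :: "'a set \<Rightarrow> ('a \<Rightarrow> 'a) set \<Rightarrow> ('a \<Rightarrow> 'a) monoid" where
  "perm_group \<Omega> G \<equiv> (BijGroup \<Omega>)\<lparr>carrier := G\<rparr>"

definition transitive_on :: "('a \<Rightarrow> 'a) set \<Rightarrow> 'a set \<Rightarrow> bool" where
  "transitive_on G \<Omega> \<longleftrightarrow> (\<forall>x\<in>\<Omega>. \<forall>y\<in>\<Omega>. \<exists>g\<in>G. g x = y)"

definition minimal_normal :: "'a set \<Rightarrow> ('a, 'b) monoid_scheme \<Rightarrow> bool" where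
  "minimal_normal N H \<longleftrightarrow>
     N \<lhd> H \<and> N \<noteq> {\<one>\<^bsub>H\<^esub>} \<and> (\<forall>K. K \<lhd> H \<and> K \<subseteq> N \<longrightarrow> K = {\<one>\<^bsub>H\<^esub>} \<or> K = N)"

definition socle :: "('a, 'b) monoid_scheme \<Rightarrow> 'a set" where
  "socle H = generate H (\<Union>{N. minimal_normal N H})"

definition centralizer :: "('a, 'b) monoid_scheme \<Rightarrow> 'a set \<Rightarrow> 'a set" where
  "centralizer H M = {g \<in> carrier H. \<forall>m\<in>M. g \<otimes>\<^bsub>H\<^esub> m = m \<otimes>\<^bsub>H\<^esub> g}"

definition quasiprimitive :: "'a set \<Rightarrow> ('a \<Rightarrow> 'a) set \<Rightarrow> bool" where
  "quasiprimitive \<Omega> G \<longleftrightarrow>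
     subgroup G (BijGroup \<Omega>) \<and>
     (\<forall>N. N \<lhd> perm_group \<Omega> G \<and> N \<noteq> {\<one>\<^bsub>perm_group \<Omega> G\<^esub>} \<longrightarrow> transitive_on N \<Omega>)"


subsection \<open>Cartesian decompositions\<close>

definition proper_partition :: "'a set \<Rightarrow> 'a set set \<Rightarrow> bool" where
  "proper_partition \<Omega> \<Gamma> \<longleftrightarrow> partition_on \<Omega> \<Gamma> \<and> \<Gamma> \<noteq> {\<Omega>} \<and> \<Gamma> \<noteq> (\<lambda>\<omega>. {\<omega>}) ` \<Omega>"

definition cartesian_decomposition :: "'a set \<Rightarrow> 'a set set set \<Rightarrow> bool" where
  "cartesian_decomposition \<Omega> \<E> \<longleftrightarrow>
     finite \<E> \<and> \<E> \<noteq> {} \<and> (\<forall>\<Gamma>\<in>\<E>. proper_partition \<Omega> \<Gamma>) \<and>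
     (\<forall>\<gamma> \<in> (\<Pi>\<^sub>E \<Gamma>\<in>\<E>. \<Gamma>). card (\<Inter>\<Gamma>\<in>\<E>. \<gamma> \<Gamma>) = 1)"

definition homogeneous :: "'a set set set \<Rightarrow> bool" where
  "homogeneous \<E> \<longleftrightarrow> (\<forall>\<Gamma>\<in>\<E>. \<forall>\<Delta>\<in>\<E>. card \<Gamma> = card \<Delta>)"

definition move_partition :: "('a \<Rightarrow> 'a) \<Rightarrow> 'a set set \<Rightarrow> 'a set set" where
  "move_partition g \<Gamma> = (\<lambda>\<gamma>. g ` \<gamma>) ` \<Gamma>"

definition invariant_decomposition :: "('a \<Rightarrow> 'a) set \<Rightarrow> 'a set set set \<Rightarrow> bool" where
  "invariant_decomposition G \<E> \<longleftrightarrow> (\<forall>g\<in>G. move_partition g ` \<E> = \<E>)"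

definition transitive_decomposition :: "('a \<Rightarrow> 'a) set \<Rightarrow> 'a set set set \<Rightarrow> bool" where
  "transitive_decomposition G \<E> \<longleftrightarrow> (\<forall>\<Gamma>\<in>\<E>. \<forall>\<Delta>\<in>\<E>. \<exists>g\<in>G. move_partition g \<Gamma> = \<Delta>)"

definition component :: "('a \<Rightarrow> 'a) set \<Rightarrow> 'a set set \<Rightarrow> ('a set \<Rightarrow> 'a set) set" where
  "component G \<Gamma> = (\<lambda>g. \<lambda>\<gamma>\<in>\<Gamma>. g ` \<gamma>) ` {g \<in> G. move_partition g \<Gamma> = \<Gamma>}"

definition coords :: "'a set set set \<Rightarrow> 'a \<Rightarrow> 'a set set \<Rightarrow> 'a set" where
  "coords \<E> \<omega> = (\<lambda>\<Gamma>\<in>\<E>. THE \<gamma>. \<gamma> \<in> \<Gamma> \<and> \<omega> \<in> \<gamma>)"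

text \<open>
  The direct product of the groups \<open>H \<Gamma>\<close> on the parts of \<open>\<Gamma>\<close>, as a permutation group on \<open>\<Omega>\<close>: each tuple
  \<open>h\<close> acts coordinatewise under the identification of \<open>\<omega>\<close> with \<open>coords \<E> \<omega>\<close>.
\<close>

definition coordinatewise_product ::
  "'a set \<Rightarrow> 'a set set set \<Rightarrow> ('a set set \<Rightarrow> ('a set \<Rightarrow> 'a set) set) \<Rightarrow> ('a \<Rightarrow> 'a) set" where
  "coordinatewise_product \<Omega> \<E> H =
     {g \<in> Bij \<Omega>. \<exists>h \<in> (\<Pi>\<^sub>E \<Gamma>\<in>\<E>. H \<Gamma>).
        \<forall>\<omega>\<in>\<Omega>. coords \<E> (g \<omega>) = (\<lambda>\<Gamma>\<in>\<E>. h \<Gamma> (coords \<E> \<omega> \<Gamma>))}"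

definition normal_decomposition :: "'a set \<Rightarrow> ('a \<Rightarrow> 'a) set \<Rightarrow> 'a set set set \<Rightarrow> bool" where
  "normal_decomposition \<Omega> M \<E> \<longleftrightarrow>
     (\<forall>g\<in>M. \<forall>\<Gamma>\<in>\<E>. move_partition g \<Gamma> = \<Gamma>) \<and>
     M = coordinatewise_product \<Omega> \<E> (\<lambda>\<Gamma>. component M \<Gamma>)"

definition blow_up_decomposition :: "'a set \<Rightarrow> ('a \<Rightarrow> 'a) set \<Rightarrow> 'a set set set \<Rightarrow> bool" where
  "blow_up_decomposition \<Omega> G \<E> \<longleftrightarrow>
     cartesian_decomposition \<Omega> \<E> \<and> invariant_decomposition G \<E> \<and> transitive_decomposition G \<E> \<and>
     (\<exists>M. M \<lhd> perm_group \<Omega> G \<and> transitive_on M \<Omega> \<and> normal_decomposition \<Omega> M \<E> \<and>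
        (\<forall>\<Gamma>\<in>\<E>. component M \<Gamma> = socle (perm_group \<Gamma> (component G \<Gamma>))))"


subsection \<open>Types of quasiprimitive groups\<close>

text \<open>
  Internal direct product: \<open>\<pi>\<close> is the isomorphism onto the external product that is inverse to
  multiplication of components, so \<open>\<lambda>x. \<pi> x T\<close> is the projection onto the factor \<open>T\<close>. The last conjunct
  determines \<open>\<pi>\<close> on the carrier.
\<close>

definition direct_decomposition ::
  "('a, 'b) monoid_scheme \<Rightarrow> 'a set set \<Rightarrow> ('a \<Rightarrow> 'a set \<Rightarrow> 'a) \<Rightarrow> bool" where
  "direct_decomposition H \<T> \<pi> \<longleftrightarrow>
     finite \<T> \<and> (\<forall>T\<in>\<T>. subgroup T H) \<and>
     \<pi> \<in> iso H (product_group \<T> (\<lambda>T. H\<lparr>carrier := T\<rparr>)) \<and>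
     (\<forall>T\<in>\<T>. \<forall>t\<in>T. \<pi> t = (\<lambda>S\<in>\<T>. if S = T then t else \<one>\<^bsub>H\<^esub>))"

text \<open>
  A decomposition into non-abelian simple factors is unique, so the existential quantifier below does not
  leave a choice.
\<close>

definition subdirect :: "('a, 'b) monoid_scheme \<Rightarrow> 'a set \<Rightarrow> bool" where
  "subdirect H K \<longleftrightarrow>
     subgroup K H \<and>
     (\<exists>\<T> \<pi>. direct_decomposition H \<T> \<pi> \<and>
        (\<forall>T\<in>\<T>. simple_group (H\<lparr>carrier := T\<rparr>) \<and> \<not> comm_group (H\<lparr>carrier := T\<rparr>)) \<and>
        (\<forall>T\<in>\<T>. (\<lambda>x. \<pi> x T) ` K = T))"

abbreviation point_stabilizer :: "'a set \<Rightarrow> ('a \<Rightarrow> 'a) set \<Rightarrow> 'a \<Rightarrow> ('a \<Rightarrow> 'a) set" where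
  "point_stabilizer \<Omega> M \<omega> \<equiv> stabilizer (perm_group \<Omega> M) (\<lambda>g. g) \<omega>"

text \<open>
  In the next definitions \<open>M\<close> is transitive, so its point stabilisers are conjugate and the choice of \<open>\<omega>\<close>
  is immaterial; \<open>M\<close> is the only minimal normal subgroup, as it contains its centraliser.
\<close>

definition type_HA :: "'a set \<Rightarrow> ('a \<Rightarrow> 'a) set \<Rightarrow> bool" where
  "type_HA \<Omega> G \<longleftrightarrow>
     quasiprimitive \<Omega> G \<and>
     (\<exists>M. minimal_normal M (perm_group \<Omega> G) \<and> comm_group (perm_group \<Omega> M))"

definition type_Sd :: "'a set \<Rightarrow> ('a \<Rightarrow> 'a) set \<Rightarrow> bool" where
  "type_Sd \<Omega> G \<longleftrightarrow>
     quasiprimitive \<Omega> G \<and>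
     (\<exists>M. \<exists>\<omega>\<in>\<Omega>. minimal_normal M (perm_group \<Omega> G) \<and>
        \<not> comm_group (perm_group \<Omega> M) \<and> \<not> simple_group (perm_group \<Omega> M) \<and>
        centralizer (perm_group \<Omega> G) M = {\<one>\<^bsub>perm_group \<Omega> G\<^esub>} \<and>
        simple_group (perm_group \<Omega> (point_stabilizer \<Omega> M \<omega>)) \<and>
        subdirect (perm_group \<Omega> M) (point_stabilizer \<Omega> M \<omega>))"

definition type_Cd :: "'a set \<Rightarrow> ('a \<Rightarrow> 'a) set \<Rightarrow> bool" where
  "type_Cd \<Omega> G \<longleftrightarrow>
     quasiprimitive \<Omega> G \<and>
     (\<exists>M. \<exists>\<omega>\<in>\<Omega>. minimal_normal M (perm_group \<Omega> G) \<and>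
        \<not> comm_group (perm_group \<Omega> M) \<and> \<not> simple_group (perm_group \<Omega> M) \<and>
        centralizer (perm_group \<Omega> G) M = {\<one>\<^bsub>perm_group \<Omega> G\<^esub>} \<and>
        \<not> simple_group (perm_group \<Omega> (point_stabilizer \<Omega> M \<omega>)) \<and>
        subdirect (perm_group \<Omega> M) (point_stabilizer \<Omega> M \<omega>))"

end

theory Submission
  imports Defs
begin

text \<open>
  Let \<open>M\<close> be a normal subgroup of \<open>G\<close> acting on \<open>\<Omega>\<close> as the full product of its coordinate actions. Normal
  subgroups of the component \<open>G\<^sup>\<Gamma>\<close> inside \<open>M\<^sup>\<Gamma>\<close> then lift to normal subgroups of \<open>G\<close> inside \<open>M\<close>, and a
  normal subgroup of \<open>G\<close> whose projection to \<open>\<Gamma>\<close> contains a non-abelian minimal normal subgroup \<open>P\<close> of the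
  component contains the lift of \<open>P\<close>, because commutators with elements supported on \<open>\<Gamma>\<close> are again supported
  on \<open>\<Gamma>\<close>. Abelian minimal normal subgroups are transitive and hence self-centralising. This gives (a) and (b).

  For (c) and (d), let \<open>M = T\<^sub>1 \<times> \<dots> \<times> T\<^sub>k\<close> be minimal normal with subdirect point stabiliser \<open>M\<^sub>\<omega>\<close>. If \<open>M\<close> moved
  some partition, it would act faithfully on the \<open>l\<close> partitions, and \<open>|\<Omega>| = |\<Gamma>|\<^sup>l\<close> would divide \<open>l!\<close>, which is
  impossible. The stabiliser \<open>K\<close> in \<open>M\<close> of a part of \<open>\<Gamma>\<close> is subdirect, so it meets the product of the
  \<open>T\<^sub>i\<close> over two complementary subsets of the factors not in \<open>K\<close> trivially; hence the product of the orders of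
  the \<open>T\<^sub>i\<close> acting non-trivially on \<open>\<Gamma>\<close> is at most \<open>|\<Gamma>|\<^sup>2\<close>. Multiplying over all \<open>\<Gamma>\<close> shows that some
  \<open>T\<^sub>i\<close> acts non-trivially on at most one \<open>\<Gamma>\<close>, and by minimality of \<open>M\<close> all of them do, so the decomposition
  is \<open>M\<close>-normal and \<open>M\<^sub>\<omega>\<close> is a product over \<open>\<E>\<close> of non-trivial groups. Finally, subdirect subgroups are
  self-normalising, so \<open>M\<^sup>\<Gamma>\<close> has trivial centraliser and is the socle of \<open>G\<^sup>\<Gamma>\<close>.
\<close>

subsection \<open>Subgroups normalised by a subgroup\<close>

text \<open>In (a) and (b) the obstacle is an abelian minimal normal subgroup \<open>P\<close> of a
  component, because all commutators in it vanish. In (b) such a \<open>P\<close> would make the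
  component of type HA. In (a) \<open>P\<close> is transitive, so it contains every other minimal
  normal subgroup of its component; commutativity spreads from that coordinate to all others by
  conjugation, and \<open>M\<close> turns out to be abelian and minimal normal itself. For (c) and
  (d), each of the two complementary partial products meets \<open>K\<close> trivially, so its order
  is at most |M : K| = |\<Gamma>|; this is the origin of the exponent 2. The bound is just strong
  enough: if every factor moved at least two coordinates, then |M|^2 would be at most |\<Omega>|^2,
  so \<open>M\<close> would act regularly, whereas its point stabiliser projects onto non-trivial
  factors. The non-divisibility of l! by |\<Gamma>|^l comes from valuations: a prime occurs in l!
  with exponent less than l.\<close>

definition normal_within :: "('a, 'b) monoid_scheme \<Rightarrow> 'a set \<Rightarrow> 'a set \<Rightarrow> bool" where
  "normal_within B G N \<longleftrightarrow>
     subgroup N B \<and> N \<subseteq> G \<and> (\<forall>g\<in>G. \<forall>n\<in>N. g \<otimes>\<^bsub>B\<^esub> n \<otimes>\<^bsub>B\<^esub> inv\<^bsub>B\<^esub> g \<in> N)"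

lemma (in group) normal_iff_normal_within:
  assumes "subgroup H G"
  shows "N \<lhd> G\<lparr>carrier := H\<rparr> \<longleftrightarrow> normal_within G H N"
proof -
  interpret H: group "G\<lparr>carrier := H\<rparr>"
    using assms by (rule subgroup_imp_group)
  have inv_H: "inv\<^bsub>G\<lparr>carrier := H\<rparr>\<^esub> h = inv h" if "h \<in> H" for h
    using m_inv_consistent[OF assms that] .
  have "subgroup N (G\<lparr>carrier := H\<rparr>) \<longleftrightarrow> subgroup N G \<and> N \<subseteq> H"
  proof
    assume N: "subgroup N (G\<lparr>carrier := H\<rparr>)"
    show "subgroup N G \<and> N \<subseteq> H"
      using incl_subgroup[OF assms N] subgroup.subset[OF N] by simp
  next
    assume "subgroup N G \<and> N \<subseteq> H"
    then show "subgroup N (G\<lparr>carrier := H\<rparr>)"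
      using subgroup_incl assms by blast
  qed
  then show ?thesis
    by (auto simp: H.normal_inv_iff normal_within_def inv_H)
qed

lemma (in group) normal_within_Int:
  "normal_within G H A \<Longrightarrow> normal_within G H B \<Longrightarrow> normal_within G H (A \<inter> B)"
  by (auto simp: normal_within_def subgroups_Inter_pair)

text \<open>Cancellation in right-associated form: together with \<open>m_assoc\<close> these
  simplification rules decide the word identities between conjugates and commutators used
  throughout.\<close>

lemma (in group) inv_mult_cancel [simp]:
  assumes "a \<in> carrier G" "b \<in> carrier G"
  shows "inv a \<otimes> (a \<otimes> b) = b" "a \<otimes> (inv a \<otimes> b) = b"
  using assms by (simp_all flip: m_assoc)

lemma (in group) commute_inv:
  assumes "a \<in> carrier G" "t \<in> carrier G" "a \<otimes> t = t \<otimes> a"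
  shows "inv a \<otimes> t = t \<otimes> inv a"
proof -
  have "inv a \<otimes> t = inv a \<otimes> (t \<otimes> a) \<otimes> inv a" using assms(1,2) by (simp add: m_assoc)
  also have "\<dots> = inv a \<otimes> (a \<otimes> t) \<otimes> inv a" by (simp only: assms(3))
  finally show ?thesis using assms(1,2) by simp
qed

lemma (in group) commute_mult:
  assumes "a \<in> carrier G" "b \<in> carrier G" "t \<in> carrier G" "a \<otimes> t = t \<otimes> a" "b \<otimes> t = t \<otimes> b"
  shows "a \<otimes> b \<otimes> t = t \<otimes> (a \<otimes> b)"
proof -
  have "a \<otimes> b \<otimes> t = a \<otimes> (t \<otimes> b)" using assms by (simp add: m_assoc)
  also have "\<dots> = t \<otimes> a \<otimes> b" using assms by (simp add: m_assoc[symmetric])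
  finally show ?thesis using assms by (simp add: m_assoc)
qed

lemma (in group) conj_eq_if_commute:
  "t \<in> carrier G \<Longrightarrow> n \<in> carrier G \<Longrightarrow> t \<otimes> n = n \<otimes> t \<Longrightarrow> t \<otimes> n \<otimes> inv t = n"
  by (simp add: m_assoc)

lemma (in group) commute_if_commutator_one:
  assumes c: "a \<in> carrier G" "b \<in> carrier G" and "a \<otimes> b \<otimes> inv a \<otimes> inv b = \<one>"
  shows "a \<otimes> b = b \<otimes> a"
proof -
  have "a \<otimes> b = (a \<otimes> b \<otimes> inv a \<otimes> inv b) \<otimes> (b \<otimes> a)" using c by (simp add: m_assoc)
  then show ?thesis using assms by simp
qed

text \<open>The commutator of a and b can be bracketed as (a b a^-1) b^-1, which lies in
  \<open>B\<close>, or as a (b a^-1 b^-1), which lies in \<open>A\<close>; hence it is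
  trivial.\<close>

lemma (in group) normal_within_commute:
  assumes "normal_within G H A" "normal_within G H B" "A \<inter> B = {\<one>}" "a \<in> A" "b \<in> B"
  shows "a \<otimes> b = b \<otimes> a"
proof -
  have A: "subgroup A G" and B: "subgroup B G" using assms by (auto simp: normal_within_def)
  have c: "a \<in> carrier G" "b \<in> carrier G"
    using subgroup.mem_carrier[OF A assms(4)] subgroup.mem_carrier[OF B assms(5)] by auto
  have "a \<otimes> b \<otimes> inv a \<in> B"
    using assms by (auto simp: normal_within_def)
  then have 1: "a \<otimes> b \<otimes> inv a \<otimes> inv b \<in> B"
    using assms B by (simp add: subgroup.m_closed subgroup.m_inv_closed)
  have "b \<otimes> inv a \<otimes> inv b \<in> A"
    using assms A by (auto simp: normal_within_def subgroup.m_inv_closed)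
  then have "a \<otimes> (b \<otimes> inv a \<otimes> inv b) \<in> A"
    using assms A by (simp add: subgroup.m_closed)
  then have "a \<otimes> b \<otimes> inv a \<otimes> inv b \<in> A"
    using c by (simp add: m_assoc)
  then have "a \<otimes> b \<otimes> inv a \<otimes> inv b = \<one>" using 1 assms by blast
  then show ?thesis using c by (rule_tac commute_if_commutator_one)
qed

lemma (in group) minimal_normal_within:
  assumes "subgroup H G"
  shows "minimal_normal N (G\<lparr>carrier := H\<rparr>) \<longleftrightarrow>
    normal_within G H N \<and> N \<noteq> {\<one>} \<and>
    (\<forall>K. normal_within G H K \<and> K \<subseteq> N \<longrightarrow> K = {\<one>} \<or> K = N)"
  using assms by (simp add: minimal_normal_def normal_iff_normal_within)

lemma (in group) minimal_normal_within_exists: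
  assumes H: "subgroup H G" and "normal_within G H N" "N \<noteq> {\<one>}" "finite N"
  obtains P where "minimal_normal P (G\<lparr>carrier := H\<rparr>)" "P \<subseteq> N"
proof -
  let ?Q = "\<lambda>K. normal_within G H K \<and> K \<noteq> {\<one>} \<and> K \<subseteq> N"
  obtain P where P: "?Q P" "\<And>K. ?Q K \<Longrightarrow> card P \<le> card K"
    using ex_has_least_nat[of ?Q N card] assms by blast
  have "K = {\<one>} \<or> K = P" if "normal_within G H K" "K \<subseteq> P" for K
    using that P assms(4) by (metis card_seteq finite_subset order_trans)
  then show thesis
    using P(1) by (intro that[of P]) (auto simp: minimal_normal_within[OF H])
qed

lemma (in group) card_mult_le_if_trivial_Int:
  assumes "finite (carrier G)" "subgroup A G" "subgroup B G" "A \<inter> B = {\<one>}"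
  shows "card A * card B \<le> card (carrier G)"
proof -
  have "inj_on (\<lambda>(a, b). a \<otimes> b) (A \<times> B)"
  proof (rule inj_onI, clarify)
    fix a b c d assume h: "a \<in> A" "b \<in> B" "c \<in> A" "d \<in> B" "a \<otimes> b = c \<otimes> d"
    have car: "a \<in> carrier G" "b \<in> carrier G" "c \<in> carrier G" "d \<in> carrier G"
      using h subgroup.mem_carrier[OF assms(2)] subgroup.mem_carrier[OF assms(3)] by auto
    have "inv c \<otimes> a = d \<otimes> inv b"
      using h(5) car by (metis inv_closed inv_solve_left inv_solve_right m_assoc m_closed)
    moreover have "inv c \<otimes> a \<in> A" "d \<otimes> inv b \<in> B"
      using h assms by (simp_all add: subgroup.m_closed subgroup.m_inv_closed)
    ultimately have "inv c \<otimes> a = \<one>" "d \<otimes> inv b = \<one>"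
      using assms(4) by auto
    then show "a = c \<and> b = d"
      using car by (metis inv_closed inv_equality inv_inv)
  qed
  moreover have "(\<lambda>(a, b). a \<otimes> b) ` (A \<times> B) \<subseteq> carrier G"
    using subgroup.mem_carrier[OF assms(2)] subgroup.mem_carrier[OF assms(3)] by auto
  ultimately have "card (A \<times> B) \<le> card (carrier G)"
    using assms(1) by (metis card_image card_mono)
  then show ?thesis by (simp add: card_cartesian_product)
qed

subsection \<open>Products of non-abelian simple groups\<close>

text \<open>An internal direct product seen through its projections, taken as endomorphisms of
  \<open>H\<close> so that no function-valued product group appears in calculations. By
  \<open>proj_separate\<close> the projections have trivial common kernel, so equations can be
  checked factor by factor; that \<open>H\<close> is the whole product then follows by counting in
  \<open>card_span\<close>.\<close>

locale simple_product = group H for H (structure) +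
  fixes \<T> :: "'a set set" and p :: "'a set \<Rightarrow> 'a \<Rightarrow> 'a"
  assumes fin: "finite (carrier H)"
    and factor_subgroup: "T \<in> \<T> \<Longrightarrow> subgroup T H"
    and factor_simple: "T \<in> \<T> \<Longrightarrow> simple_group (H\<lparr>carrier := T\<rparr>)"
    and factor_nonabelian: "T \<in> \<T> \<Longrightarrow> \<not> comm_group (H\<lparr>carrier := T\<rparr>)"
    and proj_in: "T \<in> \<T> \<Longrightarrow> x \<in> carrier H \<Longrightarrow> p T x \<in> T"
    and proj_mult: "T \<in> \<T> \<Longrightarrow> x \<in> carrier H \<Longrightarrow> y \<in> carrier H \<Longrightarrow> p T (x \<otimes> y) = p T x \<otimes> p T y"
    and proj_self: "T \<in> \<T> \<Longrightarrow> t \<in> T \<Longrightarrow> p T t = t"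
    and proj_other: "T \<in> \<T> \<Longrightarrow> S \<in> \<T> \<Longrightarrow> S \<noteq> T \<Longrightarrow> t \<in> S \<Longrightarrow> p T t = \<one>"
    and proj_separate: "x \<in> carrier H \<Longrightarrow> (\<And>T. T \<in> \<T> \<Longrightarrow> p T x = \<one>) \<Longrightarrow> x = \<one>"
begin

lemma factor_carrier: "T \<in> \<T> \<Longrightarrow> t \<in> T \<Longrightarrow> t \<in> carrier H"
  by (rule subgroup.mem_carrier[OF factor_subgroup])

lemma finite_factors: "finite \<T>"
proof (rule finite_subset)
  show "\<T> \<subseteq> Pow (carrier H)" using factor_carrier by auto
qed (simp add: fin)

lemma proj_carrier: "T \<in> \<T> \<Longrightarrow> x \<in> carrier H \<Longrightarrow> p T x \<in> carrier H"
  using factor_carrier proj_in by blast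

lemma proj_hom: "T \<in> \<T> \<Longrightarrow> group_hom H H (p T)"
  by (simp add: group_hom_def group_hom_axioms_def is_group hom_def proj_carrier proj_mult)

lemma proj_one: "T \<in> \<T> \<Longrightarrow> p T \<one> = \<one>"
  using group_hom.hom_one[OF proj_hom] .

lemma proj_inv: "T \<in> \<T> \<Longrightarrow> x \<in> carrier H \<Longrightarrow> p T (inv x) = inv (p T x)"
  using group_hom.hom_inv[OF proj_hom] .

lemma proj_eqI:
  assumes "x \<in> carrier H" "y \<in> carrier H" "\<And>T. T \<in> \<T> \<Longrightarrow> p T x = p T y"
  shows "x = y"
proof -
  have "x \<otimes> inv y = \<one>"
    using assms by (rule_tac proj_separate) (auto simp: proj_mult proj_inv proj_carrier)
  then show ?thesis using assms by (metis inv_closed inv_equality inv_inv)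
qed

lemma factor_normal_subset:
  assumes T: "T \<in> \<T>" and N: "subgroup N H" "N \<subseteq> T" "\<And>t n. t \<in> T \<Longrightarrow> n \<in> N \<Longrightarrow> t \<otimes> n \<otimes> inv t \<in> N"
  shows "N = {\<one>} \<or> N = T"
proof -
  have "N \<lhd> H\<lparr>carrier := T\<rparr>"
    using assms by (simp add: normal_iff_normal_within[OF factor_subgroup[OF T]] normal_within_def)
  then show ?thesis
    using simple_group.no_real_normal_subgroup[OF factor_simple[OF T]] by auto
qed

lemma factor_nontrivial: "T \<in> \<T> \<Longrightarrow> T \<noteq> {\<one>}"
  using simple_group.simple_not_triv[OF factor_simple] by auto

lemma factor_noncommuting:
  assumes T: "T \<in> \<T>"
  obtains s t where "s \<in> T" "t \<in> T" "s \<otimes> t \<noteq> t \<otimes> s"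
proof -
  interpret T: group "H\<lparr>carrier := T\<rparr>"
    using factor_subgroup[OF T] by (rule subgroup_imp_group)
  show thesis
    using that T.group_comm_groupI factor_nonabelian[OF T] by auto
qed

text \<open>The centre \<open>?Z\<close> of \<open>T\<close> is normal in the simple group
  \<open>T\<close>, and it is not all of \<open>T\<close> because \<open>T\<close> is
  non-abelian.\<close>

lemma factor_center:
  assumes T: "T \<in> \<T>" and s: "s \<in> T" "\<And>t. t \<in> T \<Longrightarrow> s \<otimes> t = t \<otimes> s"
  shows "s = \<one>"
proof -
  let ?Z = "{s \<in> T. \<forall>t\<in>T. s \<otimes> t = t \<otimes> s}"
  note sub = factor_subgroup[OF T] and car = factor_carrier[OF T]
  have "subgroup ?Z H"
  proof (rule subgroupI)
    fix a assume a: "a \<in> ?Z"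
    have "inv a \<otimes> t = t \<otimes> inv a" if t: "t \<in> T" for t
      using a t by (intro commute_inv) (auto simp: car)
    then show "inv a \<in> ?Z" using a subgroup.m_inv_closed[OF sub] by blast
  next
    fix a b assume ab: "a \<in> ?Z" "b \<in> ?Z"
    have "a \<otimes> b \<otimes> t = t \<otimes> (a \<otimes> b)" if t: "t \<in> T" for t
      using ab t by (intro commute_mult) (auto simp: car)
    then show "a \<otimes> b \<in> ?Z" using ab subgroup.m_closed[OF sub] by blast
  next
    have "\<one> \<in> ?Z" using subgroup.one_closed[OF sub] car by simp
    then show "?Z \<noteq> {}" by blast
  qed (use car in auto)
  moreover have "t \<otimes> n \<otimes> inv t \<in> ?Z" if "t \<in> T" "n \<in> ?Z" for t n
  proof -
    have "t \<otimes> n \<otimes> inv t = n"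
      using that by (intro conj_eq_if_commute) (auto simp: car)
    then show ?thesis using that by simp
  qed
  ultimately have "?Z = {\<one>} \<or> ?Z = T"
    by (intro factor_normal_subset[OF T]) auto
  moreover have "?Z \<noteq> T"
    using factor_noncommuting[OF T] by (metis (mono_tags, lifting) mem_Collect_eq)
  ultimately show ?thesis using s by blast
qed

text \<open>The components of \<open>x\<close> outside \<open>T\<close> commute with
  \<open>T\<close>, so only its \<open>T\<close>-component conjugates. Consequently conjugation by
  any subgroup projecting onto \<open>T\<close> induces all inner automorphisms of
  \<open>T\<close>.\<close>

lemma conj_factor:
  assumes T: "T \<in> \<T>" and x: "x \<in> carrier H" and t: "t \<in> T"
  shows "x \<otimes> t \<otimes> inv x = p T x \<otimes> t \<otimes> inv (p T x)"
proof (rule proj_eqI)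
  note c = factor_carrier[OF T t] proj_carrier[OF T x]
  show "x \<otimes> t \<otimes> inv x \<in> carrier H" "p T x \<otimes> t \<otimes> inv (p T x) \<in> carrier H"
    using x c by auto
  fix S assume S: "S \<in> \<T>"
  show "p S (x \<otimes> t \<otimes> inv x) = p S (p T x \<otimes> t \<otimes> inv (p T x))"
  proof (cases "S = T")
    case True
    then show ?thesis
      using x c S t proj_in[OF S x] by (simp add: proj_mult proj_inv proj_carrier proj_self)
  next
    case False
    then show ?thesis
      using x c S t T proj_in[OF T x] proj_other[OF S T]
      by (simp add: proj_mult proj_inv proj_carrier)
  qed
qed

lemma factor_conj_closed:
  assumes "T \<in> \<T>" "x \<in> carrier H" "t \<in> T"
  shows "x \<otimes> t \<otimes> inv x \<in> T"
  using assms factor_subgroup[OF assms(1)] proj_in[OF assms(1,2)]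
  by (simp add: conj_factor subgroup.m_closed subgroup.m_inv_closed)

text \<open>Choose \<open>t\<close> in \<open>T\<close> not commuting with the
  \<open>T\<close>-component of \<open>x\<close>. The commutator of \<open>x\<close> and
  \<open>t\<close> is a non-trivial element of \<open>N \<inter> T\<close>, which is normal in the
  simple group \<open>T\<close>. This replaces the classification of the normal subgroups of a
  product of non-abelian simple groups.\<close>

lemma factor_subset_normal:
  assumes T: "T \<in> \<T>" and N: "normal_within H (carrier H) N"
    and x: "x \<in> N" "p T x \<noteq> \<one>"
  shows "T \<subseteq> N"
proof -
  have Ns: "subgroup N H" using N by (simp add: normal_within_def)
  have xc: "x \<in> carrier H" using subgroup.mem_carrier[OF Ns x(1)] .
  note sub = factor_subgroup[OF T] and car = factor_carrier[OF T]
  obtain t where t: "t \<in> T" "p T x \<otimes> t \<noteq> t \<otimes> p T x"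
    using factor_center[OF T proj_in[OF T xc]] x(2) by blast
  have tc: "t \<in> carrier H" "p T x \<in> carrier H" using car t T xc proj_carrier by auto
  have "t \<otimes> inv x \<otimes> inv t \<in> N"
    using N x tc subgroup.m_inv_closed[OF Ns] by (auto simp: normal_within_def)
  then have "x \<otimes> (t \<otimes> inv x \<otimes> inv t) \<in> N"
    using x Ns by (simp add: subgroup.m_closed)
  then have c: "x \<otimes> t \<otimes> inv x \<otimes> inv t \<in> N \<inter> T"
    using xc tc subgroup.m_closed[OF sub factor_conj_closed[OF T xc t(1)] subgroup.m_inv_closed[OF sub t(1)]]
    by (simp add: m_assoc)
  have "x \<otimes> t \<otimes> inv x \<otimes> inv t \<noteq> \<one>"
  proof
    assume "x \<otimes> t \<otimes> inv x \<otimes> inv t = \<one>"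
    then have "p T x \<otimes> t \<otimes> inv (p T x) \<otimes> inv t = \<one>"
      using conj_factor[OF T xc t(1)] by simp
    then show False using t(2) commute_if_commutator_one[OF tc(2,1)] by blast
  qed
  moreover have "N \<inter> T = {\<one>} \<or> N \<inter> T = T"
    using T Ns sub N tc car
    by (intro factor_normal_subset[OF T])
      (auto simp: subgroups_Inter_pair normal_within_def subgroup.m_closed subgroup.m_inv_closed)
  ultimately show ?thesis using c by blast
qed

text \<open>The partial product of the factors in \<open>J\<close>, described by vanishing
  coordinates: normality and intersections become immediate. That it is also generated by those
  factors is \<open>span_subset_subgroup\<close>.\<close>

definition span :: "'a set set \<Rightarrow> 'a set" where
  "span J = {x \<in> carrier H. \<forall>T\<in>\<T> - J. p T x = \<one>}"

lemma span_normal: "normal_within H (carrier H) (span J)"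
proof -
  have "subgroup (span J) H"
    by (rule subgroupI) (auto simp: span_def proj_mult proj_inv proj_one)
  then show ?thesis
    by (auto simp: normal_within_def span_def proj_mult proj_inv proj_carrier)
qed

lemma span_subgroup: "subgroup (span J) H"
  using span_normal by (simp add: normal_within_def)

lemma span_empty: "span {} = {\<one>}"
  using proj_separate by (auto simp: span_def proj_one)

lemma factor_subset_span: "T \<in> J \<Longrightarrow> J \<subseteq> \<T> \<Longrightarrow> T \<subseteq> span J"
  using factor_carrier[of T] proj_other[of _ T] by (auto simp: span_def)

lemma span_remove:
  assumes "T \<in> \<T>" "x \<in> span (insert T J)"
  shows "inv (p T x) \<otimes> x \<in> span J"
proof -
  have x: "x \<in> carrier H" using assms(2) by (simp add: span_def)
  note px = proj_in[OF assms(1) x] proj_carrier[OF assms(1) x]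
  have "p S (inv (p T x) \<otimes> x) = \<one>" if S: "S \<in> \<T>" "S \<notin> J" for S
  proof (cases "S = T")
    case True
    then show ?thesis using assms x px by (simp add: proj_mult proj_inv proj_self)
  next
    case False
    then show ?thesis
      using assms x px S proj_other[OF S(1) assms(1)] by (simp add: proj_mult proj_inv span_def)
  qed
  then show ?thesis using x px by (simp add: span_def)
qed

text \<open>Induction on \<open>J\<close>: dividing by the \<open>T\<close>-component of an element
  of the larger span leaves an element of the smaller one.\<close>

lemma span_subset_subgroup:
  assumes "J \<subseteq> \<T>" "subgroup A H" "\<And>T. T \<in> J \<Longrightarrow> T \<subseteq> A"
  shows "span J \<subseteq> A"
proof -
  have "finite J" using assms(1) finite_factors finite_subset by blast
  then show ?thesis using assms
  proof (induction J)
    case empty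
    then show ?case by (simp add: span_empty subgroup.one_closed)
  next
    case (insert T J)
    show ?case
    proof
      fix x assume x: "x \<in> span (insert T J)"
      have T: "T \<in> \<T>" using insert by auto
      have xc: "x \<in> carrier H" using x by (simp add: span_def)
      have "inv (p T x) \<otimes> x \<in> A" "p T x \<in> A"
        using span_remove[OF T x] insert proj_in[OF T xc] by blast+
      then have "p T x \<otimes> (inv (p T x) \<otimes> x) \<in> A"
        using insert by (simp add: subgroup.m_closed)
      then show "x \<in> A" using xc proj_carrier[OF T xc] by (simp add: m_assoc[symmetric])
    qed
  qed
qed

lemma span_all: "span \<T> = carrier H"
  by (auto simp: span_def)

lemma card_span: "J \<subseteq> \<T> \<Longrightarrow> card (span J) = (\<Prod>T\<in>J. card T)"
proof -
  assume "J \<subseteq> \<T>"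
  then have "finite J" using finite_factors finite_subset by blast
  then show ?thesis using \<open>J \<subseteq> \<T>\<close>
  proof (induction J)
    case empty
    then show ?case by (simp add: span_empty)
  next
    case (insert T J)
    then have T: "T \<in> \<T>" "J \<subseteq> \<T>" by auto
    have "bij_betw (\<lambda>(t, y). t \<otimes> y) (T \<times> span J) (span (insert T J))"
    proof (rule bij_betw_byWitness[where f' = "\<lambda>x. (p T x, inv (p T x) \<otimes> x)"])
      show "\<forall>a\<in>T \<times> span J. (p T (case a of (t, y) \<Rightarrow> t \<otimes> y),
          inv p T (case a of (t, y) \<Rightarrow> t \<otimes> y) \<otimes> (case a of (t, y) \<Rightarrow> t \<otimes> y)) = a"
        using insert.hyps(2) T(1) factor_carrier[OF T(1)]
        by (auto simp: span_def proj_mult proj_self m_assoc[symmetric])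
      show "\<forall>a'\<in>span (insert T J). (case (p T a', inv p T a' \<otimes> a') of (t, y) \<Rightarrow> t \<otimes> y) = a'"
        using T(1) proj_carrier[OF T(1)] by (auto simp: span_def m_assoc[symmetric])
      show "(\<lambda>(t, y). t \<otimes> y) ` (T \<times> span J) \<subseteq> span (insert T J)"
      proof clarify
        fix t y assume t: "t \<in> T" and y: "y \<in> span J"
        have o: "p S t = \<one>" if "S \<in> \<T> - insert T J" for S
          using proj_other[OF _ T(1) _ t, of S] that by blast
        show "t \<otimes> y \<in> span (insert T J)"
          using y factor_carrier[OF T(1) t] o by (simp add: span_def proj_mult)
      qed
      show "(\<lambda>x. (p T x, inv p T x \<otimes> x)) ` span (insert T J) \<subseteq> T \<times> span J"
        using span_remove[OF T(1)] proj_in[OF T(1)] by (auto simp: span_def)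
    qed
    from bij_betw_same_card[OF this] show ?case
      using insert T by (simp add: card_cartesian_product)
  qed
qed

section \<open>Subgroups projecting onto the simple factors\<close>

lemma normal_within_Int_span:
  assumes "subgroup K H"
  shows "normal_within H K (K \<inter> span J)"
  using assms span_normal[of J] subgroup.subset[OF assms]
  by (auto simp: normal_within_def subgroups_Inter_pair subgroup.m_closed subgroup.m_inv_closed)

text \<open>Every element of \<open>T\<close> is the projection of an element of \<open>K\<close>,
  so a subgroup normalised by \<open>K\<close> has an image normalised by \<open>T\<close>.\<close>

lemma proj_image_normalised:
  assumes T: "T \<in> \<T>" and K: "p T ` K = T" and N: "normal_within H K N" and Kc: "K \<subseteq> carrier H"
  shows "p T ` N = {\<one>} \<or> p T ` N = T"
proof (rule factor_normal_subset[OF T])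
  have Ns: "subgroup N H" and NK: "N \<subseteq> K" using N by (auto simp: normal_within_def)
  show "subgroup (p T ` N) H"
    using group_hom.subgroup_img_is_subgroup[OF proj_hom[OF T] Ns] .
  show "p T ` N \<subseteq> T" using K NK by blast
  fix t n assume t: "t \<in> T" and n: "n \<in> p T ` N"
  obtain k where k: "k \<in> K" "t = p T k" using t K by blast
  obtain m where m: "m \<in> N" "n = p T m" using n by blast
  have "t \<otimes> n \<otimes> inv t = p T (k \<otimes> m \<otimes> inv k)"
    using k m Kc NK T by (auto simp: proj_mult proj_inv subset_eq)
  then show "t \<otimes> n \<otimes> inv t \<in> p T ` N"
    using N k m by (auto simp: normal_within_def)
qed

text \<open>\<open>K \<inter> T\<close> is normalised by \<open>K\<close>, hence by \<open>T\<close>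
  since \<open>K\<close> projects onto \<open>T\<close>; the projection fixes it pointwise, so
  simplicity of \<open>T\<close> applies to the intersection itself.\<close>

lemma Int_factor_trivial:
  assumes T: "T \<in> \<T>" and K: "subgroup K H" "p T ` K = T" and "\<not> T \<subseteq> K"
  shows "K \<inter> T = {\<one>}"
proof -
  have "normal_within H K (K \<inter> T)"
    using K(1) factor_subgroup[OF T] subgroup.subset[OF K(1)] factor_conj_closed[OF T]
    by (auto simp: normal_within_def subgroups_Inter_pair subgroup.m_closed subgroup.m_inv_closed)
  moreover have "p T ` (K \<inter> T) = K \<inter> T"
    using proj_self[OF T] by force
  ultimately show ?thesis
    using proj_image_normalised[OF T K(2) _ subgroup.subset[OF K(1)], of "K \<inter> T"] assms(4) by auto
qed

text \<open>
  A subdirect subgroup is a product of twisted diagonals over the blocks of a partition of the factors.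
  The set \<open>J\<close> omits exactly one factor of each block.
\<close>

lemma subdirect_complement:
  assumes K: "subgroup K H" and surj: "\<And>T. T \<in> \<T> \<Longrightarrow> p T ` K = T"
  obtains J where "J \<subseteq> {T \<in> \<T>. \<not> T \<subseteq> K}" "K \<inter> span J = {\<one>}"
    "K \<inter> span ({T \<in> \<T>. \<not> T \<subseteq> K} - J) = {\<one>}"
    "\<forall>x\<in>carrier H. \<exists>k\<in>K. \<exists>y\<in>span J. x = k \<otimes> y"
proof -
  define S where "S = {T \<in> \<T>. \<not> T \<subseteq> K}"
  note Kc = subgroup.subset[OF K] and K1 = subgroup.one_closed[OF K]
  have finS: "finite S" and ST: "S \<subseteq> \<T>" using finite_factors by (auto simp: S_def)
  \<comment> \<open>A maximal \<open>J\<close> with this property is the required transversal: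
    adding one more factor from \<open>S\<close> must create a non-trivial intersection with
    \<open>K\<close>.\<close>
  let ?\<J> = "{J. J \<subseteq> S \<and> K \<inter> span J = {\<one>}}"
  have "\<exists>J\<in>?\<J>. \<forall>J'\<in>?\<J>. J \<subseteq> J' \<longrightarrow> J = J'"
  proof (rule finite_has_maximal)
    show "finite ?\<J>" using finS by simp
    have "{} \<in> ?\<J>" using K1 by (simp add: span_empty)
    then show "?\<J> \<noteq> {}" by (metis empty_iff)
  qed
  then obtain J where J: "J \<in> ?\<J>" and max: "\<And>J'. J' \<in> ?\<J> \<Longrightarrow> J \<subseteq> J' \<Longrightarrow> J = J'"
    by (metis (no_types, lifting))
  have JS: "J \<subseteq> S" and KJ: "K \<inter> span J = {\<one>}" using J by auto
  \<comment> \<open>For \<open>T\<close> in \<open>S - J\<close> this is the diagonal subgroup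
    joining \<open>T\<close> to factors in \<open>J\<close>. By maximality it is non-trivial, and
    its elements with trivial \<open>T\<close>-component lie in
    \<open>K \<inter> span J = {\<one>}\<close>; so it projects non-trivially, and then onto,
    \<open>T\<close>.\<close>
  define D where "D T = K \<inter> span (insert T J)" for T
  have nD: "normal_within H K (D T)" for T
    unfolding D_def by (rule normal_within_Int_span[OF K])
  have D_onto: "p T ` D T = T" if T: "T \<in> S - J" for T
  proof -
    have T': "T \<in> \<T>" using T ST by blast
    have "D T \<noteq> {\<one>}"
    proof
      assume "D T = {\<one>}"
      then have "insert T J \<in> ?\<J>" using T JS by (auto simp: D_def)
      then have "J = insert T J" by (rule max) blast
      then show False using T by blast
    qed
    moreover have "\<one> \<in> D T" using nD[of T] by (simp add: normal_within_def subgroup.one_closed)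
    ultimately obtain d where d: "d \<in> D T" "d \<noteq> \<one>" by blast
    have "p T d \<noteq> \<one>"
    proof
      assume "p T d = \<one>"
      then have "d \<in> K \<inter> span J" using d(1) unfolding D_def span_def by blast
      then show False using KJ d by blast
    qed
    then show ?thesis
      using proj_image_normalised[OF T' surj[OF T'] nD Kc] d(1) by blast
  qed
  have "K \<inter> span (S - J) = {\<one>}"
  proof -
    have "z = \<one>" if z: "z \<in> K \<inter> span (S - J)" for z
    proof (rule proj_separate)
      show zc: "z \<in> carrier H" using z Kc by blast
      fix T assume T: "T \<in> \<T>"
      show "p T z = \<one>"
      proof (cases "T \<in> S - J")
        case False
        then show ?thesis using z T by (simp add: span_def)
      next
        case TJ: True
        \<comment> \<open>The index sets \<open>insert T J\<close> and \<open>S - J\<close> share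
          only \<open>T\<close>, so a common element lies in \<open>K \<inter> T\<close>, which is
          trivial as \<open>T\<close> is not contained in \<open>K\<close>.\<close>
        have "D T \<inter> (K \<inter> span (S - J)) = {\<one>}"
        proof -
          have "x = \<one>" if x: "x \<in> D T" "x \<in> span (S - J)" for x
          proof -
            have xc: "x \<in> carrier H" and xK: "x \<in> K" using x Kc by (auto simp: D_def)
            have "x = p T x"
            proof (rule proj_eqI[OF xc proj_carrier[OF T xc]])
              fix U assume U: "U \<in> \<T>"
              show "p U x = p U (p T x)"
              proof (cases "U = T")
                case True
                then show ?thesis using proj_self[OF T proj_in[OF T xc]] by simp
              next
                case False
                then have "U \<in> \<T> - insert T J \<or> U \<in> \<T> - (S - J)" using U by blast
                then have "p U x = \<one>" using x unfolding D_def span_def by blast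
                then show ?thesis using proj_other[OF U T _ proj_in[OF T xc]] False by auto
              qed
            qed
            then have "x \<in> K \<inter> T" using xK proj_in[OF T xc] by simp
            then show ?thesis
              using Int_factor_trivial[OF T K surj[OF T]] TJ by (auto simp: S_def)
          qed
          moreover have "\<one> \<in> D T \<inter> (K \<inter> span (S - J))"
            using K1 subgroup.one_closed[OF span_subgroup] by (simp add: D_def)
          ultimately show ?thesis by blast
        qed
        \<comment> \<open>Both subgroups are normalised by \<open>K\<close> and meet trivially, so
          they commute; as \<open>D T\<close> projects onto \<open>T\<close>, the
          \<open>T\<close>-component of \<open>z\<close> is central in \<open>T\<close>.\<close>
        then have comm: "d \<otimes> z = z \<otimes> d" if "d \<in> D T" for d
          using normal_within_commute[OF nD normal_within_Int_span[OF K] _ that z] by blast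
        show ?thesis
        proof (rule factor_center[OF T proj_in[OF T zc]])
          fix t assume "t \<in> T"
          then obtain d where d: "d \<in> D T" "t = p T d" using D_onto[OF TJ] by blast
          have dc: "d \<in> carrier H" using d Kc by (auto simp: D_def)
          show "p T z \<otimes> t = t \<otimes> p T z"
            using comm[OF d(1)] d(2) proj_mult[OF T zc dc] proj_mult[OF T dc zc] by simp
        qed
      qed
    qed
    then show ?thesis using K1 subgroup.one_closed[OF span_subgroup] by blast
  qed
  moreover have "\<exists>k\<in>K. \<exists>y\<in>span J. x = k \<otimes> y" if x: "x \<in> carrier H" for x
  proof -
    \<comment> \<open>This product set is a subgroup because \<open>span J\<close> is normal; it
      remains to see that it contains every factor.\<close>
    let ?A = "{k \<otimes> y | k y. k \<in> K \<and> y \<in> span J}"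
    note Jc = subgroup.subset[OF span_subgroup[of J]] and J1 = subgroup.one_closed[OF span_subgroup[of J]]
    have norm: "g \<otimes> y \<otimes> inv g \<in> span J" if "g \<in> carrier H" "y \<in> span J" for g y
      using span_normal[of J] that by (simp add: normal_within_def)
    have "subgroup ?A H"
    proof (rule subgroupI)
      show "?A \<subseteq> carrier H" using Kc Jc by auto
      show "?A \<noteq> {}" using K1 J1 by blast
      fix a assume "a \<in> ?A"
      then obtain k y where ky: "a = k \<otimes> y" "k \<in> K" "y \<in> span J" by blast
      have c: "k \<in> carrier H" "y \<in> carrier H" using ky Kc Jc by auto
      have "inv a = inv k \<otimes> (k \<otimes> inv y \<otimes> inv k)"
        using c ky by (simp add: inv_mult_group m_assoc)
      moreover have "k \<otimes> inv y \<otimes> inv k \<in> span J"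
        using c ky norm by (simp add: subgroup.m_inv_closed[OF span_subgroup])
      ultimately show "inv a \<in> ?A" using subgroup.m_inv_closed[OF K ky(2)] by blast
      fix b assume "b \<in> ?A"
      then obtain l z where lz: "b = l \<otimes> z" "l \<in> K" "z \<in> span J" by blast
      have c': "l \<in> carrier H" "z \<in> carrier H" using lz Kc Jc by auto
      have "a \<otimes> b = (k \<otimes> l) \<otimes> ((inv l \<otimes> y \<otimes> inv (inv l)) \<otimes> z)"
        using c c' ky lz by (simp add: m_assoc)
      moreover have "(inv l \<otimes> y \<otimes> inv (inv l)) \<otimes> z \<in> span J"
        using c' ky lz norm[of "inv l" y] by (simp add: subgroup.m_closed[OF span_subgroup])
      ultimately show "a \<otimes> b \<in> ?A" using subgroup.m_closed[OF K ky(2) lz(2)] by blast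
    qed
    moreover have "T \<subseteq> ?A" if T: "T \<in> \<T>" for T
    proof
      fix t assume t: "t \<in> T"
      have tc: "t \<in> carrier H" using factor_carrier[OF T t] .
      consider "t \<in> K" | "T \<in> J" | "T \<in> S - J" using t T by (auto simp: S_def)
      then show "t \<in> ?A"
      proof cases
        case 1
        moreover have "t = t \<otimes> \<one>" using tc by simp
        ultimately show ?thesis using J1 by blast
      next
        case 2
        then have "t \<in> span J" using factor_subset_span[of T J] JS ST t by blast
        moreover have "t = \<one> \<otimes> t" using tc by simp
        ultimately show ?thesis using K1 by blast
      next
        case 3
        \<comment> \<open>The diagonal element \<open>d\<close> of \<open>K\<close> agrees with
          \<open>t\<close> in coordinate \<open>T\<close>, and the discrepancy
          \<open>inv t \<otimes> d\<close> lies in \<open>span J\<close>.\<close>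
        obtain d where d: "d \<in> D T" "t = p T d" using D_onto[OF 3] t by blast
        have dK: "d \<in> K" and dc: "d \<in> carrier H" and ds: "d \<in> span (insert T J)"
          using d Kc by (auto simp: D_def)
        have y: "inv t \<otimes> d \<in> span J" using span_remove[OF T ds] d by simp
        have "d \<otimes> inv (inv t \<otimes> d) \<in> ?A"
          using dK subgroup.m_inv_closed[OF span_subgroup y] by blast
        moreover have "d \<otimes> inv (inv t \<otimes> d) = t"
          using tc dc by (simp add: inv_mult_group)
        ultimately show ?thesis by simp
      qed
    qed
    ultimately have "span \<T> \<subseteq> ?A" by (intro span_subset_subgroup) auto
    then show ?thesis using x span_all by blast
  qed
  ultimately show thesis
    using that[of J] JS KJ unfolding S_def by blast
qed

text \<open>With \<open>J\<close> from \<open>subdirect_complement\<close>, both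
  \<open>span J\<close> and \<open>span (?S - J)\<close> meet \<open>K\<close> trivially, so each
  has order at most the index of \<open>K\<close>. Multiplying gives the square; the inequality is
  stated without division.\<close>

lemma subdirect_card:
  assumes K: "subgroup K H" and surj: "\<And>T. T \<in> \<T> \<Longrightarrow> p T ` K = T"
  shows "(\<Prod>T | T \<in> \<T> \<and> \<not> T \<subseteq> K. card T) * (card K)\<^sup>2 \<le> (card (carrier H))\<^sup>2"
proof -
  let ?S = "{T \<in> \<T>. \<not> T \<subseteq> K}"
  obtain J where J: "J \<subseteq> ?S" "K \<inter> span J = {\<one>}" "K \<inter> span (?S - J) = {\<one>}"
    and "\<forall>x\<in>carrier H. \<exists>k\<in>K. \<exists>y\<in>span J. x = k \<otimes> y"
    by (rule subdirect_complement[OF K surj]) (assumption, rule that)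
  have "card K * card (span J) \<le> card (carrier H)" "card K * card (span (?S - J)) \<le> card (carrier H)"
    using J(2,3) by (auto intro!: card_mult_le_if_trivial_Int simp: fin K span_subgroup)
  then have "(card K * card (span J)) * (card K * card (span (?S - J))) \<le> (card (carrier H))\<^sup>2"
    unfolding power2_eq_square by (rule mult_le_mono)
  moreover have "card (span J) * card (span (?S - J)) = (\<Prod>T\<in>?S. card T)"
  proof -
    have "card (span J) = (\<Prod>T\<in>J. card T)" "card (span (?S - J)) = (\<Prod>T\<in>?S - J. card T)"
      using J(1) by (auto intro!: card_span)
    then show ?thesis using prod.subset_diff[of J ?S card] J(1) finite_factors by simp
  qed
  then have "(\<Prod>T\<in>?S. card T) * (card K)\<^sup>2 = (card K * card (span J)) * (card K * card (span (?S - J)))"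
    by (simp add: power2_eq_square algebra_simps)
  ultimately show ?thesis by simp
qed

text \<open>Write x = l y with l in \<open>K\<close> and y in \<open>span J\<close>. Then y
  normalises \<open>K\<close>, so its commutators with elements of \<open>K\<close> lie in
  \<open>K \<inter> span J\<close> and vanish. Thus y centralises \<open>K\<close>, and projecting
  shows each of its components to be central in a factor, so y = 1.\<close>

lemma subdirect_self_normalising:
  assumes K: "subgroup K H" and surj: "\<And>T. T \<in> \<T> \<Longrightarrow> p T ` K = T"
    and x: "x \<in> carrier H" "\<And>k. k \<in> K \<Longrightarrow> x \<otimes> k \<otimes> inv x \<in> K"
  shows "x \<in> K"
proof -
  obtain J where "J \<subseteq> {T \<in> \<T>. \<not> T \<subseteq> K}" and J1: "K \<inter> span J = {\<one>}"
    and "K \<inter> span ({T \<in> \<T>. \<not> T \<subseteq> K} - J) = {\<one>}"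
    and J2: "\<forall>x\<in>carrier H. \<exists>k\<in>K. \<exists>y\<in>span J. x = k \<otimes> y"
    by (rule subdirect_complement[OF K surj]) (assumption, rule that)
  obtain l y where ly: "l \<in> K" "y \<in> span J" "x = l \<otimes> y" using J2 x(1) by blast
  note Kc = subgroup.mem_carrier[OF K] and yc = subgroup.mem_carrier[OF span_subgroup ly(2)]
  have "y = \<one>"
  proof (rule proj_separate[OF yc])
    fix T assume T: "T \<in> \<T>"
    show "p T y = \<one>"
    proof (rule factor_center[OF T proj_in[OF T yc]])
      fix t assume "t \<in> T"
      then obtain k where k: "k \<in> K" "t = p T k" using surj[OF T] by blast
      have kc: "k \<in> carrier H" "l \<in> carrier H" using Kc k ly by auto
      \<comment> \<open>After cancelling l this is the commutator of y and k; the same commutator is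
        bracketed below so as to lie in the normal subgroup \<open>span J\<close>.\<close>
      have "inv l \<otimes> (x \<otimes> k \<otimes> inv x) \<otimes> l \<otimes> inv k \<in> K"
        using x(2)[OF k(1)] k ly K by (simp add: subgroup.m_closed subgroup.m_inv_closed)
      then have 1: "y \<otimes> k \<otimes> inv y \<otimes> inv k \<in> K"
        using ly kc yc by (simp add: m_assoc inv_mult_group)
      have "k \<otimes> inv y \<otimes> inv k \<in> span J"
        using span_normal[of J] ly kc subgroup.m_inv_closed[OF span_subgroup] by (simp add: normal_within_def)
      then have "y \<otimes> (k \<otimes> inv y \<otimes> inv k) \<in> span J"
        using subgroup.m_closed[OF span_subgroup ly(2)] by blast
      then have "y \<otimes> k \<otimes> inv y \<otimes> inv k \<in> span J"
        using kc yc by (simp add: m_assoc)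
      then have "y \<otimes> k \<otimes> inv y \<otimes> inv k = \<one>" using 1 J1 by blast
      then have "y \<otimes> k = k \<otimes> y" using commute_if_commutator_one yc kc by blast
      then show "p T y \<otimes> t = t \<otimes> p T y"
        using k(2) proj_mult[OF T yc kc(1)] proj_mult[OF T kc(1) yc] by simp
    qed
  qed
  then show ?thesis using ly Kc by simp
qed

end

section \<open>Passage to and from \<open>direct_decomposition\<close>, and homomorphic images of
  products\<close>

lemma (in simple_product) direct_decomposition:
  "direct_decomposition H \<T> (\<lambda>x. \<lambda>T\<in>\<T>. p T x)"
proof -
  let ?P = "product_group \<T> (\<lambda>T. H\<lparr>carrier := T\<rparr>)" and ?\<pi> = "\<lambda>x. \<lambda>T\<in>\<T>. p T x"
  have "?\<pi> \<in> hom H ?P"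
    by (auto simp: hom_def proj_in proj_mult)
  moreover have "bij_betw ?\<pi> (carrier H) (carrier ?P)"
  proof -
    have inj: "inj_on ?\<pi> (carrier H)"
    proof (rule inj_onI)
      fix x y assume xy: "x \<in> carrier H" "y \<in> carrier H" "?\<pi> x = ?\<pi> y"
      show "x = y"
      proof (rule proj_eqI[OF xy(1,2)])
        fix T assume "T \<in> \<T>"
        then show "p T x = p T y" using fun_cong[OF xy(3), of T] by simp
      qed
    qed
    have sub: "?\<pi> ` carrier H \<subseteq> carrier ?P" by (auto simp: proj_in)
    have finT: "finite T" if "T \<in> \<T>" for T
      using subgroup.subset[OF factor_subgroup[OF that]] fin finite_subset by blast
    have "card (?\<pi> ` carrier H) = card (carrier ?P)"
      using inj card_span[of \<T>] finite_factors by (simp add: card_image span_all card_PiE)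
    then have "?\<pi> ` carrier H = carrier ?P"
      using sub finT finite_factors by (intro card_subset_eq) (auto intro!: finite_PiE)
    then show ?thesis using inj by (simp add: bij_betw_def)
  qed
  ultimately have "?\<pi> \<in> iso H ?P" by (simp add: iso_def)
  moreover have "?\<pi> t = (\<lambda>S\<in>\<T>. if S = T then t else \<one>)" if "T \<in> \<T>" "t \<in> T" for T t
  proof (rule restrict_ext)
    fix S assume S: "S \<in> \<T>"
    show "p S t = (if S = T then t else \<one>)"
      using S that proj_self[of T t] proj_other[of S T t] by (cases "S = T") auto
  qed
  ultimately show ?thesis
    by (simp add: direct_decomposition_def finite_factors factor_subgroup)
qed

text \<open>The decomposition witnessing \<open>subdirect\<close> collects the projections into one
  map; that map is injective by \<open>proj_eqI\<close> and surjective by the order formula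
  \<open>card_span\<close>.\<close>

lemma (in simple_product) subdirectI:
  assumes "subgroup K H" "\<And>T. T \<in> \<T> \<Longrightarrow> p T ` K = T"
  shows "subdirect H K"
  unfolding subdirect_def
proof (intro conjI exI ballI)
  show "direct_decomposition H \<T> (\<lambda>x. \<lambda>T\<in>\<T>. p T x)" by (rule direct_decomposition)
qed (use assms factor_simple factor_nonabelian in auto)

lemma direct_decomposition_simple_product:
  assumes "group H" "finite (carrier H)" and dec: "direct_decomposition H \<T> \<pi>"
    and simple: "\<And>T. T \<in> \<T> \<Longrightarrow> simple_group (H\<lparr>carrier := T\<rparr>) \<and> \<not> comm_group (H\<lparr>carrier := T\<rparr>)"
  shows "simple_product H \<T> (\<lambda>T x. \<pi> x T)"
proof -
  interpret H: group H by fact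
  let ?P = "product_group \<T> (\<lambda>T. H\<lparr>carrier := T\<rparr>)"
  have sub: "subgroup T H" if "T \<in> \<T>" for T using dec that by (simp add: direct_decomposition_def)
  have "\<pi> \<in> iso H ?P" using dec by (simp add: direct_decomposition_def)
  then have hom: "\<pi> \<in> hom H ?P" and bij: "bij_betw \<pi> (carrier H) (carrier ?P)" by (auto simp: iso_def)
  interpret P: group ?P using sub by (intro product_group) (simp add: H.subgroup_imp_group)
  interpret \<pi>: group_hom H ?P \<pi> using hom by unfold_locales
  have \<pi>_in: "\<pi> x \<in> (\<Pi>\<^sub>E T\<in>\<T>. T)" if "x \<in> carrier H" for x
    using \<pi>.hom_closed[OF that] by simp
  have gen: "\<pi> t = (\<lambda>S\<in>\<T>. if S = T then t else \<one>\<^bsub>H\<^esub>)" if "T \<in> \<T>" "t \<in> T" for T t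
    using dec that by (simp add: direct_decomposition_def)
  show ?thesis
  proof (intro simple_product.intro simple_product_axioms.intro)
    show "group H" by fact
    show "finite (carrier H)" by fact
    fix T assume T: "T \<in> \<T>"
    show "subgroup T H" using sub T .
    show "simple_group (H\<lparr>carrier := T\<rparr>)" "\<not> comm_group (H\<lparr>carrier := T\<rparr>)" using simple[OF T] by auto
    show "\<pi> x T \<in> T" if "x \<in> carrier H" for x using \<pi>_in[OF that] T by auto
    show "\<pi> (x \<otimes>\<^bsub>H\<^esub> y) T = \<pi> x T \<otimes>\<^bsub>H\<^esub> \<pi> y T" if "x \<in> carrier H" "y \<in> carrier H" for x y
      using \<pi>.hom_mult[OF that] T by simp
    show "\<pi> t T = t" if "t \<in> T" for t using gen[OF T that] T by simp
    show "\<pi> t T = \<one>\<^bsub>H\<^esub>" if "S \<in> \<T>" "S \<noteq> T" "t \<in> S" for S t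
      using gen[OF that(1,3)] T that(2) by auto
  next
    fix x assume x: "x \<in> carrier H" and one: "\<And>T. T \<in> \<T> \<Longrightarrow> \<pi> x T = \<one>\<^bsub>H\<^esub>"
    have "\<pi> x = (\<lambda>T\<in>\<T>. \<one>\<^bsub>H\<^esub>)"
    proof (rule extensionalityI)
      show "\<pi> x \<in> extensional \<T>" using \<pi>_in[OF x] by (simp add: PiE_def)
    qed (auto simp: one)
    then have "\<pi> x = \<pi> \<one>\<^bsub>H\<^esub>" using \<pi>.hom_one by simp
    then show "x = \<one>\<^bsub>H\<^esub>" using bij x by (auto simp: bij_betw_def inj_on_def)
  qed
qed

lemma subdirectE:
  assumes "subdirect H K" "group H" "finite (carrier H)"
  obtains \<T> p where "simple_product H \<T> p" "\<forall>T\<in>\<T>. p T ` K = T"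
proof -
  obtain \<T> \<pi> where dec: "direct_decomposition H \<T> \<pi>"
    and simple: "\<forall>T\<in>\<T>. simple_group (H\<lparr>carrier := T\<rparr>) \<and> \<not> comm_group (H\<lparr>carrier := T\<rparr>)"
    and onto: "\<forall>T\<in>\<T>. (\<lambda>x. \<pi> x T) ` K = T"
    using assms(1) unfolding subdirect_def by blast
  have "simple_product H \<T> (\<lambda>T x. \<pi> x T)"
    using direct_decomposition_simple_product[OF assms(2,3) dec] simple by blast
  then show thesis using that onto by blast
qed

text \<open>A factor on which some kernel element has a non-trivial component lies in the kernel, by
  \<open>factor_subset_normal\<close>. So the kernel is exactly the span of the factors it contains,
  and the remaining factors are mapped injectively to pairwise distinct images.\<close>

lemma (in simple_product) image_simple_product:
  fixes L (structure)
  assumes "group_hom H L \<phi>" and onto: "\<phi> ` carrier H = carrier L"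
  shows "\<exists>q. simple_product L {U \<in> (`) \<phi> ` \<T>. U \<noteq> {\<one>\<^bsub>L\<^esub>}} q \<and>
    (\<forall>T\<in>\<T>. \<phi> ` T \<noteq> {\<one>\<^bsub>L\<^esub>} \<longrightarrow> (\<forall>x\<in>carrier H. q (\<phi> ` T) (\<phi> x) = \<phi> (p T x)))"
proof -
  interpret \<phi>: group_hom H L \<phi> by fact
  let ?N = "kernel H L \<phi>"
  have N: "normal_within H (carrier H) ?N"
    using normal_iff_normal_within[OF subgroup_self, of ?N] \<phi>.normal_kernel by simp
  define good where "good = {T \<in> \<T>. \<phi> ` T \<noteq> {\<one>\<^bsub>L\<^esub>}}"
  have goodT: "T \<in> \<T>" if "T \<in> good" for T using that by (simp add: good_def)
  have kernel_proj: "p T x = \<one>" if T: "T \<in> good" and x: "x \<in> ?N" for T x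
  proof (rule ccontr)
    assume "p T x \<noteq> \<one>"
    then have TN: "T \<subseteq> ?N" using factor_subset_normal[OF goodT[OF T] N x] by blast
    then have "\<phi> ` T \<subseteq> {\<one>\<^bsub>L\<^esub>}" by (auto simp: kernel_def)
    moreover have "\<phi> \<one> \<in> \<phi> ` T" using subgroup.one_closed[OF factor_subgroup[OF goodT[OF T]]] by blast
    ultimately show False using T by (auto simp: good_def)
  qed
  have proj_cong: "p T x = p T y"
    if T: "T \<in> good" and xy: "x \<in> carrier H" "y \<in> carrier H" "\<phi> x = \<phi> y" for T x y
  proof -
    have "x \<otimes>\<^bsub>H\<^esub> inv\<^bsub>H\<^esub> y \<in> ?N" using xy by (simp add: kernel_def)
    then have "p T x \<otimes>\<^bsub>H\<^esub> inv\<^bsub>H\<^esub> (p T y) = \<one>\<^bsub>H\<^esub>"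
      using kernel_proj[OF T, of "x \<otimes>\<^bsub>H\<^esub> inv\<^bsub>H\<^esub> y"] proj_mult[OF goodT[OF T]] proj_inv[OF goodT[OF T]] xy by simp
    then show ?thesis
      using inv_equality[of "p T x" "inv\<^bsub>H\<^esub> (p T y)"] xy proj_carrier[OF goodT[OF T]] by simp
  qed
  have inj_T: "inj_on \<phi> T" if T: "T \<in> good" for T
  proof (rule inj_onI)
    fix s t assume st: "s \<in> T" "t \<in> T" "\<phi> s = \<phi> t"
    have "p T s = p T t"
      using proj_cong[OF T _ _ st(3)] factor_carrier[OF goodT[OF T]] st by blast
    then show "s = t" using proj_self[OF goodT[OF T]] st by simp
  qed
  have inj_good: "inj_on ((`) \<phi>) good"
  proof (rule inj_onI, rule ccontr)
    fix S T assume S: "S \<in> good" and T: "T \<in> good" and eq: "\<phi> ` S = \<phi> ` T" and ne: "S \<noteq> T"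
    obtain t where t: "t \<in> T" "t \<noteq> \<one>"
      using factor_nontrivial[OF goodT[OF T]] subgroup.one_closed[OF factor_subgroup[OF goodT[OF T]]] by blast
    obtain s where s: "s \<in> S" "\<phi> t = \<phi> s" using eq t(1) by blast
    have "p T t = p T s"
      using proj_cong[OF T _ _ s(2)] factor_carrier[OF goodT[OF T] t(1)] factor_carrier[OF goodT[OF S] s(1)] by blast
    then show False
      using t proj_self[OF goodT[OF T] t(1)] proj_other[OF goodT[OF T] goodT[OF S] ne s(1)] by simp
  qed
  \<comment> \<open>Both inverse images are arbitrary choices: \<open>inj_good\<close> makes the
    factor unique, and \<open>proj_cong\<close> makes the result independent of the preimage of
    y.\<close>
  define q where "q U y = \<phi> (p (inv_into good ((`) \<phi>) U) (inv_into (carrier H) \<phi> y))" for U y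
  have q: "q (\<phi> ` T) (\<phi> x) = \<phi> (p T x)" if T: "T \<in> good" and x: "x \<in> carrier H" for T x
  proof -
    have "inv_into good ((`) \<phi>) (\<phi> ` T) = T" using inv_into_f_f[OF inj_good T] .
    moreover have "p T (inv_into (carrier H) \<phi> (\<phi> x)) = p T x"
    proof (rule proj_cong[OF T])
      show "inv_into (carrier H) \<phi> (\<phi> x) \<in> carrier H" using x by (simp add: inv_into_into)
      show "\<phi> (inv_into (carrier H) \<phi> (\<phi> x)) = \<phi> x" using x by (simp add: f_inv_into_f)
    qed (rule x)
    ultimately show ?thesis by (simp add: q_def)
  qed
  have im_good: "{U \<in> (`) \<phi> ` \<T>. U \<noteq> {\<one>\<^bsub>L\<^esub>}} = (`) \<phi> ` good"
    by (auto simp: good_def)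
  have "simple_product L ((`) \<phi> ` good) q"
  proof (intro simple_product.intro simple_product_axioms.intro)
    show "group L" by (rule \<phi>.H.is_group)
    show "finite (carrier L)" using fin onto by (metis finite_imageI)
  next
    fix U assume "U \<in> (`) \<phi> ` good"
    then obtain T where T: "T \<in> good" and U: "U = \<phi> ` T" by blast
    note T' = goodT[OF T]
    show sub: "subgroup U L"
      using \<phi>.subgroup_img_is_subgroup[OF factor_subgroup[OF T']] U by simp
    have "\<phi> \<in> iso (H\<lparr>carrier := T\<rparr>) (L\<lparr>carrier := U\<rparr>)"
      using inj_T[OF T] factor_carrier[OF T'] U by (auto simp: iso_def hom_def bij_betw_def)
    then show "simple_group (L\<lparr>carrier := U\<rparr>)"
      using simple_group.iso_simple[OF factor_simple[OF T'] \<phi>.H.subgroup_imp_group[OF sub]] by blast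
    show "\<not> comm_group (L\<lparr>carrier := U\<rparr>)"
    proof
      assume "comm_group (L\<lparr>carrier := U\<rparr>)"
      then interpret U: comm_group "L\<lparr>carrier := U\<rparr>" .
      obtain s t where st: "s \<in> T" "t \<in> T" "s \<otimes>\<^bsub>H\<^esub> t \<noteq> t \<otimes>\<^bsub>H\<^esub> s" using factor_noncommuting[OF T'] .
      have "\<phi> s \<otimes>\<^bsub>L\<^esub> \<phi> t = \<phi> t \<otimes>\<^bsub>L\<^esub> \<phi> s" using U.m_comm[of "\<phi> s" "\<phi> t"] st U by simp
      then have "\<phi> (s \<otimes>\<^bsub>H\<^esub> t) = \<phi> (t \<otimes>\<^bsub>H\<^esub> s)" using st factor_carrier[OF T'] by simp
      then show False
        using inj_onD[OF inj_T[OF T]] st subgroup.m_closed[OF factor_subgroup[OF T']] by blast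
    qed
    show "q U y \<in> U" if y: "y \<in> carrier L" for y
    proof -
      obtain x where "x \<in> carrier H" "y = \<phi> x" using y unfolding onto[symmetric] by blast
      then show ?thesis using q[OF T] proj_in[OF T'] U by simp
    qed
    show "q U (y \<otimes>\<^bsub>L\<^esub> z) = q U y \<otimes>\<^bsub>L\<^esub> q U z" if yz: "y \<in> carrier L" "z \<in> carrier L" for y z
    proof -
      obtain v w where vw: "v \<in> carrier H" "y = \<phi> v" "w \<in> carrier H" "z = \<phi> w" using yz unfolding onto[symmetric] by blast
      then have "y \<otimes>\<^bsub>L\<^esub> z = \<phi> (v \<otimes>\<^bsub>H\<^esub> w)" by simp
      then have "q U (y \<otimes>\<^bsub>L\<^esub> z) = \<phi> (p T (v \<otimes>\<^bsub>H\<^esub> w))" using q[OF T, of "v \<otimes>\<^bsub>H\<^esub> w"] vw U by simp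
      then show ?thesis using q[OF T] vw proj_mult[OF T'] proj_carrier[OF T'] U by simp
    qed
    show "q U u = u" if u: "u \<in> U" for u
    proof -
      obtain t where "t \<in> T" "u = \<phi> t" using u U by blast
      then show ?thesis using q[OF T] proj_self[OF T'] factor_carrier[OF T'] U by simp
    qed
    show "q U v = \<one>\<^bsub>L\<^esub>" if V: "V \<in> (`) \<phi> ` good" "V \<noteq> U" "v \<in> V" for V v
    proof -
      obtain S where S: "S \<in> good" "V = \<phi> ` S" using V by blast
      obtain s where s: "s \<in> S" "v = \<phi> s" using V S by blast
      have "S \<noteq> T" using S U V by blast
      then have "p T s = \<one>\<^bsub>H\<^esub>" using proj_other[OF T' goodT[OF S(1)]] s by blast
      then show ?thesis using q[OF T] factor_carrier[OF goodT[OF S(1)] s(1)] s U by simp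
    qed
  next
    fix y assume y: "y \<in> carrier L" and one: "\<And>U. U \<in> (`) \<phi> ` good \<Longrightarrow> q U y = \<one>\<^bsub>L\<^esub>"
    obtain x where x: "x \<in> carrier H" "y = \<phi> x" using y unfolding onto[symmetric] by blast
    \<comment> \<open>The components of x in surviving factors vanish, so x is a product of
      components in factors killed by \<phi>.\<close>
    have "x \<in> span {T \<in> \<T>. T \<subseteq> ?N}"
      unfolding span_def
    proof (intro CollectI conjI ballI x(1))
      fix T assume "T \<in> \<T> - {T \<in> \<T>. T \<subseteq> ?N}"
      then have T: "T \<in> \<T>" and nT: "\<not> T \<subseteq> ?N" by auto
      have "\<phi> (p T x) = \<one>\<^bsub>L\<^esub>"
      proof (cases "T \<in> good")
        case True
        then show ?thesis using one[of "\<phi> ` T"] q[OF True x(1)] x(2) by simp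
      next
        case False
        then show ?thesis using proj_in[OF T x(1)] T by (auto simp: good_def)
      qed
      then have "p T x \<in> ?N" using proj_carrier[OF T x(1)] by (simp add: kernel_def)
      then show "p T x = \<one>\<^bsub>H\<^esub>"
        using factor_subset_normal[OF T N, of "p T x"] proj_self[OF T proj_in[OF T x(1)]] nT by auto
    qed
    moreover have "span {T \<in> \<T>. T \<subseteq> ?N} \<subseteq> ?N"
      using N by (intro span_subset_subgroup) (auto simp: normal_within_def)
    ultimately show "y = \<one>\<^bsub>L\<^esub>" using x by (auto simp: kernel_def)
  qed
  moreover have "q (\<phi> ` T) (\<phi> x) = \<phi> (p T x)"
    if "T \<in> \<T>" "\<phi> ` T \<noteq> {\<one>\<^bsub>L\<^esub>}" "x \<in> carrier H" for T x
    using q[of T x] that by (simp add: good_def)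
  ultimately show ?thesis unfolding im_good by blast
qed

subsection \<open>Coordinate actions on a Cartesian decomposition\<close>

lemma carrier_BijGroup [simp]: "carrier (BijGroup S) = Bij S"
  by (simp add: BijGroup_def)

lemma Bij_apply: "f \<in> Bij S \<Longrightarrow> x \<in> S \<Longrightarrow> f x \<in> S"
  by (meson Bij_imp_funcset funcset_mem)

lemma Bij_image: "f \<in> Bij S \<Longrightarrow> f ` S = S"
  by (simp add: Bij_def bij_betw_def)

lemma Bij_inj: "f \<in> Bij S \<Longrightarrow> inj_on f S"
  by (simp add: Bij_def bij_betw_def)

lemma Bij_eqI: "f \<in> Bij S \<Longrightarrow> g \<in> Bij S \<Longrightarrow> (\<And>x. x \<in> S \<Longrightarrow> f x = g x) \<Longrightarrow> f = g"
  by (meson Bij_imp_extensional extensionalityI)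

lemma one_BijGroup_apply: "x \<in> S \<Longrightarrow> \<one>\<^bsub>BijGroup S\<^esub> x = x"
  by (simp add: BijGroup_def)

lemma mult_BijGroup_apply:
  "f \<in> Bij S \<Longrightarrow> g \<in> Bij S \<Longrightarrow> x \<in> S \<Longrightarrow> (f \<otimes>\<^bsub>BijGroup S\<^esub> g) x = f (g x)"
  by (simp add: BijGroup_def compose_eq)

lemma inv_BijGroup_apply:
  assumes "f \<in> Bij S" "x \<in> S"
  shows "(inv\<^bsub>BijGroup S\<^esub> f) (f x) = x" "f ((inv\<^bsub>BijGroup S\<^esub> f) x) = x"
  using assms Bij_apply[OF assms] Bij_inj[OF assms(1)] Bij_image[OF assms(1)]
  by (simp_all add: inv_BijGroup inv_into_f_f f_inv_into_f)

lemma Bij_mult_closed [simp]: "f \<in> Bij S \<Longrightarrow> g \<in> Bij S \<Longrightarrow> f \<otimes>\<^bsub>BijGroup S\<^esub> g \<in> Bij S"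
  using group.is_monoid[OF group_BijGroup, of S] monoid.m_closed[of "BijGroup S" f g] by simp

lemma Bij_inv_closed [simp]: "f \<in> Bij S \<Longrightarrow> inv\<^bsub>BijGroup S\<^esub> f \<in> Bij S"
  using group.inv_closed[OF group_BijGroup, of f S] by simp

lemma Bij_one_closed [simp]: "\<one>\<^bsub>BijGroup S\<^esub> \<in> Bij S"
  using monoid.one_closed[OF group.is_monoid[OF group_BijGroup, of S]] by simp

lemma mult_BijGroup_image:
  "f \<in> Bij S \<Longrightarrow> g \<in> Bij S \<Longrightarrow> A \<subseteq> S \<Longrightarrow> (f \<otimes>\<^bsub>BijGroup S\<^esub> g) ` A = f ` g ` A"
  by (auto simp: image_image mult_BijGroup_apply subset_eq intro!: image_cong)

lemma one_BijGroup_image: "A \<subseteq> S \<Longrightarrow> \<one>\<^bsub>BijGroup S\<^esub> ` A = A"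
  by (force simp: one_BijGroup_apply subset_eq)

lemma inv_BijGroup_image:
  "f \<in> Bij S \<Longrightarrow> A \<subseteq> S \<Longrightarrow> (inv\<^bsub>BijGroup S\<^esub> f) ` f ` A = A"
  by (force simp: image_image inv_BijGroup_apply subset_eq)

section \<open>Points as coordinate tuples, and permutations fixing every partition\<close>

definition part_of :: "'a set set \<Rightarrow> 'a \<Rightarrow> 'a set" where
  "part_of \<Gamma> \<omega> = (THE \<gamma>. \<gamma> \<in> \<Gamma> \<and> \<omega> \<in> \<gamma>)"

definition act :: "'a set set \<Rightarrow> ('a \<Rightarrow> 'a) \<Rightarrow> 'a set \<Rightarrow> 'a set" where
  "act \<Gamma> g = (\<lambda>\<gamma>\<in>\<Gamma>. g ` \<gamma>)"

locale cartesian =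
  fixes \<Omega> :: "'a set" and \<E> :: "'a set set set"
  assumes finite_\<Omega>: "finite \<Omega>" and cartesian: "cartesian_decomposition \<Omega> \<E>"
begin

abbreviation \<B> :: "('a \<Rightarrow> 'a) monoid" where "\<B> \<equiv> BijGroup \<Omega>"

abbreviation mult_\<B> (infixl \<open>\<cdot>\<close> 70) where "f \<cdot> g \<equiv> f \<otimes>\<^bsub>\<B>\<^esub> g"

abbreviation conj_\<B> (infixl \<open>\<triangleright>\<close> 75) where "g \<triangleright> m \<equiv> g \<cdot> m \<cdot> inv\<^bsub>\<B>\<^esub> g"

sublocale \<B>: group \<B> by (rule group_BijGroup)

lemma finite_Bij: "finite (Bij \<Omega>)"
proof (rule finite_subset)
  show "Bij \<Omega> \<subseteq> (\<Omega> \<rightarrow>\<^sub>E \<Omega>)"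
    by (simp add: PiE_def Bij_imp_extensional Bij_imp_funcset subset_eq)
qed (simp add: finite_\<Omega> finite_PiE)

lemma finite_\<E>: "finite \<E>" and \<E>_nonempty: "\<E> \<noteq> {}"
  using cartesian by (auto simp: cartesian_decomposition_def)

lemma partition: "\<Gamma> \<in> \<E> \<Longrightarrow> partition_on \<Omega> \<Gamma>"
  using cartesian by (simp add: cartesian_decomposition_def proper_partition_def)

lemma part_subset: "\<Gamma> \<in> \<E> \<Longrightarrow> \<gamma> \<in> \<Gamma> \<Longrightarrow> \<gamma> \<subseteq> \<Omega>"
  using partition_onD1[OF partition] by blast

lemma part_nonempty: "\<Gamma> \<in> \<E> \<Longrightarrow> \<gamma> \<in> \<Gamma> \<Longrightarrow> \<gamma> \<noteq> {}"
  using partition_onD3[OF partition] by blast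

lemma finite_\<Gamma>: "\<Gamma> \<in> \<E> \<Longrightarrow> finite \<Gamma>"
  using part_subset finite_\<Omega> by (metis PowI finite_Pow_iff finite_subset subsetI)

lemma part_of_eq: "\<Gamma> \<in> \<E> \<Longrightarrow> \<gamma> \<in> \<Gamma> \<Longrightarrow> \<omega> \<in> \<gamma> \<Longrightarrow> part_of \<Gamma> \<omega> = \<gamma>"
  unfolding part_of_def using partition_onD2[OF partition, of \<Gamma>]
  by (intro the_equality) (auto simp: disjoint_def)

lemma part_of:
  assumes "\<Gamma> \<in> \<E>" "\<omega> \<in> \<Omega>"
  shows "part_of \<Gamma> \<omega> \<in> \<Gamma>" "\<omega> \<in> part_of \<Gamma> \<omega>"
proof -
  obtain \<gamma> where "\<gamma> \<in> \<Gamma>" "\<omega> \<in> \<gamma>" using partition_onD1[OF partition[OF assms(1)]] assms(2) by blast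
  then show "part_of \<Gamma> \<omega> \<in> \<Gamma>" "\<omega> \<in> part_of \<Gamma> \<omega>" using part_of_eq[OF assms(1)] by auto
qed

lemma coords_eq: "\<Gamma> \<in> \<E> \<Longrightarrow> coords \<E> \<omega> \<Gamma> = part_of \<Gamma> \<omega>"
  by (simp add: coords_def part_of_def)

text \<open>The one-point intersections make \<Omega> a full coordinate product: any choice of parts
  is the coordinate tuple of some point, and of only one.\<close>

lemma meet:
  assumes "\<And>\<Gamma>. \<Gamma> \<in> \<E> \<Longrightarrow> f \<Gamma> \<in> \<Gamma>"
  shows "\<exists>\<omega>\<in>\<Omega>. (\<forall>\<Gamma>\<in>\<E>. part_of \<Gamma> \<omega> = f \<Gamma>) \<and> (\<forall>\<omega>'\<in>\<Omega>. (\<forall>\<Gamma>\<in>\<E>. part_of \<Gamma> \<omega>' = f \<Gamma>) \<longrightarrow> \<omega>' = \<omega>)"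
proof -
  have "restrict f \<E> \<in> (\<Pi>\<^sub>E \<Gamma>\<in>\<E>. \<Gamma>)" using assms by auto
  then have "card (\<Inter>\<Gamma>\<in>\<E>. restrict f \<E> \<Gamma>) = 1"
    using cartesian unfolding cartesian_decomposition_def by blast
  moreover have "(\<Inter>\<Gamma>\<in>\<E>. restrict f \<E> \<Gamma>) = (\<Inter>\<Gamma>\<in>\<E>. f \<Gamma>)" by simp
  ultimately obtain \<omega> where \<omega>: "(\<Inter>\<Gamma>\<in>\<E>. f \<Gamma>) = {\<omega>}" by (auto simp: card_1_singleton_iff)
  then have in_f: "\<omega> \<in> f \<Gamma>" if "\<Gamma> \<in> \<E>" for \<Gamma> using that by blast
  have "\<omega> \<in> \<Omega>" using in_f assms part_subset \<E>_nonempty by blast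
  moreover have "part_of \<Gamma> \<omega> = f \<Gamma>" if "\<Gamma> \<in> \<E>" for \<Gamma>
    using part_of_eq[OF that assms[OF that] in_f[OF that]] .
  moreover have "\<omega>' = \<omega>" if "\<omega>' \<in> \<Omega>" "\<forall>\<Gamma>\<in>\<E>. part_of \<Gamma> \<omega>' = f \<Gamma>" for \<omega>'
  proof -
    have "\<omega>' \<in> (\<Inter>\<Gamma>\<in>\<E>. f \<Gamma>)" using part_of(2)[of _ \<omega>'] that by auto
    then show ?thesis using \<omega> by simp
  qed
  ultimately show ?thesis by blast
qed

lemma point_eqI:
  assumes "\<omega> \<in> \<Omega>" "\<omega>' \<in> \<Omega>" "\<And>\<Gamma>. \<Gamma> \<in> \<E> \<Longrightarrow> part_of \<Gamma> \<omega> = part_of \<Gamma> \<omega>'"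
  shows "\<omega> = \<omega>'"
  using meet[of "\<lambda>\<Gamma>. part_of \<Gamma> \<omega>'"] part_of(1) assms by metis

lemma card_\<Omega>: "card \<Omega> = (\<Prod>\<Gamma>\<in>\<E>. card \<Gamma>)"
proof -
  have "bij_betw (\<lambda>\<omega>. \<lambda>\<Gamma>\<in>\<E>. part_of \<Gamma> \<omega>) \<Omega> (\<Pi>\<^sub>E \<Gamma>\<in>\<E>. \<Gamma>)"
    unfolding bij_betw_def
  proof
    show "inj_on (\<lambda>\<omega>. \<lambda>\<Gamma>\<in>\<E>. part_of \<Gamma> \<omega>) \<Omega>"
    proof (rule inj_onI)
      fix x y assume xy: "x \<in> \<Omega>" "y \<in> \<Omega>" "(\<lambda>\<Gamma>\<in>\<E>. part_of \<Gamma> x) = (\<lambda>\<Gamma>\<in>\<E>. part_of \<Gamma> y)"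
      show "x = y"
        using point_eqI[OF xy(1,2)] fun_cong[OF xy(3)] by (metis restrict_apply')
    qed
    show "(\<lambda>\<omega>. \<lambda>\<Gamma>\<in>\<E>. part_of \<Gamma> \<omega>) ` \<Omega> = (\<Pi>\<^sub>E \<Gamma>\<in>\<E>. \<Gamma>)"
    proof
      show "(\<lambda>\<omega>. \<lambda>\<Gamma>\<in>\<E>. part_of \<Gamma> \<omega>) ` \<Omega> \<subseteq> (\<Pi>\<^sub>E \<Gamma>\<in>\<E>. \<Gamma>)" using part_of by auto
      show "(\<Pi>\<^sub>E \<Gamma>\<in>\<E>. \<Gamma>) \<subseteq> (\<lambda>\<omega>. \<lambda>\<Gamma>\<in>\<E>. part_of \<Gamma> \<omega>) ` \<Omega>"
      proof
        fix f assume f: "f \<in> (\<Pi>\<^sub>E \<Gamma>\<in>\<E>. \<Gamma>)"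
        then obtain \<omega> where \<omega>: "\<omega> \<in> \<Omega>" "\<forall>\<Gamma>\<in>\<E>. part_of \<Gamma> \<omega> = f \<Gamma>" using meet[of f] by auto
        have "f = (\<lambda>\<Gamma>\<in>\<E>. part_of \<Gamma> \<omega>)"
        proof (rule extensionalityI)
          show "f \<in> extensional \<E>" using f by (simp add: PiE_def)
        qed (auto simp: \<omega>(2))
        then show "f \<in> (\<lambda>\<omega>. \<lambda>\<Gamma>\<in>\<E>. part_of \<Gamma> \<omega>) ` \<Omega>" using \<omega>(1) by blast
      qed
    qed
  qed
  from bij_betw_same_card[OF this] show ?thesis by (simp add: card_PiE[OF finite_\<E>])
qed

lemma two_parts:
  assumes "\<Gamma> \<in> \<E>"
  shows "\<exists>\<gamma>\<in>\<Gamma>. \<exists>\<delta>\<in>\<Gamma>. \<gamma> \<noteq> \<delta>"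
proof (rule ccontr)
  assume "\<not> (\<exists>\<gamma>\<in>\<Gamma>. \<exists>\<delta>\<in>\<Gamma>. \<gamma> \<noteq> \<delta>)"
  then have eq: "\<gamma> = \<delta>" if "\<gamma> \<in> \<Gamma>" "\<delta> \<in> \<Gamma>" for \<gamma> \<delta> using that by blast
  have proper: "\<Gamma> \<noteq> {\<Omega>}" "\<Gamma> \<noteq> (\<lambda>\<omega>. {\<omega>}) ` \<Omega>" and un: "\<Omega> = \<Union>\<Gamma>"
    using cartesian assms partition_onD1[OF partition[OF assms]]
    by (auto simp: cartesian_decomposition_def proper_partition_def)
  show False
  \<comment> \<open>An empty partition can only partition the empty set, and there it coincides with
    the excluded partition into singletons.\<close>
  proof (cases "\<Gamma> = {}")
    case True
    then show False using proper(2) un by simp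
  next
    case False
    then obtain \<gamma> where "\<gamma> \<in> \<Gamma>" by blast
    then have "\<Gamma> = {\<gamma>}" using eq by blast
    then show False using proper(1) un by simp
  qed
qed

lemma nonempty: "\<Omega> \<noteq> {}"
proof -
  obtain \<Gamma> where \<Gamma>: "\<Gamma> \<in> \<E>" using \<E>_nonempty by blast
  obtain \<gamma> where "\<gamma> \<in> \<Gamma>" using two_parts[OF \<Gamma>] by blast
  then show ?thesis using part_subset[OF \<Gamma>] part_nonempty[OF \<Gamma>] by blast
qed

text \<open>If \<Gamma> were the only coordinate, points in the same part would be equal, so
  \<Gamma> would be the excluded partition into singletons. The second coordinate is what later
  makes the point stabiliser decompose.\<close>

lemma two_partitions:
  assumes "\<Gamma> \<in> \<E>"
  shows "\<exists>\<Delta>\<in>\<E>. \<Delta> \<noteq> \<Gamma>"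
proof (rule ccontr)
  assume "\<not> (\<exists>\<Delta>\<in>\<E>. \<Delta> \<noteq> \<Gamma>)"
  then have E: "\<E> = {\<Gamma>}" using assms by blast
  have "\<Gamma> = (\<lambda>\<omega>. {\<omega>}) ` \<Omega>"
  proof (intro equalityI subsetI)
    fix \<gamma> assume \<gamma>: "\<gamma> \<in> \<Gamma>"
    obtain \<omega> where \<omega>: "\<omega> \<in> \<gamma>" using part_nonempty[OF assms \<gamma>] by blast
    have "x = \<omega>" if "x \<in> \<gamma>" for x
      using point_eqI[of x \<omega>] part_of_eq[OF assms \<gamma>] part_subset[OF assms \<gamma>] that \<omega> E by auto
    then have "\<gamma> = {\<omega>}" using \<omega> by blast
    then show "\<gamma> \<in> (\<lambda>\<omega>. {\<omega>}) ` \<Omega>" using \<omega> part_subset[OF assms \<gamma>] by blast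
  next
    fix \<gamma> assume "\<gamma> \<in> (\<lambda>\<omega>. {\<omega>}) ` \<Omega>"
    then obtain \<omega> where \<omega>: "\<omega> \<in> \<Omega>" "\<gamma> = {\<omega>}" by blast
    have "x = \<omega>" if "x \<in> part_of \<Gamma> \<omega>" for x
      using point_eqI[of x \<omega>] part_of_eq[OF assms part_of(1)[OF assms \<omega>(1)] that]
        part_subset[OF assms part_of(1)[OF assms \<omega>(1)]] that \<omega> E by auto
    then have "part_of \<Gamma> \<omega> = {\<omega>}" using part_of(2)[OF assms \<omega>(1)] by blast
    then show "\<gamma> \<in> \<Gamma>" using part_of(1)[OF assms \<omega>(1)] \<omega> by simp
  qed
  moreover have "proper_partition \<Omega> \<Gamma>" using cartesian assms by (simp add: cartesian_decomposition_def)
  ultimately show False by (simp add: proper_partition_def)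
qed

lemma move_mult:
  "f \<in> Bij \<Omega> \<Longrightarrow> g \<in> Bij \<Omega> \<Longrightarrow> \<Gamma> \<in> \<E> \<Longrightarrow>
    move_partition (f \<cdot> g) \<Gamma> = move_partition f (move_partition g \<Gamma>)"
  using part_subset[of \<Gamma>] by (auto simp: move_partition_def image_image mult_BijGroup_image intro!: image_cong)

lemma move_one: "\<Gamma> \<in> \<E> \<Longrightarrow> move_partition \<one>\<^bsub>\<B>\<^esub> \<Gamma> = \<Gamma>"
  using part_subset[of \<Gamma>] by (force simp: move_partition_def one_BijGroup_image)

lemma move_inv:
  assumes "g \<in> Bij \<Omega>" "\<Gamma> \<in> \<E>" "move_partition g \<Gamma> = \<Delta>"
  shows "move_partition (inv\<^bsub>\<B>\<^esub> g) \<Delta> = \<Gamma>"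
  using move_mult[of "inv\<^bsub>\<B>\<^esub> g" g \<Gamma>] assms by (simp add: Bij_inv_closed move_one \<B>.l_inv)

definition stab :: "'a set set \<Rightarrow> ('a \<Rightarrow> 'a) set" where
  "stab \<Gamma> = {g \<in> Bij \<Omega>. move_partition g \<Gamma> = \<Gamma>}"

text \<open>The full base group, the kernel of the action on partitions inside all permutations
  preserving them. Like \<open>stab\<close>, it is taken in the whole symmetric group, so that it
  does not depend on \<open>G\<close>.\<close>

definition base :: "('a \<Rightarrow> 'a) set" where
  "base = {g \<in> Bij \<Omega>. \<forall>\<Gamma>\<in>\<E>. move_partition g \<Gamma> = \<Gamma>}"

lemma base_stab: "g \<in> base \<Longrightarrow> \<Gamma> \<in> \<E> \<Longrightarrow> g \<in> stab \<Gamma>"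
  by (simp add: base_def stab_def)

lemma base_Bij: "g \<in> base \<Longrightarrow> g \<in> Bij \<Omega>" and stab_Bij: "g \<in> stab \<Gamma> \<Longrightarrow> g \<in> Bij \<Omega>"
  by (auto simp: base_def stab_def)

lemma stab_subgroup: "\<Gamma> \<in> \<E> \<Longrightarrow> subgroup (stab \<Gamma>) \<B>"
proof (rule \<B>.subgroupI)
  assume \<Gamma>: "\<Gamma> \<in> \<E>"
  have "\<one>\<^bsub>\<B>\<^esub> \<in> stab \<Gamma>" using move_one[OF \<Gamma>] by (simp add: stab_def)
  then show "stab \<Gamma> \<noteq> {}" by blast
qed (auto simp: stab_def move_mult move_inv Bij_mult_closed Bij_inv_closed)

lemma base_subgroup: "subgroup base \<B>"
proof (rule \<B>.subgroupI)
  have "\<one>\<^bsub>\<B>\<^esub> \<in> base" using move_one by (simp add: base_def)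
  then show "base \<noteq> {}" by blast
qed (auto simp: base_def move_mult move_inv Bij_mult_closed Bij_inv_closed)

lemma act_apply: "\<gamma> \<in> \<Gamma> \<Longrightarrow> act \<Gamma> g \<gamma> = g ` \<gamma>"
  by (simp add: act_def)

lemma act_Bij:
  assumes "\<Gamma> \<in> \<E>" "g \<in> stab \<Gamma>"
  shows "act \<Gamma> g \<in> Bij \<Gamma>"
proof -
  have "act \<Gamma> g ` \<Gamma> = \<Gamma>"
    using assms(2) by (simp add: act_def stab_def move_partition_def)
  moreover have "inj_on (act \<Gamma> g) \<Gamma>"
  proof (rule inj_onI)
    fix \<gamma> \<delta> assume "\<gamma> \<in> \<Gamma>" "\<delta> \<in> \<Gamma>" "act \<Gamma> g \<gamma> = act \<Gamma> g \<delta>"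
    then show "\<gamma> = \<delta>"
      using inj_on_image_eq_iff[OF Bij_inj[OF stab_Bij[OF assms(2)]]] part_subset[OF assms(1)] by (simp add: act_apply)
  qed
  ultimately show ?thesis by (simp add: Bij_def bij_betw_def act_def)
qed

lemma act_hom: "\<Gamma> \<in> \<E> \<Longrightarrow> group_hom (\<B>\<lparr>carrier := stab \<Gamma>\<rparr>) (BijGroup \<Gamma>) (act \<Gamma>)"
proof -
  assume \<Gamma>: "\<Gamma> \<in> \<E>"
  have "act \<Gamma> (f \<cdot> g) = act \<Gamma> f \<otimes>\<^bsub>BijGroup \<Gamma>\<^esub> act \<Gamma> g" if f: "f \<in> stab \<Gamma>" and g: "g \<in> stab \<Gamma>" for f g
  proof (rule Bij_eqI)
    have "f \<cdot> g \<in> stab \<Gamma>" using stab_subgroup[OF \<Gamma>] f g by (simp add: subgroup.m_closed)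
    then show "act \<Gamma> (f \<cdot> g) \<in> Bij \<Gamma>" by (rule act_Bij[OF \<Gamma>])
    show "act \<Gamma> f \<otimes>\<^bsub>BijGroup \<Gamma>\<^esub> act \<Gamma> g \<in> Bij \<Gamma>"
      by (intro Bij_mult_closed act_Bij \<Gamma> f g)
    fix \<gamma> assume \<gamma>: "\<gamma> \<in> \<Gamma>"
    have "g ` \<gamma> \<in> \<Gamma>" using Bij_apply[OF act_Bij[OF \<Gamma> g] \<gamma>] \<gamma> by (simp add: act_apply)
    then show "act \<Gamma> (f \<cdot> g) \<gamma> = (act \<Gamma> f \<otimes>\<^bsub>BijGroup \<Gamma>\<^esub> act \<Gamma> g) \<gamma>"
      using \<gamma> f g by (simp add: mult_BijGroup_apply act_Bij \<Gamma> act_apply mult_BijGroup_image stab_Bij[OF f] stab_Bij[OF g] part_subset[OF \<Gamma> \<gamma>])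
  qed
  then show ?thesis
    using \<B>.subgroup_imp_group[OF stab_subgroup[OF \<Gamma>]] group_BijGroup[of \<Gamma>] act_Bij[OF \<Gamma>]
    by (simp add: group_hom_def group_hom_axioms_def hom_def)
qed

lemma act_mult: "\<Gamma> \<in> \<E> \<Longrightarrow> f \<in> stab \<Gamma> \<Longrightarrow> g \<in> stab \<Gamma> \<Longrightarrow>
    act \<Gamma> (f \<cdot> g) = act \<Gamma> f \<otimes>\<^bsub>BijGroup \<Gamma>\<^esub> act \<Gamma> g"
  using group_hom.hom_mult[OF act_hom, of \<Gamma> f g] by simp

lemma act_one: "\<Gamma> \<in> \<E> \<Longrightarrow> act \<Gamma> \<one>\<^bsub>\<B>\<^esub> = \<one>\<^bsub>BijGroup \<Gamma>\<^esub>"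
  using group_hom.hom_one[OF act_hom, of \<Gamma>] by simp

lemma act_inv: "\<Gamma> \<in> \<E> \<Longrightarrow> g \<in> stab \<Gamma> \<Longrightarrow> act \<Gamma> (inv\<^bsub>\<B>\<^esub> g) = inv\<^bsub>BijGroup \<Gamma>\<^esub> (act \<Gamma> g)"
  using group_hom.hom_inv[OF act_hom, of \<Gamma> g] \<B>.m_inv_consistent[OF stab_subgroup, of \<Gamma> g] by simp

lemma act_part_of:
  assumes "\<Gamma> \<in> \<E>" "g \<in> stab \<Gamma>" "\<omega> \<in> \<Omega>"
  shows "act \<Gamma> g (part_of \<Gamma> \<omega>) = part_of \<Gamma> (g \<omega>)"
proof -
  note p = part_of[OF assms(1,3)]
  have "g \<omega> \<in> act \<Gamma> g (part_of \<Gamma> \<omega>)" using p by (simp add: act_apply)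
  moreover have "act \<Gamma> g (part_of \<Gamma> \<omega>) \<in> \<Gamma>" using Bij_apply[OF act_Bij[OF assms(1,2)] p(1)] .
  ultimately show ?thesis using part_of_eq[OF assms(1)] by simp
qed

lemma base_eqI:
  assumes "g \<in> base" "h \<in> base" "\<And>\<Gamma>. \<Gamma> \<in> \<E> \<Longrightarrow> act \<Gamma> g = act \<Gamma> h"
  shows "g = h"
proof (rule Bij_eqI)
  show gh: "g \<in> Bij \<Omega>" "h \<in> Bij \<Omega>" using assms base_Bij by auto
  fix \<omega> assume \<omega>: "\<omega> \<in> \<Omega>"
  show "g \<omega> = h \<omega>"
  proof (rule point_eqI)
    show "g \<omega> \<in> \<Omega>" "h \<omega> \<in> \<Omega>" using Bij_apply[OF gh(1) \<omega>] Bij_apply[OF gh(2) \<omega>] by auto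
    fix \<Gamma> assume \<Gamma>: "\<Gamma> \<in> \<E>"
    show "part_of \<Gamma> (g \<omega>) = part_of \<Gamma> (h \<omega>)"
      using act_part_of[OF \<Gamma> base_stab[OF assms(1) \<Gamma>] \<omega>] act_part_of[OF \<Gamma> base_stab[OF assms(2) \<Gamma>] \<omega>]
        assms(3)[OF \<Gamma>] by simp
  qed
qed

lemma base_eq_one:
  "g \<in> base \<Longrightarrow> (\<And>\<Gamma>. \<Gamma> \<in> \<E> \<Longrightarrow> act \<Gamma> g = \<one>\<^bsub>BijGroup \<Gamma>\<^esub>) \<Longrightarrow> g = \<one>\<^bsub>\<B>\<^esub>"
  by (rule base_eqI) (auto simp: subgroup.one_closed[OF base_subgroup] act_one)

text \<open>Parts are the fibres of the coordinate maps. A permutation compatible with the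
  coordinates therefore carries each part into its prescribed image, and injectivity of
  \<open>h \<Gamma>\<close> makes it carry the part onto that image.\<close>

lemma base_coordinates:
  assumes g: "g \<in> Bij \<Omega>" and h: "\<And>\<Gamma>. \<Gamma> \<in> \<E> \<Longrightarrow> h \<Gamma> \<in> Bij \<Gamma>"
    and gh: "\<And>\<Gamma> \<omega>. \<Gamma> \<in> \<E> \<Longrightarrow> \<omega> \<in> \<Omega> \<Longrightarrow> part_of \<Gamma> (g \<omega>) = h \<Gamma> (part_of \<Gamma> \<omega>)"
  shows "g \<in> base \<and> (\<forall>\<Gamma>\<in>\<E>. act \<Gamma> g = h \<Gamma>)"
proof -
  have im: "g ` \<gamma> = h \<Gamma> \<gamma>" if \<Gamma>: "\<Gamma> \<in> \<E>" and \<gamma>: "\<gamma> \<in> \<Gamma>" for \<Gamma> \<gamma>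
  proof (intro equalityI subsetI)
    fix y assume "y \<in> g ` \<gamma>"
    then obtain x where x: "x \<in> \<gamma>" "y = g x" by blast
    have xO: "x \<in> \<Omega>" using x part_subset[OF \<Gamma> \<gamma>] by blast
    show "y \<in> h \<Gamma> \<gamma>"
      using part_of(2)[OF \<Gamma> Bij_apply[OF g xO]] gh[OF \<Gamma> xO] part_of_eq[OF \<Gamma> \<gamma> x(1)] x(2) by simp
  next
    fix y assume y: "y \<in> h \<Gamma> \<gamma>"
    have h\<gamma>: "h \<Gamma> \<gamma> \<in> \<Gamma>" using Bij_apply[OF h[OF \<Gamma>] \<gamma>] .
    have "y \<in> g ` \<Omega>" using y part_subset[OF \<Gamma> h\<gamma>] Bij_image[OF g] by blast
    then obtain x where x: "x \<in> \<Omega>" "y = g x" by blast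
    have "h \<Gamma> (part_of \<Gamma> x) = h \<Gamma> \<gamma>"
      using gh[OF \<Gamma> x(1)] part_of_eq[OF \<Gamma> h\<gamma> y] x(2) by simp
    then have "part_of \<Gamma> x = \<gamma>"
      using inj_onD[OF Bij_inj[OF h[OF \<Gamma>]]] part_of(1)[OF \<Gamma> x(1)] \<gamma> by blast
    then show "y \<in> g ` \<gamma>" using part_of(2)[OF \<Gamma> x(1)] x(2) by blast
  qed
  have "move_partition g \<Gamma> = \<Gamma>" if \<Gamma>: "\<Gamma> \<in> \<E>" for \<Gamma>
    using im[OF \<Gamma>] Bij_image[OF h[OF \<Gamma>]] by (simp add: move_partition_def)
  moreover have "act \<Gamma> g = h \<Gamma>" if \<Gamma>: "\<Gamma> \<in> \<E>" for \<Gamma>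
  proof (rule extensionalityI)
    show "act \<Gamma> g \<in> extensional \<Gamma>" by (simp add: act_def)
    show "h \<Gamma> \<in> extensional \<Gamma>" using h[OF \<Gamma>] by (rule Bij_imp_extensional)
  qed (simp add: act_apply im[OF \<Gamma>])
  ultimately show ?thesis using g by (simp add: base_def)
qed

text \<open>Together with \<open>base_eqI\<close> this identifies \<open>base\<close> with the
  product of the symmetric groups on all \<Gamma>. The permutation is built pointwise from
  \<open>meet\<close>; it is injective coordinatewise, and surjective because \<Omega> is
  finite.\<close>

lemma base_from_coordinates:
  assumes h: "\<And>\<Gamma>. \<Gamma> \<in> \<E> \<Longrightarrow> h \<Gamma> \<in> Bij \<Gamma>"
  shows "\<exists>g\<in>base. \<forall>\<Gamma>\<in>\<E>. act \<Gamma> g = h \<Gamma>"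
proof -
  have "\<exists>\<omega>'\<in>\<Omega>. \<forall>\<Gamma>\<in>\<E>. part_of \<Gamma> \<omega>' = h \<Gamma> (part_of \<Gamma> \<omega>)" if \<omega>: "\<omega> \<in> \<Omega>" for \<omega>
    using meet[of "\<lambda>\<Gamma>. h \<Gamma> (part_of \<Gamma> \<omega>)"] Bij_apply[OF h] part_of(1)[OF _ \<omega>] by blast
  then obtain f where f: "\<And>\<omega>. \<omega> \<in> \<Omega> \<Longrightarrow> f \<omega> \<in> \<Omega>"
    "\<And>\<omega> \<Gamma>. \<omega> \<in> \<Omega> \<Longrightarrow> \<Gamma> \<in> \<E> \<Longrightarrow> part_of \<Gamma> (f \<omega>) = h \<Gamma> (part_of \<Gamma> \<omega>)" by metis
  let ?g = "restrict f \<Omega>"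
  have "inj_on ?g \<Omega>"
  proof (rule inj_onI)
    fix x y assume xy: "x \<in> \<Omega>" "y \<in> \<Omega>" "?g x = ?g y"
    show "x = y"
    proof (rule point_eqI[OF xy(1,2)])
      fix \<Gamma> assume \<Gamma>: "\<Gamma> \<in> \<E>"
      have "h \<Gamma> (part_of \<Gamma> x) = h \<Gamma> (part_of \<Gamma> y)" using f(2)[OF xy(1) \<Gamma>] f(2)[OF xy(2) \<Gamma>] xy by simp
      then show "part_of \<Gamma> x = part_of \<Gamma> y"
        using inj_onD[OF Bij_inj[OF h[OF \<Gamma>]]] part_of(1)[OF \<Gamma>] xy by blast
    qed
  qed
  moreover have "?g ` \<Omega> \<subseteq> \<Omega>" using f(1) by auto
  ultimately have "bij_betw ?g \<Omega> \<Omega>"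
    using endo_inj_surj[OF finite_\<Omega>] by (simp add: bij_betw_def)
  then have g: "?g \<in> Bij \<Omega>" by (simp add: Bij_def)
  have "?g \<in> base \<and> (\<forall>\<Gamma>\<in>\<E>. act \<Gamma> ?g = h \<Gamma>)"
    using f(2) by (intro base_coordinates[OF g h]) auto
  then show ?thesis by blast
qed

lemma coordinatewise_product_iff:
  assumes sub: "\<And>\<Gamma>. \<Gamma> \<in> \<E> \<Longrightarrow> S \<Gamma> \<subseteq> Bij \<Gamma>"
  shows "g \<in> coordinatewise_product \<Omega> \<E> S \<longleftrightarrow> g \<in> base \<and> (\<forall>\<Gamma>\<in>\<E>. act \<Gamma> g \<in> S \<Gamma>)"
proof
  assume "g \<in> coordinatewise_product \<Omega> \<E> S"
  then obtain h where g: "g \<in> Bij \<Omega>" and h: "h \<in> (\<Pi>\<^sub>E \<Gamma>\<in>\<E>. S \<Gamma>)"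
    and gh: "\<And>\<omega>. \<omega> \<in> \<Omega> \<Longrightarrow> coords \<E> (g \<omega>) = (\<lambda>\<Gamma>\<in>\<E>. h \<Gamma> (coords \<E> \<omega> \<Gamma>))"
    by (auto simp: coordinatewise_product_def)
  have hS: "h \<Gamma> \<in> S \<Gamma>" if "\<Gamma> \<in> \<E>" for \<Gamma> using h that by auto
  have "g \<in> base \<and> (\<forall>\<Gamma>\<in>\<E>. act \<Gamma> g = h \<Gamma>)"
  proof (rule base_coordinates[OF g])
    show "h \<Gamma> \<in> Bij \<Gamma>" if "\<Gamma> \<in> \<E>" for \<Gamma> using hS[OF that] sub[OF that] by blast
    show "part_of \<Gamma> (g \<omega>) = h \<Gamma> (part_of \<Gamma> \<omega>)" if "\<Gamma> \<in> \<E>" "\<omega> \<in> \<Omega>" for \<Gamma> \<omega>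
      using fun_cong[OF gh[OF that(2)], of \<Gamma>] that(1) by (simp add: coords_eq)
  qed
  then show "g \<in> base \<and> (\<forall>\<Gamma>\<in>\<E>. act \<Gamma> g \<in> S \<Gamma>)" using hS by simp
next
  assume g: "g \<in> base \<and> (\<forall>\<Gamma>\<in>\<E>. act \<Gamma> g \<in> S \<Gamma>)"
  let ?h = "\<lambda>\<Gamma>\<in>\<E>. act \<Gamma> g"
  have "coords \<E> (g \<omega>) = (\<lambda>\<Gamma>\<in>\<E>. ?h \<Gamma> (coords \<E> \<omega> \<Gamma>))" if \<omega>: "\<omega> \<in> \<Omega>" for \<omega>
  proof (rule extensionalityI)
    fix \<Gamma> assume \<Gamma>: "\<Gamma> \<in> \<E>"
    show "coords \<E> (g \<omega>) \<Gamma> = (\<lambda>\<Gamma>\<in>\<E>. ?h \<Gamma> (coords \<E> \<omega> \<Gamma>)) \<Gamma>"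
      using \<Gamma> act_part_of[OF \<Gamma> _ \<omega>] base_stab[OF _ \<Gamma>] g by (simp add: coords_eq)
  qed (auto simp: coords_def)
  moreover have "?h \<in> (\<Pi>\<^sub>E \<Gamma>\<in>\<E>. S \<Gamma>)" using g by auto
  ultimately show "g \<in> coordinatewise_product \<Omega> \<E> S"
    unfolding coordinatewise_product_def using g base_Bij by blast
qed

text \<open>The coordinate subgroup of \<open>base\<close> belonging to \<Gamma>. It is what allows
  a component of a coordinatewise product to be identified with a subgroup of
  \<Omega>-permutations.\<close>

definition supported :: "'a set set \<Rightarrow> ('a \<Rightarrow> 'a) \<Rightarrow> bool" where
  "supported \<Gamma> g \<longleftrightarrow> g \<in> base \<and> (\<forall>\<Delta>\<in>\<E> - {\<Gamma>}. act \<Delta> g = \<one>\<^bsub>BijGroup \<Delta>\<^esub>)"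

text \<open>Multiply the given supported elements one coordinate at a time; each of them changes
  only its own coordinate. The predicate \<open>Q\<close> is left open to serve both membership
  (prescribed actions) and transitivity (a prescribed image of one part).\<close>

lemma combine_coordinates:
  assumes Y: "subgroup Y \<B>"
    and one: "\<And>\<Delta>. \<Delta> \<in> \<E> \<Longrightarrow> \<exists>y\<in>Y. Q \<Delta> (act \<Delta> y) \<and> supported \<Delta> y"
  shows "\<exists>y\<in>Y. y \<in> base \<and> (\<forall>\<Delta>\<in>\<E>. Q \<Delta> (act \<Delta> y))"
proof -
  have "\<exists>y\<in>Y. y \<in> base \<and> (\<forall>\<Delta>\<in>F. Q \<Delta> (act \<Delta> y)) \<and> (\<forall>\<Delta>\<in>\<E> - F. act \<Delta> y = \<one>\<^bsub>BijGroup \<Delta>\<^esub>)"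
    if "finite F" "F \<subseteq> \<E>" for F
    using that
  proof (induction F)
    case empty
    show ?case
      using subgroup.one_closed[OF Y] subgroup.one_closed[OF base_subgroup] act_one by force
  next
    case (insert \<Gamma> F)
    then obtain y where y: "y \<in> Y" "y \<in> base" "\<forall>\<Delta>\<in>F. Q \<Delta> (act \<Delta> y)"
      "\<forall>\<Delta>\<in>\<E> - F. act \<Delta> y = \<one>\<^bsub>BijGroup \<Delta>\<^esub>" by auto
    obtain z where z: "z \<in> Y" "Q \<Gamma> (act \<Gamma> z)" "supported \<Gamma> z" using one insert by blast
    have zb: "z \<in> base" using z by (simp add: supported_def)
    let ?w = "y \<cdot> z"
    have act_w: "act \<Delta> ?w = act \<Delta> y \<otimes>\<^bsub>BijGroup \<Delta>\<^esub> act \<Delta> z" if "\<Delta> \<in> \<E>" for \<Delta>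
      using act_mult[OF that] base_stab[OF _ that] y(2) zb by blast
    have car: "act \<Delta> y \<in> carrier (BijGroup \<Delta>)" "act \<Delta> z \<in> carrier (BijGroup \<Delta>)" if "\<Delta> \<in> \<E>" for \<Delta>
      using act_Bij[OF that base_stab[OF y(2) that]] act_Bij[OF that base_stab[OF zb that]] by auto
    have l: "act \<Delta> ?w = act \<Delta> z" if "\<Delta> \<in> \<E>" "act \<Delta> y = \<one>\<^bsub>BijGroup \<Delta>\<^esub>" for \<Delta>
      using act_w[OF that(1)] car(2)[OF that(1)] that(2)
      by (simp add: monoid.l_one[OF group.is_monoid[OF group_BijGroup]])
    have r: "act \<Delta> ?w = act \<Delta> y" if "\<Delta> \<in> \<E>" "act \<Delta> z = \<one>\<^bsub>BijGroup \<Delta>\<^esub>" for \<Delta>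
      using act_w[OF that(1)] car(1)[OF that(1)] that(2)
      by (simp add: monoid.r_one[OF group.is_monoid[OF group_BijGroup]])
    have "Q \<Delta> (act \<Delta> ?w)" if \<Delta>: "\<Delta> \<in> insert \<Gamma> F" for \<Delta>
    proof (cases "\<Delta> = \<Gamma>")
      case True
      then have "act \<Delta> y = \<one>\<^bsub>BijGroup \<Delta>\<^esub>" "\<Delta> \<in> \<E>" using y insert by auto
      then show ?thesis using True z(2) l by simp
    next
      case False
      then have "act \<Delta> z = \<one>\<^bsub>BijGroup \<Delta>\<^esub>" "\<Delta> \<in> \<E>" "\<Delta> \<in> F" using z \<Delta> insert by (auto simp: supported_def)
      then show ?thesis using y(3) r by simp
    qed
    moreover have "act \<Delta> ?w = \<one>\<^bsub>BijGroup \<Delta>\<^esub>" if \<Delta>: "\<Delta> \<in> \<E> - insert \<Gamma> F" for \<Delta>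
    proof -
      have "act \<Delta> y = \<one>\<^bsub>BijGroup \<Delta>\<^esub>" "act \<Delta> z = \<one>\<^bsub>BijGroup \<Delta>\<^esub>"
        using y(4) z(3) \<Delta> by (auto simp: supported_def)
      then show ?thesis using l \<Delta> by simp
    qed
    moreover have "?w \<in> Y" "?w \<in> base"
      using subgroup.m_closed[OF Y y(1) z(1)] subgroup.m_closed[OF base_subgroup y(2) zb] by auto
    ultimately show ?case by blast
  qed
  from this[OF finite_\<E> order_refl] show ?thesis by blast
qed

lemma mem_by_coordinates:
  assumes "subgroup Y \<B>" "x \<in> base"
    and "\<And>\<Delta>. \<Delta> \<in> \<E> \<Longrightarrow> \<exists>y\<in>Y. act \<Delta> y = act \<Delta> x \<and> supported \<Delta> y"
  shows "x \<in> Y"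
proof -
  obtain y where y: "y \<in> Y" "y \<in> base" "\<forall>\<Delta>\<in>\<E>. act \<Delta> y = act \<Delta> x"
    using combine_coordinates[of Y "\<lambda>\<Delta> a. a = act \<Delta> x"] assms by blast
  then have "y = x" using base_eqI assms(2) by blast
  then show ?thesis using y by simp
qed

lemma transitive_by_coordinates:
  assumes "subgroup Y \<B>"
    and "\<And>\<Delta> \<gamma> \<delta>. \<Delta> \<in> \<E> \<Longrightarrow> \<gamma> \<in> \<Delta> \<Longrightarrow> \<delta> \<in> \<Delta> \<Longrightarrow> \<exists>y\<in>Y. act \<Delta> y \<gamma> = \<delta> \<and> supported \<Delta> y"
  shows "transitive_on Y \<Omega>"
  unfolding transitive_on_def
proof (intro ballI)
  fix x z assume xz: "x \<in> \<Omega>" "z \<in> \<Omega>"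
  obtain y where y: "y \<in> Y" "y \<in> base" "\<forall>\<Delta>\<in>\<E>. act \<Delta> y (part_of \<Delta> x) = part_of \<Delta> z"
    using combine_coordinates[of Y "\<lambda>\<Delta> a. a (part_of \<Delta> x) = part_of \<Delta> z"] assms part_of(1) xz by blast
  have "y x = z"
  proof (rule point_eqI)
    show "y x \<in> \<Omega>" using Bij_apply[OF base_Bij[OF y(2)] xz(1)] .
    show "part_of \<Gamma> (y x) = part_of \<Gamma> z" if \<Gamma>: "\<Gamma> \<in> \<E>" for \<Gamma>
      using act_part_of[OF \<Gamma> base_stab[OF y(2) \<Gamma>] xz(1)] y(3) \<Gamma> by simp
  qed (rule xz)
  then show "\<exists>g\<in>Y. g x = z" using y by blast
qed

section \<open>Conjugation carrying one coordinate to another\<close>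

lemma conj_stab:
  assumes "\<Gamma> \<in> \<E>" "\<Delta> \<in> \<E>" "g \<in> Bij \<Omega>" "move_partition g \<Gamma> = \<Delta>" "m \<in> stab \<Gamma>"
  shows "g \<triangleright> m \<in> stab \<Delta>"
proof -
  have "m \<in> Bij \<Omega>" "move_partition m \<Gamma> = \<Gamma>" using assms by (auto simp: stab_def)
  then show ?thesis
    using assms move_inv[OF assms(3,1,4)]
    by (simp add: stab_def Bij_mult_closed Bij_inv_closed move_mult \<B>.m_assoc)
qed

lemma conj_act:
  assumes "\<Gamma> \<in> \<E>" "\<Delta> \<in> \<E>" "g \<in> Bij \<Omega>" "move_partition g \<Gamma> = \<Delta>" "m \<in> stab \<Gamma>" "\<gamma> \<in> \<Gamma>"
  shows "act \<Delta> (g \<triangleright> m) (g ` \<gamma>) = g ` act \<Gamma> m \<gamma>"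
proof -
  have m: "m \<in> Bij \<Omega>" using assms stab_Bij by blast
  have g\<gamma>: "g ` \<gamma> \<in> \<Delta>" using assms by (auto simp: move_partition_def)
  have "(g \<triangleright> m) ` g ` \<gamma> = (g \<cdot> m) ` \<gamma>"
    using assms m part_subset[OF assms(2) g\<gamma>] part_subset[OF assms(1,6)]
    by (simp add: mult_BijGroup_image Bij_mult_closed Bij_inv_closed inv_BijGroup_image)
  then show ?thesis
    using g\<gamma> assms m part_subset[OF assms(1,6)] by (simp add: act_apply mult_BijGroup_image)
qed

text \<open>The bijection from the parts of \<Gamma> to those of \<Delta> given by \<open>g\<close>
  intertwines the two actions. This is the means by which statements about one coordinate are
  transported to the others.\<close>

lemma conj_act_one:
  assumes "\<Gamma> \<in> \<E>" "\<Delta> \<in> \<E>" "g \<in> Bij \<Omega>" "move_partition g \<Gamma> = \<Delta>" "m \<in> stab \<Gamma>"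
  shows "act \<Delta> (g \<triangleright> m) = \<one>\<^bsub>BijGroup \<Delta>\<^esub> \<longleftrightarrow> act \<Gamma> m = \<one>\<^bsub>BijGroup \<Gamma>\<^esub>"
proof
  have m: "m \<in> Bij \<Omega>" using assms stab_Bij by blast
  assume one: "act \<Delta> (g \<triangleright> m) = \<one>\<^bsub>BijGroup \<Delta>\<^esub>"
  show "act \<Gamma> m = \<one>\<^bsub>BijGroup \<Gamma>\<^esub>"
  proof (rule Bij_eqI[OF act_Bij[OF assms(1,5)] Bij_one_closed])
    fix \<gamma> assume \<gamma>: "\<gamma> \<in> \<Gamma>"
    have g\<gamma>: "g ` \<gamma> \<in> \<Delta>" using assms \<gamma> by (auto simp: move_partition_def)
    have "g ` act \<Gamma> m \<gamma> = g ` \<gamma>"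
      using conj_act[OF assms \<gamma>] one one_BijGroup_apply[OF g\<gamma>] by simp
    then have "act \<Gamma> m \<gamma> = \<gamma>"
      using inj_on_image_eq_iff[OF Bij_inj[OF assms(3)]] part_subset[OF assms(1)] \<gamma>
        Bij_apply[OF act_Bij[OF assms(1,5)] \<gamma>] by blast
    then show "act \<Gamma> m \<gamma> = \<one>\<^bsub>BijGroup \<Gamma>\<^esub> \<gamma>" using one_BijGroup_apply[OF \<gamma>] by simp
  qed
next
  assume one: "act \<Gamma> m = \<one>\<^bsub>BijGroup \<Gamma>\<^esub>"
  show "act \<Delta> (g \<triangleright> m) = \<one>\<^bsub>BijGroup \<Delta>\<^esub>"
  proof (rule Bij_eqI[OF act_Bij[OF assms(2) conj_stab[OF assms]] Bij_one_closed])
    fix \<delta> assume \<delta>: "\<delta> \<in> \<Delta>"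
    then obtain \<gamma> where \<gamma>: "\<gamma> \<in> \<Gamma>" "\<delta> = g ` \<gamma>" using assms(4) by (auto simp: move_partition_def)
    show "act \<Delta> (g \<triangleright> m) \<delta> = \<one>\<^bsub>BijGroup \<Delta>\<^esub> \<delta>"
      using conj_act[OF assms \<gamma>(1)] one one_BijGroup_apply[OF \<gamma>(1)] one_BijGroup_apply[OF \<delta>] \<gamma>(2) by simp
  qed
qed

end

section \<open>Normal subgroups of a group permuting the coordinates\<close>

lemma minimal_normal_subset_socle: "minimal_normal P H \<Longrightarrow> P \<subseteq> socle H"
  by (auto simp: socle_def intro: generate.incl)

lemma quasiprimitive_iff:
  assumes "subgroup G (BijGroup S)"
  shows "quasiprimitive S G \<longleftrightarrow>
    (\<forall>N. normal_within (BijGroup S) G N \<and> N \<noteq> {\<one>\<^bsub>BijGroup S\<^esub>} \<longrightarrow> transitive_on N S)"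
  using assms by (simp add: quasiprimitive_def group.normal_iff_normal_within[OF group_BijGroup assms])

text \<open>Pick x in \<open>A\<close> agreeing with \<open>c\<close> at one point. Both commute
  with the transitive group \<open>A\<close>, so agreement at one point spreads to all
  points.\<close>

lemma transitive_abelian_self_centralising:
  assumes A: "A \<subseteq> Bij S" "transitive_on A S"
    and comm: "\<And>x y. x \<in> A \<Longrightarrow> y \<in> A \<Longrightarrow> x \<otimes>\<^bsub>BijGroup S\<^esub> y = y \<otimes>\<^bsub>BijGroup S\<^esub> x"
    and c: "c \<in> Bij S" "\<And>x. x \<in> A \<Longrightarrow> c \<otimes>\<^bsub>BijGroup S\<^esub> x = x \<otimes>\<^bsub>BijGroup S\<^esub> c"
    and "S \<noteq> {}"
  shows "c \<in> A"
proof -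
  obtain s where s: "s \<in> S" using \<open>S \<noteq> {}\<close> by blast
  obtain x where x: "x \<in> A" "x s = c s"
    using A(2) s Bij_apply[OF c(1) s] by (auto simp: transitive_on_def)
  have xB: "x \<in> Bij S" using A x by blast
  have "c = x"
  proof (rule Bij_eqI[OF c(1) xB])
    fix t assume "t \<in> S"
    then obtain y where y: "y \<in> A" "y s = t" using A(2) s by (auto simp: transitive_on_def)
    have yB: "y \<in> Bij S" using A y by blast
    have "c (y s) = y (c s)"
      using fun_cong[OF c(2)[OF y(1)], of s] mult_BijGroup_apply[OF c(1) yB s] mult_BijGroup_apply[OF yB c(1) s] by simp
    moreover have "x (y s) = y (x s)"
      using fun_cong[OF comm[OF x(1) y(1)], of s] mult_BijGroup_apply[OF xB yB s] mult_BijGroup_apply[OF yB xB s] by simp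
    ultimately show "c t = x t" using x y by simp
  qed
  then show ?thesis using x by simp
qed

locale invariant_cartesian = cartesian +
  fixes G :: "('a \<Rightarrow> 'a) set"
  assumes G_subgroup: "subgroup G \<B>" and G_invariant: "invariant_decomposition G \<E>"
begin

lemma G_Bij: "g \<in> G \<Longrightarrow> g \<in> Bij \<Omega>"
  using subgroup.subset[OF G_subgroup] by auto

lemma move_\<E>: "g \<in> G \<Longrightarrow> \<Gamma> \<in> \<E> \<Longrightarrow> move_partition g \<Gamma> \<in> \<E>"
  using G_invariant by (auto simp: invariant_decomposition_def)

lemma component_eq:
  assumes "K \<subseteq> Bij \<Omega>"
  shows "component K \<Gamma> = act \<Gamma> ` (K \<inter> stab \<Gamma>)"
  using assms by (auto simp: component_def act_def stab_def)

lemma component_base: "K \<subseteq> base \<Longrightarrow> \<Gamma> \<in> \<E> \<Longrightarrow> component K \<Gamma> = act \<Gamma> ` K"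
  using component_eq[of K \<Gamma>] base_stab[of _ \<Gamma>] base_Bij by (metis inf.absorb1 subset_eq)

lemma finite_Bij_\<Gamma>: "\<Gamma> \<in> \<E> \<Longrightarrow> finite (Bij \<Gamma>)"
proof (rule finite_subset)
  show "Bij \<Gamma> \<subseteq> (\<Gamma> \<rightarrow>\<^sub>E \<Gamma>)"
    by (simp add: PiE_def Bij_imp_extensional Bij_imp_funcset subset_eq)
qed (simp add: finite_\<Gamma> finite_PiE)

lemma act_subgroup:
  assumes "\<Gamma> \<in> \<E>" "subgroup K \<B>" "K \<subseteq> stab \<Gamma>"
  shows "subgroup (act \<Gamma> ` K) (BijGroup \<Gamma>)"
  using group_hom.subgroup_img_is_subgroup[OF act_hom[OF assms(1)]]
    \<B>.subgroup_incl[OF assms(2) stab_subgroup[OF assms(1)] assms(3)] by blast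

lemma component_subgroup: "\<Gamma> \<in> \<E> \<Longrightarrow> subgroup (component G \<Gamma>) (BijGroup \<Gamma>)"
  using act_subgroup[of \<Gamma> "G \<inter> stab \<Gamma>"] \<B>.subgroups_Inter_pair[OF G_subgroup stab_subgroup, of \<Gamma>]
    component_eq[of G \<Gamma>] subgroup.subset[OF G_subgroup] by simp

lemma act_in_component: "g \<in> G \<Longrightarrow> g \<in> stab \<Gamma> \<Longrightarrow> act \<Gamma> g \<in> component G \<Gamma>"
  using component_eq[of G \<Gamma>] G_Bij by blast

lemma act_conj:
  assumes "\<Gamma> \<in> \<E>" "g \<in> stab \<Gamma>" "m \<in> stab \<Gamma>"
  shows "act \<Gamma> (g \<triangleright> m) =
    act \<Gamma> g \<otimes>\<^bsub>BijGroup \<Gamma>\<^esub> act \<Gamma> m \<otimes>\<^bsub>BijGroup \<Gamma>\<^esub> inv\<^bsub>BijGroup \<Gamma>\<^esub> (act \<Gamma> g)"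
  using assms subgroup.m_closed[OF stab_subgroup[OF assms(1)]] subgroup.m_inv_closed[OF stab_subgroup[OF assms(1)]]
  by (simp add: act_mult act_inv)

lemma act_normal:
  assumes \<Gamma>: "\<Gamma> \<in> \<E>" and N: "normal_within \<B> G N" "N \<subseteq> stab \<Gamma>"
  shows "normal_within (BijGroup \<Gamma>) (component G \<Gamma>) (act \<Gamma> ` N)"
  unfolding normal_within_def
proof (intro conjI ballI)
  have NG: "N \<subseteq> G" "subgroup N \<B>" using N by (auto simp: normal_within_def)
  show "subgroup (act \<Gamma> ` N) (BijGroup \<Gamma>)" using act_subgroup[OF \<Gamma> NG(2) N(2)] .
  show "act \<Gamma> ` N \<subseteq> component G \<Gamma>" using act_in_component N NG by blast
  fix c a assume "c \<in> component G \<Gamma>" "a \<in> act \<Gamma> ` N"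
  then obtain g n where g: "g \<in> G" "g \<in> stab \<Gamma>" "c = act \<Gamma> g" and n: "n \<in> N" "a = act \<Gamma> n"
    using component_eq[of G \<Gamma>] G_Bij by blast
  have "g \<triangleright> n \<in> N" using N g n by (simp add: normal_within_def)
  then show "c \<otimes>\<^bsub>BijGroup \<Gamma>\<^esub> a \<otimes>\<^bsub>BijGroup \<Gamma>\<^esub> inv\<^bsub>BijGroup \<Gamma>\<^esub> c \<in> act \<Gamma> ` N"
    using act_conj[OF \<Gamma> g(2), of n] g n N(2) by (metis imageI subset_eq)
qed

lemma conj_base:
  assumes g: "g \<in> G" and m: "m \<in> base"
  shows "g \<triangleright> m \<in> base"
proof -
  have "g \<triangleright> m \<in> stab \<Delta>" if \<Delta>: "\<Delta> \<in> \<E>" for \<Delta>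
  proof -
    have "\<Delta> \<in> move_partition g ` \<E>" using G_invariant g \<Delta> by (simp add: invariant_decomposition_def)
    then obtain \<Gamma> where "\<Gamma> \<in> \<E>" "move_partition g \<Gamma> = \<Delta>" by blast
    then show ?thesis using conj_stab[OF _ \<Delta> G_Bij[OF g]] base_stab[OF m] by blast
  qed
  moreover have "g \<triangleright> m \<in> Bij \<Omega>"
    using G_Bij[OF g] base_Bij[OF m] by simp
  ultimately show ?thesis by (simp add: base_def stab_def)
qed

lemma supported_conj:
  assumes g: "g \<in> G" and \<Gamma>: "\<Gamma> \<in> \<E>" and m: "supported \<Gamma> m" and mv: "move_partition g \<Gamma> = \<Delta>"
  shows "supported \<Delta> (g \<triangleright> m)"
  unfolding supported_def
proof (intro conjI ballI)
  have mb: "m \<in> base" using m by (simp add: supported_def)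
  show "g \<triangleright> m \<in> base" using conj_base[OF g mb] .
  fix \<Lambda> assume \<Lambda>: "\<Lambda> \<in> \<E> - {\<Delta>}"
  then have "\<Lambda> \<in> move_partition g ` \<E>" using G_invariant g by (simp add: invariant_decomposition_def)
  then obtain \<Theta> where \<Theta>: "\<Theta> \<in> \<E>" "move_partition g \<Theta> = \<Lambda>" by blast
  then have "act \<Theta> m = \<one>\<^bsub>BijGroup \<Theta>\<^esub>" using m mv \<Lambda> by (auto simp: supported_def)
  then show "act \<Lambda> (g \<triangleright> m) = \<one>\<^bsub>BijGroup \<Lambda>\<^esub>"
    using conj_act_one[OF \<Theta>(1) _ G_Bij[OF g] \<Theta>(2) base_stab[OF mb \<Theta>(1)]] \<Lambda> by simp
qed

text \<open>An elementwise form of \<open>normal_decomposition\<close>: the \<Gamma>-coordinate of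
  any element of \<open>M\<close>, with all other coordinates replaced by the identity, again
  belongs to \<open>M\<close>.\<close>

definition splits :: "('a \<Rightarrow> 'a) set \<Rightarrow> bool" where
  "splits M \<longleftrightarrow> M \<subseteq> base \<and> (\<forall>\<Gamma>\<in>\<E>. \<forall>m\<in>M. \<exists>m'\<in>M. act \<Gamma> m' = act \<Gamma> m \<and> supported \<Gamma> m')"

lemma splits_mem:
  assumes M: "subgroup M \<B>" "splits M" and x: "x \<in> base" "\<And>\<Gamma>. \<Gamma> \<in> \<E> \<Longrightarrow> act \<Gamma> x \<in> act \<Gamma> ` M"
  shows "x \<in> M"
proof (rule mem_by_coordinates[OF M(1) x(1)])
  fix \<Delta> assume \<Delta>: "\<Delta> \<in> \<E>"
  then obtain m where "m \<in> M" "act \<Delta> m = act \<Delta> x" using x(2)[OF \<Delta>] by (metis imageE)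
  then show "\<exists>y\<in>M. act \<Delta> y = act \<Delta> x \<and> supported \<Delta> y"
    using M(2) \<Delta> unfolding splits_def by metis
qed

lemma normal_decomposition_iff_splits:
  assumes M: "subgroup M \<B>"
  shows "normal_decomposition \<Omega> M \<E> \<longleftrightarrow> splits M"
proof -
  have MB: "M \<subseteq> Bij \<Omega>" using subgroup.subset[OF M] by simp
  have base_iff: "(\<forall>g\<in>M. \<forall>\<Gamma>\<in>\<E>. move_partition g \<Gamma> = \<Gamma>) \<longleftrightarrow> M \<subseteq> base"
    using MB by (auto simp: base_def)
  have "M = coordinatewise_product \<Omega> \<E> (\<lambda>\<Gamma>. component M \<Gamma>) \<longleftrightarrow> splits M" if Mb: "M \<subseteq> base"
  proof -
    have prod: "g \<in> coordinatewise_product \<Omega> \<E> (\<lambda>\<Gamma>. component M \<Gamma>) \<longleftrightarrow>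
        g \<in> base \<and> (\<forall>\<Gamma>\<in>\<E>. act \<Gamma> g \<in> act \<Gamma> ` M)" for g
    proof (subst coordinatewise_product_iff)
      show "component M \<Gamma> \<subseteq> Bij \<Gamma>" if "\<Gamma> \<in> \<E>" for \<Gamma>
        unfolding component_base[OF Mb that] using act_Bij[OF that base_stab[OF _ that]] Mb by auto
    qed (simp add: component_base[OF Mb])
    show ?thesis
    proof
      assume eq: "M = coordinatewise_product \<Omega> \<E> (\<lambda>\<Gamma>. component M \<Gamma>)"
      show "splits M"
        unfolding splits_def
      proof (intro conjI ballI Mb)
        fix \<Gamma> m assume \<Gamma>: "\<Gamma> \<in> \<E>" and m: "m \<in> M"
        let ?h = "\<lambda>\<Delta>. if \<Delta> = \<Gamma> then act \<Gamma> m else \<one>\<^bsub>BijGroup \<Delta>\<^esub>"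
        have "?h \<Delta> \<in> Bij \<Delta>" if "\<Delta> \<in> \<E>" for \<Delta>
          using act_Bij[OF \<Gamma>] base_stab[OF _ \<Gamma>] m Mb Bij_one_closed[of \<Delta>] by auto
        then obtain g where g: "g \<in> base" "\<forall>\<Delta>\<in>\<E>. act \<Delta> g = ?h \<Delta>"
          using base_from_coordinates[of ?h] by blast
        have "act \<Delta> g \<in> act \<Delta> ` M" if \<Delta>: "\<Delta> \<in> \<E>" for \<Delta>
        proof (cases "\<Delta> = \<Gamma>")
          case True
          then show ?thesis using g \<Delta> m by simp
        next
          case False
          then have "act \<Delta> g = act \<Delta> \<one>\<^bsub>\<B>\<^esub>" using g \<Delta> act_one[OF \<Delta>] by simp
          then show ?thesis using subgroup.one_closed[OF M] by blast
        qed
        then have "g \<in> coordinatewise_product \<Omega> \<E> (\<lambda>\<Gamma>. component M \<Gamma>)"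
          unfolding prod using g(1) by blast
        then have "g \<in> M" using eq by simp
        moreover have "supported \<Gamma> g" using g by (simp add: supported_def)
        moreover have "act \<Gamma> g = act \<Gamma> m" using g(2) \<Gamma> by simp
        ultimately show "\<exists>m'\<in>M. act \<Gamma> m' = act \<Gamma> m \<and> supported \<Gamma> m'" by blast
      qed
    next
      assume S: "splits M"
      show "M = coordinatewise_product \<Omega> \<E> (\<lambda>\<Gamma>. component M \<Gamma>)"
      proof (intro equalityI subsetI)
        fix x assume "x \<in> M"
        then show "x \<in> coordinatewise_product \<Omega> \<E> (\<lambda>\<Gamma>. component M \<Gamma>)" unfolding prod using Mb by blast
      next
        fix x assume "x \<in> coordinatewise_product \<Omega> \<E> (\<lambda>\<Gamma>. component M \<Gamma>)"
        then show "x \<in> M" unfolding prod by (intro splits_mem[OF M S]) auto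
      qed
    qed
  qed
  then show ?thesis
    unfolding normal_decomposition_def base_iff by (auto simp: splits_def)
qed

text \<open>When \<open>M\<close> splits and \<open>G\<close> is transitive on the partitions, this
  is the product over all coordinates of the conjugates of \<open>P\<close>. Quantifying over every
  \<open>g\<close> that carries some \<Delta> to \<Gamma> avoids a choice of transversal and makes
  invariance under \<open>G\<close> a matter of re-indexing.\<close>

definition lift :: "('a \<Rightarrow> 'a) set \<Rightarrow> 'a set set \<Rightarrow> ('a set \<Rightarrow> 'a set) set \<Rightarrow> ('a \<Rightarrow> 'a) set" where
  "lift M \<Gamma> P = {m \<in> M. \<forall>g\<in>G. \<forall>\<Delta>\<in>\<E>. move_partition g \<Delta> = \<Gamma> \<longrightarrow>
     act \<Gamma> (g \<triangleright> m) \<in> P}"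

lemma liftD:
  "m \<in> lift M \<Gamma> P \<Longrightarrow> g \<in> G \<Longrightarrow> \<Delta> \<in> \<E> \<Longrightarrow> move_partition g \<Delta> = \<Gamma> \<Longrightarrow>
    act \<Gamma> (g \<triangleright> m) \<in> P"
  unfolding lift_def by blast

lemma lift_normal:
  assumes \<Gamma>: "\<Gamma> \<in> \<E>" and M: "normal_within \<B> G M" "M \<subseteq> base"
    and P: "normal_within (BijGroup \<Gamma>) (component G \<Gamma>) P"
  shows "normal_within \<B> G (lift M \<Gamma> P)"
proof -
  have Ms: "subgroup M \<B>" and MG: "M \<subseteq> G" and Mn: "\<And>g m. g \<in> G \<Longrightarrow> m \<in> M \<Longrightarrow> g \<cdot> m \<cdot> inv\<^bsub>\<B>\<^esub> g \<in> M"
    using M by (auto simp: normal_within_def)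
  have Ps: "subgroup P (BijGroup \<Gamma>)" using P by (simp add: normal_within_def)
  have MB: "m \<in> carrier \<B>" if "m \<in> M" for m using subgroup.mem_carrier[OF Ms that] .
  have GB: "g \<in> carrier \<B>" if "g \<in> G" for g using subgroup.mem_carrier[OF G_subgroup that] .
  have st: "g \<triangleright> m \<in> stab \<Gamma>" if "g \<in> G" "m \<in> M" for g m
    using base_stab[OF _ \<Gamma>] Mn[OF that] M(2) by blast
  have "subgroup (lift M \<Gamma> P) \<B>"
  proof (rule \<B>.subgroupI)
    show "lift M \<Gamma> P \<subseteq> carrier \<B>" using MB by (auto simp: lift_def)
    have "\<one>\<^bsub>\<B>\<^esub> \<in> lift M \<Gamma> P"
      using subgroup.one_closed[OF Ms] GB act_one[OF \<Gamma>] subgroup.one_closed[OF Ps] by (auto simp: lift_def)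
    then show "lift M \<Gamma> P \<noteq> {}" by blast
  next
    fix a assume a: "a \<in> lift M \<Gamma> P"
    then have aM: "a \<in> M" by (simp add: lift_def)
    show "inv\<^bsub>\<B>\<^esub> a \<in> lift M \<Gamma> P"
      unfolding lift_def
    proof (intro CollectI conjI ballI impI)
      show "inv\<^bsub>\<B>\<^esub> a \<in> M" using subgroup.m_inv_closed[OF Ms aM] .
      fix g \<Delta> assume g: "g \<in> G" and \<Delta>: "\<Delta> \<in> \<E>" "move_partition g \<Delta> = \<Gamma>"
      have "g \<cdot> inv\<^bsub>\<B>\<^esub> a \<cdot> inv\<^bsub>\<B>\<^esub> g = inv\<^bsub>\<B>\<^esub> (g \<triangleright> a)"
        using GB[OF g] MB[OF aM] by (simp add: \<B>.inv_mult_group \<B>.m_assoc)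
      then have "act \<Gamma> (g \<cdot> inv\<^bsub>\<B>\<^esub> a \<cdot> inv\<^bsub>\<B>\<^esub> g) = inv\<^bsub>BijGroup \<Gamma>\<^esub> (act \<Gamma> (g \<triangleright> a))"
        using act_inv[OF \<Gamma> st[OF g aM]] by simp
      then show "act \<Gamma> (g \<cdot> inv\<^bsub>\<B>\<^esub> a \<cdot> inv\<^bsub>\<B>\<^esub> g) \<in> P"
        using subgroup.m_inv_closed[OF Ps liftD[OF a g \<Delta>]] by simp
    qed
    fix b assume b: "b \<in> lift M \<Gamma> P"
    then have bM: "b \<in> M" by (simp add: lift_def)
    show "a \<cdot> b \<in> lift M \<Gamma> P"
      unfolding lift_def
    proof (intro CollectI conjI ballI impI)
      show "a \<cdot> b \<in> M" using subgroup.m_closed[OF Ms aM bM] .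
      fix g \<Delta> assume g: "g \<in> G" and \<Delta>: "\<Delta> \<in> \<E>" "move_partition g \<Delta> = \<Gamma>"
      have "g \<cdot> (a \<cdot> b) \<cdot> inv\<^bsub>\<B>\<^esub> g =
          (g \<triangleright> a) \<cdot> (g \<triangleright> b)"
        using GB[OF g] MB[OF aM] MB[OF bM] by (simp add: \<B>.m_assoc)
      then have "act \<Gamma> (g \<cdot> (a \<cdot> b) \<cdot> inv\<^bsub>\<B>\<^esub> g) =
          act \<Gamma> (g \<triangleright> a) \<otimes>\<^bsub>BijGroup \<Gamma>\<^esub> act \<Gamma> (g \<triangleright> b)"
        using act_mult[OF \<Gamma> st[OF g aM] st[OF g bM]] by simp
      then show "act \<Gamma> (g \<cdot> (a \<cdot> b) \<cdot> inv\<^bsub>\<B>\<^esub> g) \<in> P"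
        using subgroup.m_closed[OF Ps liftD[OF a g \<Delta>] liftD[OF b g \<Delta>]] by simp
    qed
  qed
  moreover have "x \<triangleright> m \<in> lift M \<Gamma> P" if x: "x \<in> G" and m: "m \<in> lift M \<Gamma> P" for x m
    unfolding lift_def
  proof (intro CollectI conjI ballI impI)
    have mM: "m \<in> M" using m by (simp add: lift_def)
    show "x \<triangleright> m \<in> M" using Mn[OF x mM] .
    fix g \<Delta> assume g: "g \<in> G" and \<Delta>: "\<Delta> \<in> \<E>" "move_partition g \<Delta> = \<Gamma>"
    \<comment> \<open>The condition on the conjugate of m by x at the pair g, \<Delta> is the
      condition on m at the pair g x, x^-1 \<Delta>.\<close>
    have gx: "g \<cdot> x \<in> G" using subgroup.m_closed[OF G_subgroup g x] .
    have xi: "inv\<^bsub>\<B>\<^esub> x \<in> G" using subgroup.m_inv_closed[OF G_subgroup x] .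
    have \<Theta>: "move_partition (inv\<^bsub>\<B>\<^esub> x) \<Delta> \<in> \<E>" using move_\<E>[OF xi \<Delta>(1)] .
    have "move_partition (g \<cdot> x) (move_partition (inv\<^bsub>\<B>\<^esub> x) \<Delta>) = \<Gamma>"
      using move_mult[OF G_Bij[OF gx] G_Bij[OF xi] \<Delta>(1)] GB[OF g] GB[OF x] \<Delta>(2) by (simp add: \<B>.m_assoc)
    then have "act \<Gamma> ((g \<cdot> x) \<cdot> m \<cdot> inv\<^bsub>\<B>\<^esub> (g \<cdot> x)) \<in> P"
      using liftD[OF m gx \<Theta>] by simp
    moreover have "(g \<cdot> x) \<cdot> m \<cdot> inv\<^bsub>\<B>\<^esub> (g \<cdot> x) =
        g \<cdot> (x \<triangleright> m) \<cdot> inv\<^bsub>\<B>\<^esub> g"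
      using GB[OF g] GB[OF x] MB[OF mM] by (simp add: \<B>.inv_mult_group \<B>.m_assoc)
    ultimately show "act \<Gamma> (g \<cdot> (x \<triangleright> m) \<cdot> inv\<^bsub>\<B>\<^esub> g) \<in> P" by simp
  qed
  ultimately show ?thesis using MG by (auto simp: normal_within_def lift_def)
qed

lemma lift_act:
  assumes "\<Gamma> \<in> \<E>" "m \<in> lift M \<Gamma> P" "M \<subseteq> Bij \<Omega>"
  shows "act \<Gamma> m \<in> P"
proof -
  have "act \<Gamma> (\<one>\<^bsub>\<B>\<^esub> \<cdot> m \<cdot> inv\<^bsub>\<B>\<^esub> \<one>\<^bsub>\<B>\<^esub>) \<in> P"
    using assms(2) subgroup.one_closed[OF G_subgroup] move_one[OF assms(1)] assms(1) unfolding lift_def by blast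
  moreover have "m \<in> carrier \<B>" using assms by (auto simp: lift_def)
  ultimately show ?thesis by simp
qed

text \<open>A conjugating element fixing \<Gamma> acts on \<Gamma> through the component, which
  normalises \<open>P\<close>; one bringing another coordinate to \<Gamma> brings a trivial action
  with it.\<close>

lemma lift_supported:
  assumes \<Gamma>: "\<Gamma> \<in> \<E>" and P: "normal_within (BijGroup \<Gamma>) (component G \<Gamma>) P"
    and m: "m \<in> M" "act \<Gamma> m \<in> P" "supported \<Gamma> m"
  shows "m \<in> lift M \<Gamma> P"
  unfolding lift_def
proof (intro CollectI conjI ballI impI m(1))
  have mb: "m \<in> base" using m by (simp add: supported_def)
  fix g \<Delta> assume g: "g \<in> G" and \<Delta>: "\<Delta> \<in> \<E>" "move_partition g \<Delta> = \<Gamma>"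
  show "act \<Gamma> (g \<triangleright> m) \<in> P"
  proof (cases "\<Delta> = \<Gamma>")
    case True
    then have gs: "g \<in> stab \<Gamma>" using g \<Delta> G_Bij by (simp add: stab_def)
    then show ?thesis
      using act_conj[OF \<Gamma> gs base_stab[OF mb \<Gamma>]] P m(2) act_in_component[OF g gs] by (simp add: normal_within_def)
  next
    case False
    then have "act \<Delta> m = \<one>\<^bsub>BijGroup \<Delta>\<^esub>" using m \<Delta> by (simp add: supported_def)
    then have "act \<Gamma> (g \<triangleright> m) = \<one>\<^bsub>BijGroup \<Gamma>\<^esub>"
      using conj_act_one[OF \<Delta>(1) \<Gamma> G_Bij[OF g] \<Delta>(2) base_stab[OF mb \<Delta>(1)]] by simp
    then show ?thesis using P subgroup.one_closed[of P "BijGroup \<Gamma>"] by (simp add: normal_within_def)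
  qed
qed

lemma supported_in_lift:
  assumes \<Gamma>: "\<Gamma> \<in> \<E>" and P: "normal_within (BijGroup \<Gamma>) (component G \<Gamma>) P"
    and M: "splits M" and a: "a \<in> P" "a \<in> act \<Gamma> ` M"
  shows "\<exists>m\<in>lift M \<Gamma> P. act \<Gamma> m = a \<and> supported \<Gamma> m"
proof -
  obtain n where "n \<in> M" "act \<Gamma> n = a" using a(2) by blast
  then obtain m where "m \<in> M" "act \<Gamma> m = a" "supported \<Gamma> m"
    using M \<Gamma> unfolding splits_def by metis
  then show ?thesis using lift_supported[OF \<Gamma> P, of m M] a(1) by blast
qed

lemma transitive_act:
  assumes \<Gamma>: "\<Gamma> \<in> \<E>" and Y: "transitive_on Y \<Omega>" "Y \<subseteq> stab \<Gamma>"
  shows "transitive_on (act \<Gamma> ` Y) \<Gamma>"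
  unfolding transitive_on_def
proof (intro ballI)
  fix \<gamma> \<delta> assume gd: "\<gamma> \<in> \<Gamma>" "\<delta> \<in> \<Gamma>"
  obtain x z where xz: "x \<in> \<gamma>" "z \<in> \<delta>" using gd part_nonempty[OF \<Gamma>] by blast
  have O: "x \<in> \<Omega>" "z \<in> \<Omega>" using xz gd part_subset[OF \<Gamma>] by auto
  obtain y where y: "y \<in> Y" "y x = z" using Y(1) O by (auto simp: transitive_on_def)
  have "act \<Gamma> y \<gamma> = \<delta>"
    using act_part_of[OF \<Gamma> _ O(1), of y] y Y(2) part_of_eq[OF \<Gamma> gd(1) xz(1)] part_of_eq[OF \<Gamma> gd(2) xz(2)] by auto
  then show "\<exists>g\<in>act \<Gamma> ` Y. g \<gamma> = \<delta>" using y by blast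
qed

lemma transporter:
  assumes "transitive_decomposition G \<E>" "\<Gamma> \<in> \<E>" "\<Delta> \<in> \<E>"
  shows "\<exists>g. g \<in> G \<and> move_partition g \<Gamma> = \<Delta>"
  using assms unfolding transitive_decomposition_def by (metis (no_types))

text \<open>Each coordinate can be moved to \<Gamma> by an element of \<open>G\<close>, and
  \<open>N\<close> is invariant under the corresponding conjugation; so \<open>N\<close> acts
  faithfully on any single coordinate in the sense of its whole image.\<close>

lemma act_trivial_imp_trivial:
  assumes N: "normal_within \<B> G N" "N \<subseteq> base" and tr: "transitive_decomposition G \<E>"
    and \<Gamma>: "\<Gamma> \<in> \<E>" and one: "act \<Gamma> ` N = {\<one>\<^bsub>BijGroup \<Gamma>\<^esub>}"
  shows "N = {\<one>\<^bsub>\<B>\<^esub>}"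
proof -
  have "n = \<one>\<^bsub>\<B>\<^esub>" if n: "n \<in> N" for n
  proof (rule base_eq_one)
    show nb: "n \<in> base" using n N by blast
    fix \<Delta> assume \<Delta>: "\<Delta> \<in> \<E>"
    obtain g where g: "g \<in> G" "move_partition g \<Delta> = \<Gamma>"
      using transporter[OF tr \<Delta> \<Gamma>] by blast
    have "g \<triangleright> n \<in> N" using N g n by (simp add: normal_within_def)
    then have "act \<Gamma> (g \<triangleright> n) = \<one>\<^bsub>BijGroup \<Gamma>\<^esub>" using one by blast
    then show "act \<Delta> n = \<one>\<^bsub>BijGroup \<Delta>\<^esub>"
      using conj_act_one[OF \<Delta> \<Gamma> G_Bij[OF g(1)] g(2) base_stab[OF nb \<Delta>]] by simp
  qed
  moreover have "\<one>\<^bsub>\<B>\<^esub> \<in> N" using N subgroup.one_closed[of N \<B>] by (simp add: normal_within_def)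
  ultimately show ?thesis by blast
qed

lemma transitive_act_nontrivial:
  assumes "\<Gamma> \<in> \<E>" "transitive_on A \<Gamma>"
  shows "A \<noteq> {\<one>\<^bsub>BijGroup \<Gamma>\<^esub>}"
proof
  assume A: "A = {\<one>\<^bsub>BijGroup \<Gamma>\<^esub>}"
  obtain \<gamma> \<delta> where "\<gamma> \<in> \<Gamma>" "\<delta> \<in> \<Gamma>" "\<gamma> \<noteq> \<delta>" using two_parts[OF assms(1)] by blast
  then show False
    using assms(2) one_BijGroup_apply[of \<gamma> \<Gamma>] unfolding A transitive_on_def by (metis singletonD)
qed

lemma supported_subgroup:
  assumes \<Gamma>: "\<Gamma> \<in> \<E>"
  shows "subgroup {g. supported \<Gamma> g} \<B>"
proof (rule \<B>.subgroupI)
  show "{g. supported \<Gamma> g} \<subseteq> carrier \<B>" using base_Bij by (auto simp: supported_def)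
  have "supported \<Gamma> \<one>\<^bsub>\<B>\<^esub>" using subgroup.one_closed[OF base_subgroup] by (simp add: supported_def act_one)
  then show "{g. supported \<Gamma> g} \<noteq> {}" by blast
next
  fix x assume "x \<in> {g. supported \<Gamma> g}"
  then have x: "x \<in> base" "\<And>\<Delta>. \<Delta> \<in> \<E> \<Longrightarrow> \<Delta> \<noteq> \<Gamma> \<Longrightarrow> act \<Delta> x = \<one>\<^bsub>BijGroup \<Delta>\<^esub>"
    by (auto simp: supported_def)
  have "act \<Delta> (inv\<^bsub>\<B>\<^esub> x) = \<one>\<^bsub>BijGroup \<Delta>\<^esub>" if \<Delta>: "\<Delta> \<in> \<E>" "\<Delta> \<noteq> \<Gamma>" for \<Delta>
  proof -
    interpret D: group "BijGroup \<Delta>" by (rule group_BijGroup)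
    show ?thesis using act_inv[OF \<Delta>(1) base_stab[OF x(1) \<Delta>(1)]] x(2)[OF \<Delta>] by simp
  qed
  then show "inv\<^bsub>\<B>\<^esub> x \<in> {g. supported \<Gamma> g}"
    using subgroup.m_inv_closed[OF base_subgroup x(1)] by (simp add: supported_def)
  fix y assume "y \<in> {g. supported \<Gamma> g}"
  then have y: "y \<in> base" "\<And>\<Delta>. \<Delta> \<in> \<E> \<Longrightarrow> \<Delta> \<noteq> \<Gamma> \<Longrightarrow> act \<Delta> y = \<one>\<^bsub>BijGroup \<Delta>\<^esub>"
    by (auto simp: supported_def)
  have "act \<Delta> (x \<cdot> y) = \<one>\<^bsub>BijGroup \<Delta>\<^esub>" if \<Delta>: "\<Delta> \<in> \<E>" "\<Delta> \<noteq> \<Gamma>" for \<Delta>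
  proof -
    interpret D: group "BijGroup \<Delta>" by (rule group_BijGroup)
    show ?thesis
      using act_mult[OF \<Delta>(1) base_stab[OF x(1) \<Delta>(1)] base_stab[OF y(1) \<Delta>(1)]] x(2)[OF \<Delta>] y(2)[OF \<Delta>] by simp
  qed
  then show "x \<cdot> y \<in> {g. supported \<Gamma> g}"
    using subgroup.m_closed[OF base_subgroup x(1) y(1)] by (simp add: supported_def)
qed

text \<open>
  The commutator of an element of \<open>N\<close> with an element supported on the single coordinate \<open>\<Gamma>\<close> lies in
  \<open>N\<close> and is again supported on \<open>\<Gamma>\<close>.
\<close>

lemma lift_subset:
  assumes tr: "transitive_decomposition G \<E>" and \<Gamma>: "\<Gamma> \<in> \<E>"
    and N: "normal_within \<B> G N" "N \<subseteq> base" and M: "normal_within \<B> G M" "splits M"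
    and P: "minimal_normal P (perm_group \<Gamma> (component G \<Gamma>))" "P \<subseteq> act \<Gamma> ` N" "P \<subseteq> act \<Gamma> ` M"
    and nonab: "a \<in> P" "b \<in> P" "a \<otimes>\<^bsub>BijGroup \<Gamma>\<^esub> b \<noteq> b \<otimes>\<^bsub>BijGroup \<Gamma>\<^esub> a"
  shows "lift M \<Gamma> P \<subseteq> N"
proof -
  interpret C: group "BijGroup \<Gamma>" by (rule group_BijGroup)
  note C_sub = component_subgroup[OF \<Gamma>]
  have Pn: "normal_within (BijGroup \<Gamma>) (component G \<Gamma>) P"
    and Pmin: "\<And>K. normal_within (BijGroup \<Gamma>) (component G \<Gamma>) K \<Longrightarrow> K \<subseteq> P \<Longrightarrow> K = {\<one>\<^bsub>BijGroup \<Gamma>\<^esub>} \<or> K = P"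
    using P(1) by (auto simp: C.minimal_normal_within[OF C_sub])
  have Ps: "subgroup P (BijGroup \<Gamma>)" using Pn by (simp add: normal_within_def)
  have Ns: "subgroup N \<B>" and Nn: "\<And>g n. g \<in> G \<Longrightarrow> n \<in> N \<Longrightarrow> g \<cdot> n \<cdot> inv\<^bsub>\<B>\<^esub> g \<in> N"
    using N by (auto simp: normal_within_def)
  have Mb: "M \<subseteq> base" using M by (simp add: splits_def)
  have MG: "M \<subseteq> G" using M by (simp add: normal_within_def)
  \<comment> \<open>The part of \<open>P\<close> realised inside \<open>N\<close> by elements
    supported on \<Gamma>. It is normalised by the component and contains a non-trivial commutator,
    so minimality of \<open>P\<close> gives \<open>Q = P\<close>.\<close>
  define Q where "Q = {c \<in> P. \<exists>m\<in>N. act \<Gamma> m = c \<and> supported \<Gamma> m}"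
  have sup_mult: "supported \<Gamma> (x \<cdot> y)" if "supported \<Gamma> x" "supported \<Gamma> y" for x y
    using subgroup.m_closed[OF supported_subgroup[OF \<Gamma>]] that by simp
  have sup_inv: "supported \<Gamma> (inv\<^bsub>\<B>\<^esub> x)" if "supported \<Gamma> x" for x
    using subgroup.m_inv_closed[OF supported_subgroup[OF \<Gamma>]] that by simp
  have sup_b: "x \<in> base" if "supported \<Gamma> x" for x using that by (simp add: supported_def)
  have "normal_within (BijGroup \<Gamma>) (component G \<Gamma>) Q"
    unfolding normal_within_def
  proof (intro conjI ballI)
    show "subgroup Q (BijGroup \<Gamma>)"
    proof (rule C.subgroupI)
      show "Q \<subseteq> carrier (BijGroup \<Gamma>)" using subgroup.subset[OF Ps] by (auto simp: Q_def)
      have "\<one>\<^bsub>BijGroup \<Gamma>\<^esub> \<in> Q"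
        unfolding Q_def
      proof (intro CollectI conjI bexI)
        show "\<one>\<^bsub>BijGroup \<Gamma>\<^esub> \<in> P" using subgroup.one_closed[OF Ps] .
        show "\<one>\<^bsub>\<B>\<^esub> \<in> N" using subgroup.one_closed[OF Ns] .
        show "act \<Gamma> \<one>\<^bsub>\<B>\<^esub> = \<one>\<^bsub>BijGroup \<Gamma>\<^esub>" using act_one[OF \<Gamma>] .
        show "supported \<Gamma> \<one>\<^bsub>\<B>\<^esub>" using subgroup.one_closed[OF base_subgroup] by (simp add: supported_def act_one)
      qed
      then show "Q \<noteq> {}" by blast
    next
      fix c assume "c \<in> Q"
      then obtain m where m: "c \<in> P" "m \<in> N" "act \<Gamma> m = c" "supported \<Gamma> m" by (auto simp: Q_def)
      have "act \<Gamma> (inv\<^bsub>\<B>\<^esub> m) = inv\<^bsub>BijGroup \<Gamma>\<^esub> c" using act_inv[OF \<Gamma> base_stab[OF sup_b[OF m(4)] \<Gamma>]] m(3) by simp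
      then show "inv\<^bsub>BijGroup \<Gamma>\<^esub> c \<in> Q"
        using subgroup.m_inv_closed[OF Ps m(1)] subgroup.m_inv_closed[OF Ns m(2)] sup_inv[OF m(4)]
        unfolding Q_def by blast
      fix d assume "d \<in> Q"
      then obtain n where n: "d \<in> P" "n \<in> N" "act \<Gamma> n = d" "supported \<Gamma> n" by (auto simp: Q_def)
      have "act \<Gamma> (m \<cdot> n) = c \<otimes>\<^bsub>BijGroup \<Gamma>\<^esub> d"
        using act_mult[OF \<Gamma> base_stab[OF sup_b[OF m(4)] \<Gamma>] base_stab[OF sup_b[OF n(4)] \<Gamma>]] m(3) n(3) by simp
      then show "c \<otimes>\<^bsub>BijGroup \<Gamma>\<^esub> d \<in> Q"
        using subgroup.m_closed[OF Ps m(1) n(1)] subgroup.m_closed[OF Ns m(2) n(2)] sup_mult[OF m(4) n(4)]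
        unfolding Q_def by blast
    qed
    show "Q \<subseteq> component G \<Gamma>" using Pn by (auto simp: Q_def normal_within_def)
    fix c d assume c: "c \<in> component G \<Gamma>" and "d \<in> Q"
    then obtain n where n: "d \<in> P" "n \<in> N" "act \<Gamma> n = d" "supported \<Gamma> n" by (auto simp: Q_def)
    obtain g where g: "g \<in> G" "g \<in> stab \<Gamma>" "c = act \<Gamma> g"
      using c component_eq[of G \<Gamma>] G_Bij by blast
    have "act \<Gamma> (g \<triangleright> n) = c \<otimes>\<^bsub>BijGroup \<Gamma>\<^esub> d \<otimes>\<^bsub>BijGroup \<Gamma>\<^esub> inv\<^bsub>BijGroup \<Gamma>\<^esub> c"
      using act_conj[OF \<Gamma> g(2) base_stab[OF sup_b[OF n(4)] \<Gamma>]] g(3) n(3) by simp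
    moreover have "supported \<Gamma> (g \<triangleright> n)"
      using supported_conj[OF g(1) \<Gamma> n(4)] g(2) by (simp add: stab_def)
    moreover have "c \<otimes>\<^bsub>BijGroup \<Gamma>\<^esub> d \<otimes>\<^bsub>BijGroup \<Gamma>\<^esub> inv\<^bsub>BijGroup \<Gamma>\<^esub> c \<in> P"
      using Pn c n(1) by (simp add: normal_within_def)
    ultimately show "c \<otimes>\<^bsub>BijGroup \<Gamma>\<^esub> d \<otimes>\<^bsub>BijGroup \<Gamma>\<^esub> inv\<^bsub>BijGroup \<Gamma>\<^esub> c \<in> Q"
      using Nn[OF g(1) n(2)] unfolding Q_def by blast
  qed
  moreover have "Q \<noteq> {\<one>\<^bsub>BijGroup \<Gamma>\<^esub>}"
  proof -
    obtain n where n: "n \<in> N" "act \<Gamma> n = a" using nonab(1) P(2) by blast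
    obtain m where m: "m \<in> M" "act \<Gamma> m = b" "supported \<Gamma> m"
    proof -
      obtain m0 where "m0 \<in> M" "act \<Gamma> m0 = b" using nonab(2) P(3) by blast
      then show thesis using M(2) \<Gamma> that unfolding splits_def by metis
    qed
    have nb: "n \<in> base" and mb: "m \<in> base" using n N sup_b[OF m(3)] by auto
    \<comment> \<open>The commutator of \<open>n\<close> and \<open>m\<close>. It acts on \<Gamma>
      as the non-trivial commutator of \<open>a\<close> and \<open>b\<close>; on any other
      coordinate \<open>m\<close> is trivial, whatever \<open>n\<close> does there.\<close>
    let ?x = "n \<triangleright> m \<cdot> inv\<^bsub>\<B>\<^esub> m"
    have car: "n \<in> carrier \<B>" "m \<in> carrier \<B>" using base_Bij nb mb by auto
    have "m \<cdot> inv\<^bsub>\<B>\<^esub> n \<cdot> inv\<^bsub>\<B>\<^esub> m \<in> N"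
      using Nn[of m "inv\<^bsub>\<B>\<^esub> n"] m(1) MG subgroup.m_inv_closed[OF Ns n(1)] by blast
    then have xN: "?x \<in> N"
      using subgroup.m_closed[OF Ns n(1)] car by (simp add: \<B>.m_assoc)
    have act_x: "act \<Delta> ?x = act \<Delta> n \<otimes>\<^bsub>BijGroup \<Delta>\<^esub> act \<Delta> m \<otimes>\<^bsub>BijGroup \<Delta>\<^esub> inv\<^bsub>BijGroup \<Delta>\<^esub> (act \<Delta> n) \<otimes>\<^bsub>BijGroup \<Delta>\<^esub> inv\<^bsub>BijGroup \<Delta>\<^esub> (act \<Delta> m)"
      if \<Delta>: "\<Delta> \<in> \<E>" for \<Delta>
    proof -
      note st = base_stab[OF nb \<Delta>] base_stab[OF mb \<Delta>] and cl = subgroup.m_closed[OF stab_subgroup[OF \<Delta>]]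
        and icl = subgroup.m_inv_closed[OF stab_subgroup[OF \<Delta>]]
      show ?thesis using st cl icl by (simp add: act_mult[OF \<Delta>] act_inv[OF \<Delta>])
    qed
    have "act \<Delta> ?x = \<one>\<^bsub>BijGroup \<Delta>\<^esub>" if \<Delta>: "\<Delta> \<in> \<E> - {\<Gamma>}" for \<Delta>
    proof -
      interpret D: group "BijGroup \<Delta>" by (rule group_BijGroup)
      have "act \<Delta> m = \<one>\<^bsub>BijGroup \<Delta>\<^esub>" "act \<Delta> n \<in> carrier (BijGroup \<Delta>)"
        using m(3) \<Delta> act_Bij[OF _ base_stab[OF nb]] by (auto simp: supported_def)
      then show ?thesis using act_x \<Delta> by simp
    qed
    then have sx: "supported \<Gamma> ?x"
      using xN N by (auto simp: supported_def)
    have ac: "a \<in> carrier (BijGroup \<Gamma>)" "b \<in> carrier (BijGroup \<Gamma>)" using subgroup.subset[OF Ps] nonab by auto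
    have ax: "act \<Gamma> ?x = a \<otimes>\<^bsub>BijGroup \<Gamma>\<^esub> b \<otimes>\<^bsub>BijGroup \<Gamma>\<^esub> inv\<^bsub>BijGroup \<Gamma>\<^esub> a \<otimes>\<^bsub>BijGroup \<Gamma>\<^esub> inv\<^bsub>BijGroup \<Gamma>\<^esub> b"
      using act_x[OF \<Gamma>] n m by simp
    moreover have "a \<otimes>\<^bsub>BijGroup \<Gamma>\<^esub> b \<otimes>\<^bsub>BijGroup \<Gamma>\<^esub> inv\<^bsub>BijGroup \<Gamma>\<^esub> a \<otimes>\<^bsub>BijGroup \<Gamma>\<^esub> inv\<^bsub>BijGroup \<Gamma>\<^esub> b \<in> P"
      by (intro subgroup.m_closed[OF Ps] subgroup.m_inv_closed[OF Ps] nonab)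
    ultimately have "act \<Gamma> ?x \<in> Q" using xN sx unfolding Q_def by auto
    moreover have "act \<Gamma> ?x \<noteq> \<one>\<^bsub>BijGroup \<Gamma>\<^esub>"
      using C.commute_if_commutator_one[OF ac] nonab(3) ax by auto
    ultimately show ?thesis by blast
  qed
  ultimately have QP: "Q = P" using Pmin[of Q] by (auto simp: Q_def)
  show ?thesis
  proof
    fix x assume x: "x \<in> lift M \<Gamma> P"
    have xM: "x \<in> M" using x by (simp add: lift_def)
    show "x \<in> N"
    proof (rule mem_by_coordinates[OF Ns])
      show "x \<in> base" using xM Mb by blast
      fix \<Delta> assume \<Delta>: "\<Delta> \<in> \<E>"
      obtain y where y: "y \<in> M" "act \<Delta> y = act \<Delta> x" "supported \<Delta> y"
        using M(2) \<Delta> xM unfolding splits_def by blast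
      \<comment> \<open>The coordinate \<Delta> of \<open>x\<close> is transported to \<Gamma>,
        where its action lies in \<open>P = Q\<close> and is realised in \<open>N\<close>;
        conjugating back returns the required supported element.\<close>
      obtain g where g: "g \<in> G" "move_partition g \<Delta> = \<Gamma>"
        using transporter[OF tr \<Delta> \<Gamma>] by blast
      have gc: "g \<in> carrier \<B>" "y \<in> carrier \<B>" "x \<in> carrier \<B>"
        using G_Bij[OF g(1)] y(1) xM Mb base_Bij by auto
      let ?z = "g \<triangleright> y"
      have sz: "supported \<Gamma> ?z" using supported_conj[OF g(1) \<Delta> y(3) g(2)] .
      have "act \<Gamma> ?z = act \<Gamma> (g \<triangleright> x)"
      proof (rule Bij_eqI)
        have yb: "y \<in> stab \<Delta>" "x \<in> stab \<Delta>" using y(1) xM Mb base_stab[OF _ \<Delta>] by auto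
        show "act \<Gamma> ?z \<in> Bij \<Gamma>" "act \<Gamma> (g \<triangleright> x) \<in> Bij \<Gamma>"
          using act_Bij[OF \<Gamma> conj_stab[OF \<Delta> \<Gamma> G_Bij[OF g(1)] g(2)]] yb by auto
        fix \<gamma> assume "\<gamma> \<in> \<Gamma>"
        then obtain \<delta> where \<delta>: "\<delta> \<in> \<Delta>" "\<gamma> = g ` \<delta>" using g(2) by (auto simp: move_partition_def)
        show "act \<Gamma> ?z \<gamma> = act \<Gamma> (g \<triangleright> x) \<gamma>"
          using conj_act[OF \<Delta> \<Gamma> G_Bij[OF g(1)] g(2) yb(1) \<delta>(1)] conj_act[OF \<Delta> \<Gamma> G_Bij[OF g(1)] g(2) yb(2) \<delta>(1)] y(2) \<delta>(2) by simp
      qed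
      then have "act \<Gamma> ?z \<in> Q" using liftD[OF x g(1) \<Delta> g(2)] QP by simp
      then obtain n where n: "n \<in> N" "act \<Gamma> n = act \<Gamma> ?z" "supported \<Gamma> n" by (auto simp: Q_def)
      have "n = ?z"
      proof (rule base_eqI[OF sup_b[OF n(3)] sup_b[OF sz]])
        show "act \<Theta> n = act \<Theta> ?z" if "\<Theta> \<in> \<E>" for \<Theta>
          using n sz that by (cases "\<Theta> = \<Gamma>") (auto simp: supported_def)
      qed
      then have "inv\<^bsub>\<B>\<^esub> g \<cdot> ?z \<cdot> inv\<^bsub>\<B>\<^esub> (inv\<^bsub>\<B>\<^esub> g) \<in> N"
        using Nn[OF subgroup.m_inv_closed[OF G_subgroup g(1)] n(1)] by simp
      then have "y \<in> N" using gc by (simp add: \<B>.m_assoc)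
      then show "\<exists>y\<in>N. act \<Delta> y = act \<Delta> x \<and> supported \<Delta> y" using y by blast
    qed
  qed
qed

text \<open>One coordinate can be adjusted at a time: carry the two parts back to \<Gamma>, join
  them by an element of \<open>P\<close>, realise that element with support on \<Gamma>, and
  conjugate the result to \<Delta>.\<close>

lemma lift_transitive:
  assumes tr: "transitive_decomposition G \<E>" and \<Gamma>: "\<Gamma> \<in> \<E>"
    and M: "normal_within \<B> G M" "splits M"
    and P: "normal_within (BijGroup \<Gamma>) (component G \<Gamma>) P" "P \<subseteq> act \<Gamma> ` M" "transitive_on P \<Gamma>"
  shows "transitive_on (lift M \<Gamma> P) \<Omega>"
proof (rule transitive_by_coordinates)
  have L: "normal_within \<B> G (lift M \<Gamma> P)"
    using lift_normal[OF \<Gamma> M(1) _ P(1)] M(2) by (simp add: splits_def)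
  then show "subgroup (lift M \<Gamma> P) \<B>" by (simp add: normal_within_def)
  fix \<Delta> \<gamma> \<delta> assume \<Delta>: "\<Delta> \<in> \<E>" and gd: "\<gamma> \<in> \<Delta>" "\<delta> \<in> \<Delta>"
  obtain g where g: "g \<in> G" "move_partition g \<Gamma> = \<Delta>"
    using transporter[OF tr \<Gamma> \<Delta>] by blast
  obtain \<gamma>' \<delta>' where gd': "\<gamma>' \<in> \<Gamma>" "\<gamma> = g ` \<gamma>'" "\<delta>' \<in> \<Gamma>" "\<delta> = g ` \<delta>'"
    using gd g(2) by (auto simp: move_partition_def)
  obtain a where a: "a \<in> P" "a \<gamma>' = \<delta>'" using P(3) gd'(1,3) unfolding transitive_on_def by metis
  obtain m where m: "m \<in> lift M \<Gamma> P" "act \<Gamma> m = a" "supported \<Gamma> m"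
    using supported_in_lift[OF \<Gamma> P(1) M(2) a(1)] a(1) P(2) by blast
  let ?y = "g \<triangleright> m"
  have "?y \<in> lift M \<Gamma> P" using L g m by (simp add: normal_within_def)
  moreover have "supported \<Delta> ?y" using supported_conj[OF g(1) \<Gamma> m(3) g(2)] .
  moreover have "act \<Delta> ?y \<gamma> = \<delta>"
    using conj_act[OF \<Gamma> \<Delta> G_Bij[OF g(1)] g(2) base_stab[OF _ \<Gamma>] gd'(1)] m a gd' by (simp add: supported_def)
  ultimately show "\<exists>y\<in>lift M \<Gamma> P. act \<Delta> y \<gamma> = \<delta> \<and> supported \<Delta> y" by blast
qed

text \<open>\<open>N\<close> and \<open>M\<close> commute elementwise. If n moved \<Gamma> to
  another partition, conjugation by n would send a non-trivial element of \<open>M\<close> supported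
  on \<Gamma> to one supported elsewhere, although it has to fix that element.\<close>

lemma commuting_normal_base:
  assumes N: "normal_within \<B> G N" and M: "normal_within \<B> G M" "splits M" "transitive_on M \<Omega>"
    and NM: "N \<inter> M = {\<one>\<^bsub>\<B>\<^esub>}"
  shows "N \<subseteq> base" "\<And>\<Gamma> n m. \<Gamma> \<in> \<E> \<Longrightarrow> n \<in> N \<Longrightarrow> m \<in> M \<Longrightarrow>
    act \<Gamma> n \<otimes>\<^bsub>BijGroup \<Gamma>\<^esub> act \<Gamma> m = act \<Gamma> m \<otimes>\<^bsub>BijGroup \<Gamma>\<^esub> act \<Gamma> n"
proof -
  have comm: "n \<cdot> m = m \<cdot> n" if "n \<in> N" "m \<in> M" for n m
    using \<B>.normal_within_commute[OF N M(1) NM that] .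
  have Mb: "M \<subseteq> base" using M by (simp add: splits_def)
  have NG: "N \<subseteq> G" using N by (simp add: normal_within_def)
  have "move_partition n \<Gamma> = \<Gamma>" if n: "n \<in> N" and \<Gamma>: "\<Gamma> \<in> \<E>" for n \<Gamma>
  proof (rule ccontr)
    have nG: "n \<in> G" using n NG by blast
    let ?\<Delta> = "move_partition n \<Gamma>"
    assume ne: "?\<Delta> \<noteq> \<Gamma>"
    have \<Delta>: "?\<Delta> \<in> \<E>" using move_\<E>[OF nG \<Gamma>] .
    have "act \<Gamma> ` M \<noteq> {\<one>\<^bsub>BijGroup \<Gamma>\<^esub>}"
      using transitive_act_nontrivial[OF \<Gamma>] transitive_act[OF \<Gamma> M(3)] Mb base_stab[OF _ \<Gamma>] by blast
    moreover have "M \<noteq> {}" using M(1) subgroup.one_closed[of M \<B>] by (auto simp: normal_within_def)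
    ultimately have "\<exists>m0\<in>M. act \<Gamma> m0 \<noteq> \<one>\<^bsub>BijGroup \<Gamma>\<^esub>" by (metis image_cong image_constant_conv)
    then obtain m where m: "m \<in> M" "act \<Gamma> m \<noteq> \<one>\<^bsub>BijGroup \<Gamma>\<^esub>" "supported \<Gamma> m"
      using M(2) \<Gamma> unfolding splits_def by metis
    have c: "n \<in> carrier \<B>" "m \<in> carrier \<B>" using G_Bij[OF nG] m(1) Mb base_Bij by auto
    have "n \<triangleright> m = m" using \<B>.conj_eq_if_commute[OF c comm[OF n m(1)]] .
    then have "act ?\<Delta> m \<noteq> \<one>\<^bsub>BijGroup ?\<Delta>\<^esub>"
      using conj_act_one[OF \<Gamma> \<Delta> G_Bij[OF nG] refl base_stab[OF _ \<Gamma>], of m] m Mb by auto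
    then show False using m(3) \<Delta> ne by (simp add: supported_def)
  qed
  then show Nb: "N \<subseteq> base" using NG G_Bij by (auto simp: base_def)
  fix \<Gamma> n m assume \<Gamma>: "\<Gamma> \<in> \<E>" and nm: "n \<in> N" "m \<in> M"
  have "n \<in> stab \<Gamma>" "m \<in> stab \<Gamma>" using nm Nb Mb base_stab[OF _ \<Gamma>] by auto
  then show "act \<Gamma> n \<otimes>\<^bsub>BijGroup \<Gamma>\<^esub> act \<Gamma> m = act \<Gamma> m \<otimes>\<^bsub>BijGroup \<Gamma>\<^esub> act \<Gamma> n"
    using comm[OF nm] act_mult[OF \<Gamma>, of n m] act_mult[OF \<Gamma>, of m n] by simp
qed

end

lemma transitive_on_mono: "transitive_on A S \<Longrightarrow> A \<subseteq> B \<Longrightarrow> transitive_on B S"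
  unfolding transitive_on_def by (meson subsetD)

subsection \<open>Blow-up decompositions\<close>

locale blow_up = invariant_cartesian +
  fixes M :: "('a \<Rightarrow> 'a) set"
  assumes M_normal: "normal_within \<B> G M" and M_transitive: "transitive_on M \<Omega>" and M_splits: "splits M"
    and M_socle: "\<Gamma> \<in> \<E> \<Longrightarrow> act \<Gamma> ` M = socle (perm_group \<Gamma> (component G \<Gamma>))"
    and \<E>_transitive: "transitive_decomposition G \<E>"
begin

lemma M_base: "M \<subseteq> base" and M_subgroup: "subgroup M \<B>" and M_G: "M \<subseteq> G"
  using M_splits M_normal by (auto simp: splits_def normal_within_def)

lemma minimal_normal_component:
  assumes \<Gamma>: "\<Gamma> \<in> \<E>" and P: "minimal_normal P (perm_group \<Gamma> (component G \<Gamma>))"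
  shows "normal_within (BijGroup \<Gamma>) (component G \<Gamma>) P" "P \<noteq> {\<one>\<^bsub>BijGroup \<Gamma>\<^esub>}" "P \<subseteq> act \<Gamma> ` M" "P \<subseteq> Bij \<Gamma>"
proof -
  show n: "normal_within (BijGroup \<Gamma>) (component G \<Gamma>) P" "P \<noteq> {\<one>\<^bsub>BijGroup \<Gamma>\<^esub>}"
    using P by (auto simp: group.minimal_normal_within[OF group_BijGroup component_subgroup[OF \<Gamma>]])
  show "P \<subseteq> act \<Gamma> ` M" using minimal_normal_subset_socle[OF P] M_socle[OF \<Gamma>] by simp
  show "P \<subseteq> Bij \<Gamma>" using n(1) subgroup.subset[of P "BijGroup \<Gamma>"] by (simp add: normal_within_def)
qed

lemma minimal_normal_component_exists:
  assumes \<Gamma>: "\<Gamma> \<in> \<E>" and N: "normal_within (BijGroup \<Gamma>) (component G \<Gamma>) N" "N \<noteq> {\<one>\<^bsub>BijGroup \<Gamma>\<^esub>}"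
  shows "\<exists>P. minimal_normal P (perm_group \<Gamma> (component G \<Gamma>)) \<and> P \<subseteq> N"
proof -
  interpret C: group "BijGroup \<Gamma>" by (rule group_BijGroup)
  have "N \<subseteq> Bij \<Gamma>" using N(1) subgroup.subset[of N "BijGroup \<Gamma>"] by (simp add: normal_within_def)
  then have "finite N" using finite_Bij_\<Gamma>[OF \<Gamma>] finite_subset by blast
  then show ?thesis using C.minimal_normal_within_exists[OF component_subgroup[OF \<Gamma>] N] by metis
qed

text \<open>A minimal normal subgroup \<open>P\<close> inside \<open>N\<close> lifts to a
  non-trivial normal subgroup of \<open>G\<close>. That lift is transitive on \<Omega>, hence on
  \<Gamma>, where it acts inside \<open>P\<close>.\<close>

lemma component_quasiprimitive:
  assumes q: "quasiprimitive \<Omega> G" and \<Gamma>: "\<Gamma> \<in> \<E>"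
  shows "quasiprimitive \<Gamma> (component G \<Gamma>)"
  unfolding quasiprimitive_iff[OF component_subgroup[OF \<Gamma>]]
proof (intro allI impI, elim conjE)
  fix N assume N: "normal_within (BijGroup \<Gamma>) (component G \<Gamma>) N" "N \<noteq> {\<one>\<^bsub>BijGroup \<Gamma>\<^esub>}"
  obtain P where P: "minimal_normal P (perm_group \<Gamma> (component G \<Gamma>))" "P \<subseteq> N"
    using minimal_normal_component_exists[OF \<Gamma> N] by blast
  note Pn = minimal_normal_component[OF \<Gamma> P(1)]
  have L: "normal_within \<B> G (lift M \<Gamma> P)" using lift_normal[OF \<Gamma> M_normal M_base Pn(1)] .
  have "\<one>\<^bsub>BijGroup \<Gamma>\<^esub> \<in> P" using Pn(1) subgroup.one_closed[of P "BijGroup \<Gamma>"] by (simp add: normal_within_def)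
  then obtain a where a: "a \<in> P" "a \<noteq> \<one>\<^bsub>BijGroup \<Gamma>\<^esub>" using Pn(2) by blast
  obtain m where m: "m \<in> lift M \<Gamma> P" "act \<Gamma> m = a"
    using supported_in_lift[OF \<Gamma> Pn(1) M_splits a(1)] a(1) Pn(3) by blast
  have "m \<noteq> \<one>\<^bsub>\<B>\<^esub>" using m(2) a(2) act_one[OF \<Gamma>] by auto
  then have "transitive_on (lift M \<Gamma> P) \<Omega>"
    using q L m(1) by (auto simp: quasiprimitive_iff[OF G_subgroup])
  moreover have "lift M \<Gamma> P \<subseteq> stab \<Gamma>" using M_base base_stab[OF _ \<Gamma>] by (auto simp: lift_def)
  ultimately have "transitive_on (act \<Gamma> ` lift M \<Gamma> P) \<Gamma>" using transitive_act[OF \<Gamma>] by blast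
  moreover have "act \<Gamma> ` lift M \<Gamma> P \<subseteq> N"
    using lift_act[OF \<Gamma>, of _ M P] M_base base_Bij P(2) by blast
  ultimately show "transitive_on N \<Gamma>" by (rule transitive_on_mono)
qed

text \<open>A minimal normal \<open>P\<close> inside the image of \<open>N\<close> also lies in the
  socle, which is the image of \<open>M\<close>. Since \<open>N\<close> and \<open>M\<close>
  commute, \<open>P\<close> is central in the image of \<open>N\<close>, and in particular
  abelian.\<close>

lemma central_minimal_normal:
  assumes \<Gamma>: "\<Gamma> \<in> \<E>" and N: "normal_within \<B> G N" "N \<inter> M = {\<one>\<^bsub>\<B>\<^esub>}"
    and ne: "act \<Gamma> ` N \<noteq> {\<one>\<^bsub>BijGroup \<Gamma>\<^esub>}"
  shows "\<exists>P. minimal_normal P (perm_group \<Gamma> (component G \<Gamma>)) \<and>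
    (\<forall>c\<in>act \<Gamma> ` N. \<forall>a\<in>P. c \<otimes>\<^bsub>BijGroup \<Gamma>\<^esub> a = a \<otimes>\<^bsub>BijGroup \<Gamma>\<^esub> c) \<and>
    (\<forall>a\<in>P. \<forall>b\<in>P. a \<otimes>\<^bsub>BijGroup \<Gamma>\<^esub> b = b \<otimes>\<^bsub>BijGroup \<Gamma>\<^esub> a)"
proof -
  note cb = commuting_normal_base[OF N(1) M_normal M_splits M_transitive N(2)]
  have "N \<subseteq> stab \<Gamma>" using cb(1) base_stab[OF _ \<Gamma>] by blast
  then obtain P where P: "minimal_normal P (perm_group \<Gamma> (component G \<Gamma>))" "P \<subseteq> act \<Gamma> ` N"
    using minimal_normal_component_exists[OF \<Gamma> act_normal[OF \<Gamma> N(1)] ne] by blast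
  have c: "c \<otimes>\<^bsub>BijGroup \<Gamma>\<^esub> a = a \<otimes>\<^bsub>BijGroup \<Gamma>\<^esub> c" if ca: "c \<in> act \<Gamma> ` N" "a \<in> P" for c a
  proof -
    have "a \<in> act \<Gamma> ` M" using ca(2) minimal_normal_component(3)[OF \<Gamma> P(1)] by blast
    then obtain n m where "n \<in> N" "c = act \<Gamma> n" "m \<in> M" "a = act \<Gamma> m" using ca(1) by blast
    then show ?thesis using cb(2)[OF \<Gamma>] by simp
  qed
  show ?thesis using P c by (intro exI[of _ P]) (metis subsetD)
qed

lemma socle_eq:
  assumes q: "quasiprimitive \<Omega> G"
  shows "socle (perm_group \<Omega> G) = M"
proof
  interpret W: group "perm_group \<Omega> G" using \<B>.subgroup_imp_group[OF G_subgroup] .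
  have M_W: "subgroup M (perm_group \<Omega> G)" using \<B>.subgroup_incl[OF M_subgroup G_subgroup M_G] .
  have tr: "transitive_on N \<Omega>" if "normal_within \<B> G N" "N \<noteq> {\<one>\<^bsub>\<B>\<^esub>}" for N
    using q that by (simp add: quasiprimitive_iff[OF G_subgroup])
  have parts_ne: "\<Gamma> \<noteq> {}" if "\<Gamma> \<in> \<E>" for \<Gamma> using two_parts[OF that] by blast
  have tr_comp: "transitive_on P \<Gamma>"
    if "\<Gamma> \<in> \<E>" "minimal_normal P (perm_group \<Gamma> (component G \<Gamma>))" for P \<Gamma>
    using component_quasiprimitive[OF q that(1)] minimal_normal_component(1,2)[OF that]
    by (simp add: quasiprimitive_iff[OF component_subgroup[OF that(1)]])
  show "socle (perm_group \<Omega> G) \<subseteq> M"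
    unfolding socle_def
  proof (rule W.generate_subgroup_incl[OF _ M_W], rule Union_least)
    fix N assume "N \<in> {N. minimal_normal N (perm_group \<Omega> G)}"
    then have N: "normal_within \<B> G N" "N \<noteq> {\<one>\<^bsub>\<B>\<^esub>}"
      and min: "\<And>K. normal_within \<B> G K \<Longrightarrow> K \<subseteq> N \<Longrightarrow> K = {\<one>\<^bsub>\<B>\<^esub>} \<or> K = N"
      by (auto simp: \<B>.minimal_normal_within[OF G_subgroup])
    show "N \<subseteq> M"
    proof (cases "N \<inter> M = {\<one>\<^bsub>\<B>\<^esub>}")
      case False
      then have "N \<inter> M = N" using min[OF \<B>.normal_within_Int[OF N(1) M_normal]] by blast
      then show ?thesis by blast
    next
      case True
      note cb = commuting_normal_base(1)[OF N(1) M_normal M_splits M_transitive True]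
      show ?thesis
      proof
        fix n assume n: "n \<in> N"
        show "n \<in> M"
        proof (rule splits_mem[OF M_subgroup M_splits])
          show "n \<in> base" using n cb by blast
          fix \<Gamma> assume \<Gamma>: "\<Gamma> \<in> \<E>"
          show "act \<Gamma> n \<in> act \<Gamma> ` M"
          proof (cases "act \<Gamma> ` N = {\<one>\<^bsub>BijGroup \<Gamma>\<^esub>}")
            case True
            then have "act \<Gamma> n = act \<Gamma> \<one>\<^bsub>\<B>\<^esub>" using imageI[OF n, of "act \<Gamma>"] act_one[OF \<Gamma>] by simp
            then show ?thesis using subgroup.one_closed[OF M_subgroup] by blast
          next
            case ne: False
            obtain P where P: "minimal_normal P (perm_group \<Gamma> (component G \<Gamma>))"
              and cent: "\<forall>c\<in>act \<Gamma> ` N. \<forall>a\<in>P. c \<otimes>\<^bsub>BijGroup \<Gamma>\<^esub> a = a \<otimes>\<^bsub>BijGroup \<Gamma>\<^esub> c"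
              and ab: "\<forall>a\<in>P. \<forall>b\<in>P. a \<otimes>\<^bsub>BijGroup \<Gamma>\<^esub> b = b \<otimes>\<^bsub>BijGroup \<Gamma>\<^esub> a"
              using central_minimal_normal[OF \<Gamma> N(1) True ne] by blast
            \<comment> \<open>\<open>P\<close> is abelian and transitive, so it contains the element
              \<open>act \<Gamma> n\<close> centralising it. Hence even a minimal normal
              \<open>N\<close> meeting \<open>M\<close> trivially acts on each coordinate as
              elements of \<open>M\<close> do.\<close>
            have "act \<Gamma> n \<in> P"
            proof (rule transitive_abelian_self_centralising[OF minimal_normal_component(4)[OF \<Gamma> P] tr_comp[OF \<Gamma> P]])
              show "act \<Gamma> n \<in> Bij \<Gamma>" using act_Bij[OF \<Gamma> base_stab[OF _ \<Gamma>]] n cb by blast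
            qed (use ab cent n parts_ne[OF \<Gamma>] in auto)
            then show ?thesis using minimal_normal_component(3)[OF \<Gamma> P] by blast
          qed
        qed
      qed
    qed
  qed
  have M_ne: "M \<noteq> {\<one>\<^bsub>\<B>\<^esub>}"
  proof
    assume M1: "M = {\<one>\<^bsub>\<B>\<^esub>}"
    obtain \<Gamma> where \<Gamma>: "\<Gamma> \<in> \<E>" using \<E>_nonempty by blast
    have "transitive_on (act \<Gamma> ` M) \<Gamma>" using transitive_act[OF \<Gamma> M_transitive] M_base base_stab[OF _ \<Gamma>] by blast
    then show False using transitive_act_nontrivial[OF \<Gamma>] act_one[OF \<Gamma>] by (auto simp: M1)
  qed
  show "M \<subseteq> socle (perm_group \<Omega> G)"
  \<comment> \<open>The commutator argument needs every minimal normal subgroup of every component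
    to be non-abelian; a single abelian one is treated separately and forces \<open>M\<close> to be
    abelian.\<close>
  proof (cases "\<exists>\<Gamma>\<in>\<E>. \<exists>P. minimal_normal P (perm_group \<Gamma> (component G \<Gamma>)) \<and>
      (\<forall>a\<in>P. \<forall>b\<in>P. a \<otimes>\<^bsub>BijGroup \<Gamma>\<^esub> b = b \<otimes>\<^bsub>BijGroup \<Gamma>\<^esub> a)")
    case True
    then obtain \<Gamma> P where \<Gamma>: "\<Gamma> \<in> \<E>" and P: "minimal_normal P (perm_group \<Gamma> (component G \<Gamma>))"
      and ab: "\<And>a b. a \<in> P \<Longrightarrow> b \<in> P \<Longrightarrow> a \<otimes>\<^bsub>BijGroup \<Gamma>\<^esub> b = b \<otimes>\<^bsub>BijGroup \<Gamma>\<^esub> a" by blast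
    interpret C: group "BijGroup \<Gamma>" by (rule group_BijGroup)
    note C_sub = component_subgroup[OF \<Gamma>]
    interpret CW: group "perm_group \<Gamma> (component G \<Gamma>)" using C.subgroup_imp_group[OF C_sub] .
    note Pn = minimal_normal_component[OF \<Gamma> P] and Ptr = tr_comp[OF \<Gamma> P]
    have Ps: "subgroup P (perm_group \<Gamma> (component G \<Gamma>))"
      using C.subgroup_incl[OF _ C_sub] Pn(1) by (simp add: normal_within_def)
    \<comment> \<open>Another minimal normal subgroup \<open>Q\<close> either lies in
      \<open>P\<close> or centralises it; in the latter case \<open>P\<close>, being
      self-centralising, contains \<open>Q\<close> all the same.\<close>
    have "act \<Gamma> ` M \<subseteq> P"
      unfolding M_socle[OF \<Gamma>] socle_def
    proof (rule CW.generate_subgroup_incl[OF _ Ps], rule Union_least)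
      fix Q assume "Q \<in> {N. minimal_normal N (perm_group \<Gamma> (component G \<Gamma>))}"
      then have Q: "minimal_normal Q (perm_group \<Gamma> (component G \<Gamma>))" by simp
      note Qn = minimal_normal_component[OF \<Gamma> Q]
      have min: "P \<inter> Q = {\<one>\<^bsub>BijGroup \<Gamma>\<^esub>} \<or> P \<inter> Q = Q"
        using Q C.normal_within_Int[OF Pn(1) Qn(1)] by (simp add: C.minimal_normal_within[OF C_sub])
      show "Q \<subseteq> P"
      proof (cases "P \<inter> Q = {\<one>\<^bsub>BijGroup \<Gamma>\<^esub>}")
        case False
        then show ?thesis using min by blast
      next
        case True
        have "c \<in> P" if c: "c \<in> Q" for c
        proof (rule transitive_abelian_self_centralising[OF Pn(4) Ptr])
          show "c \<in> Bij \<Gamma>" using c Qn(4) by blast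
          show "c \<otimes>\<^bsub>BijGroup \<Gamma>\<^esub> x = x \<otimes>\<^bsub>BijGroup \<Gamma>\<^esub> c" if "x \<in> P" for x
            using C.normal_within_commute[OF Pn(1) Qn(1) True that c] by simp
        qed (use ab parts_ne[OF \<Gamma>] in auto)
        then show ?thesis by blast
      qed
    qed
    then have abM: "act \<Gamma> x \<otimes>\<^bsub>BijGroup \<Gamma>\<^esub> act \<Gamma> y = act \<Gamma> y \<otimes>\<^bsub>BijGroup \<Gamma>\<^esub> act \<Gamma> x" if "x \<in> M" "y \<in> M" for x y
      using ab that by blast
    have M_comm: "x \<cdot> y = y \<cdot> x" if x: "x \<in> M" and y: "y \<in> M" for x y
    proof -
      let ?K = "\<lambda>x y. x \<cdot> y \<cdot> inv\<^bsub>\<B>\<^esub> x \<cdot> inv\<^bsub>\<B>\<^esub> y"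
      have c: "x \<in> carrier \<B>" "y \<in> carrier \<B>" using x y subgroup.mem_carrier[OF M_subgroup] by auto
      have K1: "act \<Gamma> (?K u v) = \<one>\<^bsub>BijGroup \<Gamma>\<^esub>" if uv: "u \<in> M" "v \<in> M" for u v
      proof -
        have st: "u \<in> stab \<Gamma>" "v \<in> stab \<Gamma>" using uv M_base base_stab[OF _ \<Gamma>] by auto
        have ac: "act \<Gamma> u \<in> carrier (BijGroup \<Gamma>)" "act \<Gamma> v \<in> carrier (BijGroup \<Gamma>)" using act_Bij[OF \<Gamma>] st by auto
        have "act \<Gamma> (?K u v) = act \<Gamma> u \<otimes>\<^bsub>BijGroup \<Gamma>\<^esub> act \<Gamma> v \<otimes>\<^bsub>BijGroup \<Gamma>\<^esub> inv\<^bsub>BijGroup \<Gamma>\<^esub> (act \<Gamma> u) \<otimes>\<^bsub>BijGroup \<Gamma>\<^esub> inv\<^bsub>BijGroup \<Gamma>\<^esub> (act \<Gamma> v)"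
          using st subgroup.m_closed[OF stab_subgroup[OF \<Gamma>]] subgroup.m_inv_closed[OF stab_subgroup[OF \<Gamma>]]
          by (simp add: act_mult[OF \<Gamma>] act_inv[OF \<Gamma>])
        also have "act \<Gamma> u \<otimes>\<^bsub>BijGroup \<Gamma>\<^esub> act \<Gamma> v \<otimes>\<^bsub>BijGroup \<Gamma>\<^esub> inv\<^bsub>BijGroup \<Gamma>\<^esub> (act \<Gamma> u) = act \<Gamma> v"
          by (rule C.conj_eq_if_commute[OF ac abM[OF uv]])
        finally show ?thesis using ac by simp
      qed
      \<comment> \<open>To see that the commutator is trivial on \<Delta>, conjugate it to \<Gamma>:
        it becomes a commutator of two elements of \<open>M\<close>, which acts trivially
        there.\<close>
      have "?K x y = \<one>\<^bsub>\<B>\<^esub>"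
      proof (rule base_eq_one)
        have KM: "?K x y \<in> M"
          by (intro subgroup.m_closed[OF M_subgroup] subgroup.m_inv_closed[OF M_subgroup] x y)
        then show Kb: "?K x y \<in> base" using M_base by blast
        fix \<Delta> assume \<Delta>: "\<Delta> \<in> \<E>"
        obtain g where g: "g \<in> G" "move_partition g \<Delta> = \<Gamma>" using transporter[OF \<E>_transitive \<Delta> \<Gamma>] by blast
        have gc: "g \<in> carrier \<B>" using G_Bij[OF g(1)] by simp
        let ?c = "\<lambda>z. g \<cdot> z \<cdot> inv\<^bsub>\<B>\<^esub> g"
        have cM: "?c x \<in> M" "?c y \<in> M" using M_normal g x y by (auto simp: normal_within_def)
        have "?c (?K x y) = ?K (?c x) (?c y)"
          using gc c by (simp add: \<B>.m_assoc \<B>.inv_mult_group)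
        then have "act \<Gamma> (?c (?K x y)) = \<one>\<^bsub>BijGroup \<Gamma>\<^esub>" using K1[OF cM] by simp
        then show "act \<Delta> (?K x y) = \<one>\<^bsub>BijGroup \<Delta>\<^esub>"
          using conj_act_one[OF \<Delta> \<Gamma> G_Bij[OF g(1)] g(2) base_stab[OF Kb \<Delta>]] by simp
      qed
      then show ?thesis using \<B>.commute_if_commutator_one[OF c] by simp
    qed
    have "finite M" using subgroup.subset[OF M_subgroup] finite_Bij finite_subset by (metis carrier_BijGroup)
    then obtain N where N: "minimal_normal N (perm_group \<Omega> G)" "N \<subseteq> M"
      using \<B>.minimal_normal_within_exists[OF G_subgroup M_normal M_ne] by metis
    have Nn: "normal_within \<B> G N" "N \<noteq> {\<one>\<^bsub>\<B>\<^esub>}" using N(1) by (auto simp: \<B>.minimal_normal_within[OF G_subgroup])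
    have NB: "N \<subseteq> Bij \<Omega>" using N(2) M_base base_Bij by blast
    \<comment> \<open>\<open>N\<close> is transitive and abelian, hence self-centralising, while the
      abelian group \<open>M\<close> centralises it.\<close>
    have "M \<subseteq> N"
    proof
      fix x assume x: "x \<in> M"
      show "x \<in> N"
      proof (rule transitive_abelian_self_centralising[OF NB tr[OF Nn]])
        show "x \<in> Bij \<Omega>" using x M_base base_Bij by blast
      qed (use x M_comm N(2) nonempty in auto)
    qed
    then show ?thesis using minimal_normal_subset_socle[OF N(1)] by blast
  next
    case False
    show ?thesis
    proof
      fix x assume x: "x \<in> M"
      have Z: "subgroup (socle (perm_group \<Omega> G)) \<B>"
      proof -
        have "\<Union>{N. minimal_normal N (perm_group \<Omega> G)} \<subseteq> carrier (perm_group \<Omega> G)"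
          by (auto simp: \<B>.minimal_normal_within[OF G_subgroup] normal_within_def)
        then show ?thesis
          unfolding socle_def using \<B>.incl_subgroup[OF G_subgroup W.generate_is_subgroup] by blast
      qed
      show "x \<in> socle (perm_group \<Omega> G)"
      proof (rule mem_by_coordinates[OF Z])
        show "x \<in> base" using x M_base by blast
        fix \<Gamma> assume \<Gamma>: "\<Gamma> \<in> \<E>"
        interpret C: group "BijGroup \<Gamma>" by (rule group_BijGroup)
        note C_sub = component_subgroup[OF \<Gamma>]
        \<comment> \<open>The lift of a non-abelian \<open>P\<close> is itself minimal normal in
          \<open>G\<close>: a normal subgroup \<open>K\<close> inside it is either trivial on
          \<Gamma> and so trivial, or projects onto \<open>P\<close> and then contains the lift by
          \<open>lift_subset\<close>.\<close>
        have lift_min: "lift M \<Gamma> P \<subseteq> socle (perm_group \<Omega> G)"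
          if P: "minimal_normal P (perm_group \<Gamma> (component G \<Gamma>))" for P
        proof (rule minimal_normal_subset_socle)
          note Pn = minimal_normal_component[OF \<Gamma> P]
          have L: "normal_within \<B> G (lift M \<Gamma> P)" using lift_normal[OF \<Gamma> M_normal M_base Pn(1)] .
          obtain a b where nonab: "a \<in> P" "b \<in> P" "a \<otimes>\<^bsub>BijGroup \<Gamma>\<^esub> b \<noteq> b \<otimes>\<^bsub>BijGroup \<Gamma>\<^esub> a"
            using False \<Gamma> P by blast
          have "lift M \<Gamma> P \<noteq> {\<one>\<^bsub>\<B>\<^esub>}"
            using lift_transitive[OF \<E>_transitive \<Gamma> M_normal M_splits Pn(1,3) tr_comp[OF \<Gamma> P]]
              transitive_act[OF \<Gamma>, of "lift M \<Gamma> P"] transitive_act_nontrivial[OF \<Gamma>, of "act \<Gamma> ` lift M \<Gamma> P"] act_one[OF \<Gamma>]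
              base_stab[OF subgroup.one_closed[OF base_subgroup] \<Gamma>] by auto
          moreover have "K = {\<one>\<^bsub>\<B>\<^esub>} \<or> K = lift M \<Gamma> P" if K: "normal_within \<B> G K" "K \<subseteq> lift M \<Gamma> P" for K
          proof (cases "act \<Gamma> ` K = {\<one>\<^bsub>BijGroup \<Gamma>\<^esub>}")
            case True
            have "K \<subseteq> base" using K(2) M_base by (auto simp: lift_def)
            then show ?thesis using act_trivial_imp_trivial[OF K(1) _ \<E>_transitive \<Gamma> True] by blast
          next
            case ne: False
            have Kb: "K \<subseteq> base" using K(2) M_base by (auto simp: lift_def)
            have "act \<Gamma> ` K \<subseteq> P" using K(2) lift_act[OF \<Gamma>, of _ M P] M_base base_Bij by blast
            moreover have "normal_within (BijGroup \<Gamma>) (component G \<Gamma>) (act \<Gamma> ` K)"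
              using act_normal[OF \<Gamma> K(1)] Kb base_stab[OF _ \<Gamma>] by blast
            ultimately have "act \<Gamma> ` K = P" using P ne unfolding C.minimal_normal_within[OF C_sub] by metis
            then have "lift M \<Gamma> P \<subseteq> K"
              using lift_subset[OF \<E>_transitive \<Gamma> K(1) Kb M_normal M_splits P _ Pn(3) nonab] by blast
            then show ?thesis using K(2) by blast
          qed
          ultimately show "minimal_normal (lift M \<Gamma> P) (perm_group \<Omega> G)"
            using L by (simp add: \<B>.minimal_normal_within[OF G_subgroup])
        qed
        \<comment> \<open>The actions on \<Gamma> of elements of the socle of \<open>G\<close>
          supported on \<Gamma> form a subgroup \<open>R\<close>. It contains every minimal normal
          subgroup of the component, hence the subgroup they generate.\<close>
        have gen: "\<exists>z\<in>socle (perm_group \<Omega> G). act \<Gamma> z = c \<and> supported \<Gamma> z"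
          if "c \<in> socle (perm_group \<Gamma> (component G \<Gamma>))" for c
        proof -
          define R where "R = {c. \<exists>z\<in>socle (perm_group \<Omega> G). act \<Gamma> z = c \<and> supported \<Gamma> z}"
          have "act \<Gamma> ` (socle (perm_group \<Omega> G) \<inter> {g. supported \<Gamma> g}) = R" by (auto simp: R_def)
          moreover have "subgroup (socle (perm_group \<Omega> G) \<inter> {g. supported \<Gamma> g}) \<B>"
            using \<B>.subgroups_Inter_pair[OF Z supported_subgroup[OF \<Gamma>]] .
          ultimately have Rs: "subgroup R (BijGroup \<Gamma>)"
            using act_subgroup[OF \<Gamma>, of "socle (perm_group \<Omega> G) \<inter> {g. supported \<Gamma> g}"] base_stab[OF _ \<Gamma>]
            by (auto simp: supported_def)
          have RC: "subgroup (R \<inter> component G \<Gamma>) (perm_group \<Gamma> (component G \<Gamma>))"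
            using C.subgroup_incl[OF C.subgroups_Inter_pair[OF Rs C_sub] C_sub] by blast
          interpret CW: group "perm_group \<Gamma> (component G \<Gamma>)" using C.subgroup_imp_group[OF C_sub] .
          have "socle (perm_group \<Gamma> (component G \<Gamma>)) \<subseteq> R \<inter> component G \<Gamma>"
            unfolding socle_def
          proof (rule CW.generate_subgroup_incl[OF _ RC], rule Union_least)
            fix P assume "P \<in> {N. minimal_normal N (perm_group \<Gamma> (component G \<Gamma>))}"
            then have P: "minimal_normal P (perm_group \<Gamma> (component G \<Gamma>))" by simp
            note Pn = minimal_normal_component[OF \<Gamma> P]
            have "a \<in> R" if a: "a \<in> P" for a
            proof -
              obtain m where "m \<in> lift M \<Gamma> P" "act \<Gamma> m = a" "supported \<Gamma> m"
                using supported_in_lift[OF \<Gamma> Pn(1) M_splits a] a Pn(3) by blast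
              then show ?thesis using lift_min[OF P] unfolding R_def by blast
            qed
            moreover have "P \<subseteq> component G \<Gamma>" using Pn(1) by (simp add: normal_within_def)
            ultimately show "P \<subseteq> R \<inter> component G \<Gamma>" by blast
          qed
          then show ?thesis using that by (auto simp: R_def)
        qed
        have "act \<Gamma> x \<in> socle (perm_group \<Gamma> (component G \<Gamma>))" using x M_socle[OF \<Gamma>] by blast
        then show "\<exists>y\<in>socle (perm_group \<Omega> G). act \<Gamma> y = act \<Gamma> x \<and> supported \<Gamma> y" by (rule gen)
      qed
    qed
  qed
qed

text \<open>Excluding type HA makes all minimal normal subgroups of the component non-abelian. Then
  \<open>N\<close> cannot meet \<open>M\<close> trivially, by \<open>central_minimal_normal\<close>,
  and \<open>N \<inter> M\<close> contains the transitive lift of some minimal normal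
  \<open>P\<close>.\<close>

lemma quasiprimitive_from_component:
  assumes \<Gamma>: "\<Gamma> \<in> \<E>" and q: "quasiprimitive \<Gamma> (component G \<Gamma>)" and HA: "\<not> type_HA \<Gamma> (component G \<Gamma>)"
  shows "quasiprimitive \<Omega> G"
  unfolding quasiprimitive_iff[OF G_subgroup]
proof (intro allI impI, elim conjE)
  interpret C: group "BijGroup \<Gamma>" by (rule group_BijGroup)
  note C_sub = component_subgroup[OF \<Gamma>]
  have nonab: "\<exists>a\<in>P. \<exists>b\<in>P. a \<otimes>\<^bsub>BijGroup \<Gamma>\<^esub> b \<noteq> b \<otimes>\<^bsub>BijGroup \<Gamma>\<^esub> a"
    if P: "minimal_normal P (perm_group \<Gamma> (component G \<Gamma>))" for P
  proof (rule ccontr)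
    assume ab: "\<not> ?thesis"
    have "subgroup P (BijGroup \<Gamma>)" using minimal_normal_component(1)[OF \<Gamma> P] by (simp add: normal_within_def)
    then interpret P: group "perm_group \<Gamma> P" by (rule C.subgroup_imp_group)
    have "comm_group (perm_group \<Gamma> P)" using ab by (intro P.group_comm_groupI) auto
    then show False using HA q P by (auto simp: type_HA_def)
  qed
  fix N assume N: "normal_within \<B> G N" "N \<noteq> {\<one>\<^bsub>\<B>\<^esub>}"
  have "N \<inter> M \<noteq> {\<one>\<^bsub>\<B>\<^esub>}"
  proof
    assume NM: "N \<inter> M = {\<one>\<^bsub>\<B>\<^esub>}"
    have Nb: "N \<subseteq> base" by (rule commuting_normal_base(1)[OF N(1) M_normal M_splits M_transitive NM])
    show False
    proof (cases "act \<Gamma> ` N = {\<one>\<^bsub>BijGroup \<Gamma>\<^esub>}")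
      case True
      then show False using act_trivial_imp_trivial[OF N(1) Nb \<E>_transitive \<Gamma>] N(2) by blast
    next
      case False
      then show False using central_minimal_normal[OF \<Gamma> N(1) NM] nonab by blast
    qed
  qed
  moreover have K: "normal_within \<B> G (N \<inter> M)" using \<B>.normal_within_Int[OF N(1) M_normal] .
  moreover have Kb: "N \<inter> M \<subseteq> base" using M_base by blast
  ultimately have "act \<Gamma> ` (N \<inter> M) \<noteq> {\<one>\<^bsub>BijGroup \<Gamma>\<^esub>}"
    using act_trivial_imp_trivial[OF K Kb \<E>_transitive \<Gamma>] by blast
  moreover have "normal_within (BijGroup \<Gamma>) (component G \<Gamma>) (act \<Gamma> ` (N \<inter> M))"
    using act_normal[OF \<Gamma> K] Kb base_stab[OF _ \<Gamma>] by blast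
  ultimately obtain P where P: "minimal_normal P (perm_group \<Gamma> (component G \<Gamma>))" "P \<subseteq> act \<Gamma> ` (N \<inter> M)"
    using minimal_normal_component_exists[OF \<Gamma>] by blast
  note Pn = minimal_normal_component[OF \<Gamma> P(1)]
  obtain a b where ab: "a \<in> P" "b \<in> P" "a \<otimes>\<^bsub>BijGroup \<Gamma>\<^esub> b \<noteq> b \<otimes>\<^bsub>BijGroup \<Gamma>\<^esub> a" using nonab[OF P(1)] by blast
  have LN: "lift M \<Gamma> P \<subseteq> N \<inter> M"
    using lift_subset[OF \<E>_transitive \<Gamma> K Kb M_normal M_splits P Pn(3) ab] .
  have "transitive_on P \<Gamma>" using q Pn by (simp add: quasiprimitive_iff[OF C_sub])
  then have "transitive_on (lift M \<Gamma> P) \<Omega>"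
    using lift_transitive[OF \<E>_transitive \<Gamma> M_normal M_splits Pn(1,3)] by blast
  then show "transitive_on N \<Omega>" using LN by (auto elim: transitive_on_mono)
qed

lemma M_coordinatewise_product:
  "M = coordinatewise_product \<Omega> \<E> (\<lambda>\<Gamma>. socle (perm_group \<Gamma> (component G \<Gamma>)))"
proof -
  have "M = coordinatewise_product \<Omega> \<E> (\<lambda>\<Gamma>. component M \<Gamma>)"
    using normal_decomposition_iff_splits[OF M_subgroup] M_splits by (simp add: normal_decomposition_def)
  also have "\<dots> = coordinatewise_product \<Omega> \<E> (\<lambda>\<Gamma>. socle (perm_group \<Gamma> (component G \<Gamma>)))"
  proof -
    have "(\<Pi>\<^sub>E \<Gamma>\<in>\<E>. component M \<Gamma>) = (\<Pi>\<^sub>E \<Gamma>\<in>\<E>. socle (perm_group \<Gamma> (component G \<Gamma>)))"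
      by (rule PiE_cong) (simp add: component_base[OF M_base] M_socle)
    then show ?thesis by (simp add: coordinatewise_product_def)
  qed
  finally show ?thesis .
qed

end

lemma (in invariant_cartesian) blow_up_decomposition_iff:
  "blow_up_decomposition \<Omega> G \<E> \<longleftrightarrow> (\<exists>M. blow_up \<Omega> \<E> G M)"
proof -
  have "M \<lhd> perm_group \<Omega> G \<and> transitive_on M \<Omega> \<and> normal_decomposition \<Omega> M \<E> \<and>
        (\<forall>\<Gamma>\<in>\<E>. component M \<Gamma> = socle (perm_group \<Gamma> (component G \<Gamma>))) \<and> transitive_decomposition G \<E> \<longleftrightarrow>
      blow_up \<Omega> \<E> G M" for M
  proof -
    have "normal_decomposition \<Omega> M \<E> \<longleftrightarrow> splits M" if "normal_within \<B> G M"
      using that normal_decomposition_iff_splits by (simp add: normal_within_def)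
    moreover have "component M \<Gamma> = act \<Gamma> ` M" if "splits M" "\<Gamma> \<in> \<E>" for \<Gamma>
      using that component_base by (simp add: splits_def)
    ultimately show ?thesis
      using \<B>.normal_iff_normal_within[OF G_subgroup, of M] invariant_cartesian_axioms
      by (auto simp: blow_up_def blow_up_axioms_def)
  qed
  then show ?thesis
    using cartesian G_invariant unfolding blow_up_decomposition_def by blast
qed

subsection \<open>Minimal normal subgroups with subdirect point stabilisers\<close>

lemma multiplicity_fact_div:
  assumes p: "Factorial_Ring.prime (p::nat)"
  shows "multiplicity p (fact n :: nat) = n div p + multiplicity p (fact (n div p) :: nat)"
proof (induction n)
  case 0
  then show ?case by simp
next
  case (Suc n)
  have p2: "p \<ge> 2" using prime_ge_2_nat[OF p] .
  have f: "multiplicity p (fact (Suc m) :: nat) = multiplicity p (Suc m) + multiplicity p (fact m :: nat)" for m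
    using prime_elem_multiplicity_mult_distrib[of p "Suc m" "fact m :: nat"] p by simp
  show ?case
  proof (cases "p dvd Suc n")
    case False
    then have "Suc n div p = n div p" "multiplicity p (Suc n) = 0"
      by (simp_all add: div_Suc dvd_eq_mod_eq_0 not_dvd_imp_multiplicity_0)
    then show ?thesis using Suc f[of n] by simp
  next
    case True
    then obtain k where k: "Suc n = p * k" by blast
    then have k0: "k \<noteq> 0" by (metis mult_0_right nat.distinct(1))
    then obtain q where q: "k = Suc q" using not0_implies_Suc by blast
    have d1: "Suc n div p = Suc q" using k q p2 by simp
    have d2: "n div p = q"
      using k q p2 by (intro div_nat_eqI) auto
    have "multiplicity p (Suc n) = Suc (multiplicity p (Suc q))"
      using prime_elem_multiplicity_mult_distrib[of p p "Suc q"] p k q by simp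
    then show ?thesis using Suc f[of n] f[of q] d1 d2 by simp
  qed
qed

text \<open>Legendre's recursion gives exponent k plus the exponent of \<open>p\<close> in k!, where
  k = n div p. For positive k the induction hypothesis bounds this strictly by 2k, and 2k is at most
  n because \<open>p\<close> is at least 2.\<close>

lemma prime_power_not_dvd_fact:
  assumes p: "Factorial_Ring.prime (p::nat)" and n: "n > 0"
  shows "\<not> p ^ n dvd fact n"
proof -
  have "multiplicity p (fact n :: nat) < n"
    using n
  proof (induction n rule: less_induct)
    case (less n)
    have p2: "p \<ge> 2" using prime_ge_2_nat[OF p] .
    show ?case
    proof (cases "n div p = 0")
      case True
      then show ?thesis using multiplicity_fact_div[OF p, of n] less by simp
    next
      case False
      have le: "2 * (n div p) \<le> n"
        using mult_le_mono1[OF p2, of "n div p"] times_div_less_eq_dividend[of p n] by linarith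
      moreover have "n div p < n" using False le by linarith
      then have "multiplicity p (fact (n div p) :: nat) < n div p" using less.IH False by simp
      ultimately show ?thesis using multiplicity_fact_div[OF p, of n] by linarith
    qed
  qed
  moreover have "p ^ n dvd fact n \<Longrightarrow> n \<le> multiplicity p (fact n :: nat)"
    using p by (intro multiplicity_geI) auto
  ultimately show ?thesis by linarith
qed

text \<open>\<open>Bij\<close> fixes an undefined value outside \<open>S\<close>, whereas
  \<open>permutes\<close> demands the identity there; restriction and extension by the identity
  translate between the two.\<close>

lemma card_Bij:
  assumes "finite S"
  shows "card (Bij S) = fact (card S)"
proof -
  have "bij_betw (\<lambda>f. restrict f S) {f. f permutes S} (Bij S)"
  proof (rule bij_betw_byWitness[where f' = "\<lambda>f x. if x \<in> S then f x else x"])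
    show "\<forall>f\<in>{f. f permutes S}. (\<lambda>x. if x \<in> S then restrict f S x else x) = f"
      by (auto simp: fun_eq_iff permutes_not_in)
    show "\<forall>f\<in>Bij S. restrict (\<lambda>x. if x \<in> S then f x else x) S = f"
      by (auto simp: fun_eq_iff Bij_def extensional_def)
    show "(\<lambda>f. restrict f S) ` {f. f permutes S} \<subseteq> Bij S"
      using permutes_imp_bij by (fastforce simp: Bij_def)
    show "(\<lambda>f x. if x \<in> S then f x else x) ` Bij S \<subseteq> {f. f permutes S}"
    proof (intro image_subsetI CollectI)
      fix f assume "f \<in> Bij S"
      then have "bij_betw (\<lambda>x. if x \<in> S then f x else x) S S"
        by (subst bij_betw_cong[of S _ f]) (auto simp: Bij_def)
      then show "(\<lambda>x. if x \<in> S then f x else x) permutes S"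
        by (rule bij_imp_permutes) auto
    qed
  qed
  from bij_betw_same_card[OF this] show ?thesis using card_permutations[OF refl assms] by simp
qed

lemma card_transitive_action:
  assumes \<phi>: "group_hom H (BijGroup S) \<phi>" and s: "s \<in> S" and "finite S"
    and tr: "transitive_on (\<phi> ` carrier H) S"
  shows "card (carrier H) = card S * card {h \<in> carrier H. \<phi> h s = s}"
proof -
  interpret group_action H S \<phi> using \<phi> by (simp add: group_action_def)
  have "orbit H \<phi> s = S"
  proof
    show "orbit H \<phi> s \<subseteq> S" using element_image s by (auto simp: orbit_def)
    show "S \<subseteq> orbit H \<phi> s" using tr s by (fastforce simp: orbit_def transitive_on_def)
  qed
  then show ?thesis
    using orbit_stabilizer_theorem[OF s] by (simp add: stabilizer_def order_def mult.commute)
qed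

lemma (in group) normal_within_carrier_update:
  assumes "subgroup H G"
  shows "normal_within (G\<lparr>carrier := H\<rparr>) H N \<longleftrightarrow> normal_within G H N"
proof -
  interpret H: group "G\<lparr>carrier := H\<rparr>" using assms by (rule subgroup_imp_group)
  show ?thesis
    using H.normal_iff_normal_within[of H N] normal_iff_normal_within[OF assms, of N] H.subgroup_self by simp
qed

context invariant_cartesian
begin

lemma perm_group_hom:
  "\<Gamma> \<in> \<E> \<Longrightarrow> subgroup K \<B> \<Longrightarrow> K \<subseteq> stab \<Gamma> \<Longrightarrow> group_hom (perm_group \<Omega> K) (BijGroup \<Gamma>) (act \<Gamma>)"
  using \<B>.subgroup_imp_group[of K] group_BijGroup[of \<Gamma>]
  by (auto simp: group_hom_def group_hom_axioms_def hom_def act_mult act_Bij subset_eq)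

lemma card_transitive_perm_group:
  assumes "subgroup K \<B>" "transitive_on K \<Omega>" "\<omega> \<in> \<Omega>"
  shows "card K = card \<Omega> * card {k \<in> K. k \<omega> = \<omega>}"
proof -
  have "group_hom (perm_group \<Omega> K) \<B> (\<lambda>g. g)"
    using \<B>.subgroup_imp_group[OF assms(1)] subgroup.subset[OF assms(1)]
    by (auto simp: group_hom_def group_hom_axioms_def hom_def)
  from card_transitive_action[OF this assms(3) finite_\<Omega>] show ?thesis using assms(2) by simp
qed

text \<open>Minimality forces the normal subgroup \<open>M \<inter> base\<close> to be trivial, so
  the action on partitions is faithful. Lagrange and orbit counting then make |\<Omega>| divide a
  factorial, and homogeneity makes |\<Omega>| an exact power whose exponent is the argument of that
  factorial.\<close>

lemma minimal_normal_base:
  assumes hom: "homogeneous \<E>" and M: "minimal_normal M (perm_group \<Omega> G)" "transitive_on M \<Omega>"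
  shows "M \<subseteq> base"
proof (rule ccontr)
  assume nb: "\<not> M \<subseteq> base"
  have Mn: "normal_within \<B> G M" and min: "\<And>K. normal_within \<B> G K \<Longrightarrow> K \<subseteq> M \<Longrightarrow> K = {\<one>\<^bsub>\<B>\<^esub>} \<or> K = M"
    using M(1) by (auto simp: \<B>.minimal_normal_within[OF G_subgroup])
  have Ms: "subgroup M \<B>" and MG: "M \<subseteq> G" using Mn by (auto simp: normal_within_def)
  have "normal_within \<B> G (M \<inter> base)"
    using Mn conj_base \<B>.subgroups_Inter_pair[OF Ms base_subgroup] by (auto simp: normal_within_def)
  then have triv: "M \<inter> base = {\<one>\<^bsub>\<B>\<^esub>}" using min[of "M \<inter> base"] nb by blast
  let ?\<phi> = "\<lambda>m. \<lambda>\<Gamma>\<in>\<E>. move_partition m \<Gamma>"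
  have MB: "m \<in> Bij \<Omega>" if "m \<in> M" for m using that MG G_Bij by blast
  have \<phi>_Bij: "?\<phi> m \<in> Bij \<E>" if m: "m \<in> M" for m
  proof -
    have im: "?\<phi> m ` \<E> = \<E>"
      using G_invariant m MG by (auto simp: invariant_decomposition_def)
    then have "inj_on (?\<phi> m) \<E>" using finite_\<E> by (simp add: eq_card_imp_inj_on)
    then show ?thesis using im by (simp add: Bij_def bij_betw_def)
  qed
  have \<phi>_mult: "?\<phi> (m \<cdot> n) = ?\<phi> m \<otimes>\<^bsub>BijGroup \<E>\<^esub> ?\<phi> n" if mn: "m \<in> M" "n \<in> M" for m n
  proof (rule Bij_eqI[OF \<phi>_Bij])
    show "m \<cdot> n \<in> M" using subgroup.m_closed[OF Ms mn] .
    show "?\<phi> m \<otimes>\<^bsub>BijGroup \<E>\<^esub> ?\<phi> n \<in> Bij \<E>" using \<phi>_Bij mn by simp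
    fix \<Gamma> assume \<Gamma>: "\<Gamma> \<in> \<E>"
    have "move_partition n \<Gamma> \<in> \<E>" using move_\<E>[OF _ \<Gamma>] mn MG by blast
    then show "?\<phi> (m \<cdot> n) \<Gamma> = (?\<phi> m \<otimes>\<^bsub>BijGroup \<E>\<^esub> ?\<phi> n) \<Gamma>"
      using mult_BijGroup_apply[OF \<phi>_Bij[OF mn(1)] \<phi>_Bij[OF mn(2)] \<Gamma>] \<Gamma> move_mult[OF MB[OF mn(1)] MB[OF mn(2)] \<Gamma>] by simp
  qed
  have \<phi>: "group_hom (perm_group \<Omega> M) (BijGroup \<E>) ?\<phi>"
    using \<B>.subgroup_imp_group[OF Ms] group_BijGroup[of \<E>] \<phi>_Bij \<phi>_mult
    by (auto simp: group_hom_def group_hom_axioms_def hom_def)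
  interpret HM: group "perm_group \<Omega> M" using \<B>.subgroup_imp_group[OF Ms] .
  interpret \<phi>: group_hom "perm_group \<Omega> M" "BijGroup \<E>" ?\<phi> by (rule \<phi>)
  have "inj_on ?\<phi> M"
  proof (rule inj_onI)
    fix m n assume mn: "m \<in> M" "n \<in> M" "?\<phi> m = ?\<phi> n"
    have "inv\<^bsub>\<B>\<^esub> m \<cdot> n \<in> base"
      unfolding base_def
    proof (intro CollectI conjI ballI)
      show "inv\<^bsub>\<B>\<^esub> m \<cdot> n \<in> Bij \<Omega>" using MB mn by simp
      fix \<Gamma> assume \<Gamma>: "\<Gamma> \<in> \<E>"
      have "move_partition m \<Gamma> = move_partition n \<Gamma>" using fun_cong[OF mn(3), of \<Gamma>] \<Gamma> by simp
      then show "move_partition (inv\<^bsub>\<B>\<^esub> m \<cdot> n) \<Gamma> = \<Gamma>"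
        using move_mult[OF Bij_inv_closed[OF MB[OF mn(1)]] MB[OF mn(2)] \<Gamma>] move_inv[OF MB[OF mn(1)] \<Gamma> refl] by simp
    qed
    moreover have "inv\<^bsub>\<B>\<^esub> m \<cdot> n \<in> M" using subgroup.m_closed[OF Ms subgroup.m_inv_closed[OF Ms mn(1)] mn(2)] .
    ultimately have "inv\<^bsub>\<B>\<^esub> m \<cdot> n = \<one>\<^bsub>\<B>\<^esub>" using triv by blast
    then have "m \<cdot> (inv\<^bsub>\<B>\<^esub> m \<cdot> n) = m" using MB[OF mn(1)] by simp
    then show "m = n" using MB[OF mn(1)] MB[OF mn(2)] by simp
  qed
  then have cM: "card (?\<phi> ` M) = card M" by (rule card_image)
  have "subgroup (?\<phi> ` M) (BijGroup \<E>)" using \<phi>.img_is_subgroup by simp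
  then have "card (?\<phi> ` M) dvd card (Bij \<E>)"
    using group.lagrange[OF group_BijGroup, of "?\<phi> ` M" \<E>] by (metis carrier_BijGroup dvd_triv_right order_def)
  then have "card M dvd fact (card \<E>)" using cM card_Bij[OF finite_\<E>] by simp
  moreover obtain \<omega> where \<omega>: "\<omega> \<in> \<Omega>" using nonempty by blast
  then have "card \<Omega> dvd card M" using card_transitive_perm_group[OF Ms M(2)] by simp
  ultimately have dvd: "card \<Omega> dvd fact (card \<E>)" by (rule dvd_trans[rotated])
  obtain \<Gamma> where \<Gamma>: "\<Gamma> \<in> \<E>" using \<E>_nonempty by blast
  have "card \<Omega> = (\<Prod>\<Delta>\<in>\<E>. card \<Gamma>)"
    unfolding card_\<Omega>
  proof (rule prod.cong[OF refl])
    show "card \<Delta> = card \<Gamma>" if "\<Delta> \<in> \<E>" for \<Delta>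
      using hom \<Gamma> that unfolding homogeneous_def by (metis (no_types))
  qed
  then have cO: "card \<Omega> = card \<Gamma> ^ card \<E>" by simp
  have "card \<Gamma> \<noteq> 1" using two_parts[OF \<Gamma>] by (auto simp: card_1_singleton_iff)
  then obtain q where q: "Factorial_Ring.prime q" "q dvd card \<Gamma>" using prime_factor_nat by blast
  have "q ^ card \<E> dvd fact (card \<E>)" using dvd_trans[OF dvd_power_same[OF q(2)]] dvd cO by metis
  moreover have "card \<E> > 0" using finite_\<E> \<E>_nonempty by (simp add: card_gt_0_iff)
  ultimately show False using prime_power_not_dvd_fact[OF q(1)] by blast
qed

end

text \<open>The setting common to types Sd and Cd. That \<open>M\<close> fixes every partition is
  taken as an assumption, supplied by \<open>minimal_normal_base\<close>, so that everything inside
  can work with coordinate actions of \<open>M\<close>.\<close>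

locale subdirect_plinth = invariant_cartesian +
  fixes M :: "('a \<Rightarrow> 'a) set" and \<omega> :: 'a and \<T> and p
  assumes M_minimal: "minimal_normal M (perm_group \<Omega> G)"
    and M_transitive: "transitive_on M \<Omega>" and M_base: "M \<subseteq> base" and \<omega>: "\<omega> \<in> \<Omega>"
    and M_simple_product: "simple_product (perm_group \<Omega> M) \<T> p"
    and stabilizer_onto: "T \<in> \<T> \<Longrightarrow> p T ` point_stabilizer \<Omega> M \<omega> = T"
begin

sublocale M: simple_product "perm_group \<Omega> M" \<T> p by (rule M_simple_product)

lemma M_normal: "normal_within \<B> G M" and M_nontrivial: "M \<noteq> {\<one>\<^bsub>\<B>\<^esub>}"
  and M_min: "normal_within \<B> G K \<Longrightarrow> K \<subseteq> M \<Longrightarrow> K = {\<one>\<^bsub>\<B>\<^esub>} \<or> K = M"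
  using M_minimal by (auto simp: \<B>.minimal_normal_within[OF G_subgroup])

lemma M_subgroup: "subgroup M \<B>" and M_G: "M \<subseteq> G"
  and M_conj: "g \<in> G \<Longrightarrow> m \<in> M \<Longrightarrow> g \<cdot> m \<cdot> inv\<^bsub>\<B>\<^esub> g \<in> M"
  using M_normal by (auto simp: normal_within_def)

lemma M_Bij: "m \<in> M \<Longrightarrow> m \<in> Bij \<Omega>"
  using M_base base_Bij by blast

lemma M_stab: "m \<in> M \<Longrightarrow> \<Gamma> \<in> \<E> \<Longrightarrow> m \<in> stab \<Gamma>"
  using M_base base_stab by blast

lemma subgroup_M: "subgroup A (perm_group \<Omega> M) \<Longrightarrow> subgroup A \<B>"
  using \<B>.incl_subgroup[OF M_subgroup] .

lemma subgroup_in_M: "subgroup A \<B> \<Longrightarrow> A \<subseteq> M \<Longrightarrow> subgroup A (perm_group \<Omega> M)"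
  using \<B>.subgroup_incl[OF _ M_subgroup] .

lemma M_inv: "m \<in> M \<Longrightarrow> inv\<^bsub>perm_group \<Omega> M\<^esub> m = inv\<^bsub>\<B>\<^esub> m"
  using \<B>.m_inv_consistent[OF M_subgroup] .

lemma factor_subset_M: "T \<in> \<T> \<Longrightarrow> T \<subseteq> M"
  using M.factor_carrier by auto

lemma factor_M: "T \<in> \<T> \<Longrightarrow> t \<in> T \<Longrightarrow> t \<in> M"
  using factor_subset_M by blast

lemma factor_one: "T \<in> \<T> \<Longrightarrow> \<one>\<^bsub>\<B>\<^esub> \<in> T"
  using subgroup.one_closed[OF M.factor_subgroup, of T] by simp

lemma factor_nontrivial: "T \<in> \<T> \<Longrightarrow> \<exists>t\<in>T. t \<noteq> \<one>\<^bsub>\<B>\<^esub>"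
  using M.factor_nontrivial[of T] factor_one[of T] by auto

lemma factors_nonempty: "\<T> \<noteq> {}"
proof
  assume "\<T> = {}"
  then have "x = \<one>\<^bsub>\<B>\<^esub>" if "x \<in> M" for x using M.proj_separate[of x] that by simp
  then show False using M_nontrivial subgroup.one_closed[OF M_subgroup] by blast
qed

text \<open>The conjugate of \<open>T\<close> is a non-trivial normal subgroup of \<open>M\<close>,
  so it contains some factor \<open>S\<close>. Conjugating back puts \<open>S\<close> into
  \<open>T\<close> as a non-trivial normal subgroup, and simplicity of \<open>T\<close> turns both
  inclusions into equalities.\<close>

lemma factor_conj:
  assumes T: "T \<in> \<T>" and g: "g \<in> G"
  shows "(\<lambda>t. g \<cdot> t \<cdot> inv\<^bsub>\<B>\<^esub> g) ` T \<in> \<T>"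
proof -
  let ?c = "\<lambda>t. g \<cdot> t \<cdot> inv\<^bsub>\<B>\<^esub> g" and ?d = "\<lambda>t. inv\<^bsub>\<B>\<^esub> g \<cdot> t \<cdot> g"
  have gB: "g \<in> Bij \<Omega>" using G_Bij[OF g] .
  have TB: "t \<in> Bij \<Omega>" if "t \<in> T" for t using M_Bij factor_M[OF T that] by blast
  have Ts: "subgroup T \<B>" using subgroup_M[OF M.factor_subgroup[OF T]] .
  have conj_hom: "group_hom \<B> \<B> ?c" "group_hom \<B> \<B> ?d"
    using gB by (auto simp: group_hom_def group_hom_axioms_def hom_def \<B>.m_assoc group_BijGroup)
  have dc: "?d (?c t) = t" if "t \<in> Bij \<Omega>" for t using that gB by (simp add: \<B>.m_assoc)
  have cd: "?c (?d t) = t" if "t \<in> Bij \<Omega>" for t using that gB by (simp add: \<B>.m_assoc)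
  have Us: "subgroup (?c ` T) \<B>" using group_hom.subgroup_img_is_subgroup[OF conj_hom(1) Ts] .
  have UM: "?c ` T \<subseteq> M" using M_conj[OF g] factor_M[OF T] by blast
  have d_conj: "?d (m \<triangleright> x) = ?d m \<cdot> ?d x \<cdot> inv\<^bsub>\<B>\<^esub> (?d m)"
    if "m \<in> Bij \<Omega>" "x \<in> Bij \<Omega>" for m x
    using that gB by (simp add: \<B>.m_assoc \<B>.inv_mult_group)
  have dM: "?d m \<in> M" if "m \<in> M" for m
    using M_conj[OF subgroup.m_inv_closed[OF G_subgroup g] that] gB by simp
  have T_conj: "m \<triangleright> t \<in> S" if "S \<in> \<T>" "m \<in> M" "t \<in> S" for m t S
    using M.factor_conj_closed[OF that(1), of m t] that M_inv by simp
  have "normal_within (perm_group \<Omega> M) M (?c ` T)"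
    unfolding \<B>.normal_within_carrier_update[OF M_subgroup] unfolding normal_within_def
  proof (intro conjI Us UM ballI)
    fix m u assume m: "m \<in> M" and "u \<in> ?c ` T"
    then obtain t where t: "t \<in> T" "u = ?c t" by blast
    have uB: "u \<in> Bij \<Omega>" using t TB gB by simp
    have "?d (m \<triangleright> u) = ?d m \<cdot> t \<cdot> inv\<^bsub>\<B>\<^esub> (?d m)"
      using d_conj[OF M_Bij[OF m] uB] dc[OF TB[OF t(1)]] t(2) by simp
    then have "?d (m \<triangleright> u) \<in> T" using T_conj[OF T dM[OF m] t(1)] by simp
    moreover have "m \<triangleright> u = ?c (?d (m \<triangleright> u))"
      using cd M_Bij[OF m] uB by simp
    ultimately show "m \<triangleright> u \<in> ?c ` T" by (metis (no_types, lifting) imageI)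
  qed
  then have Un: "normal_within (perm_group \<Omega> M) (carrier (perm_group \<Omega> M)) (?c ` T)" by simp
  obtain t where t: "t \<in> T" "t \<noteq> \<one>\<^bsub>\<B>\<^esub>" using factor_nontrivial[OF T] by blast
  have "?c t \<noteq> \<one>\<^bsub>\<B>\<^esub>"
  proof
    assume "?c t = \<one>\<^bsub>\<B>\<^esub>"
    then have "?d (?c t) = \<one>\<^bsub>\<B>\<^esub>" using gB by simp
    then show False using dc[OF TB[OF t(1)]] t(2) by simp
  qed
  moreover have ctM: "?c t \<in> M" using UM t(1) by blast
  ultimately obtain S where S: "S \<in> \<T>" "p S (?c t) \<noteq> \<one>\<^bsub>\<B>\<^esub>"
    using M.proj_separate[of "?c t"] by auto
  have SU: "S \<subseteq> ?c ` T"
    using M.factor_subset_normal[OF S(1) Un, of "?c t"] t(1) S(2) by simp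
  have SB: "s \<in> Bij \<Omega>" if "s \<in> S" for s using M_Bij factor_M[OF S(1) that] by blast
  have dST: "?d ` S \<subseteq> T"
  proof
    fix x assume "x \<in> ?d ` S"
    then obtain s where s: "s \<in> S" "x = ?d s" by blast
    then obtain r where r: "r \<in> T" "s = ?c r" using SU by blast
    then show "x \<in> T" using s dc[OF TB[OF r(1)]] by simp
  qed
  have "?d ` S = {\<one>\<^bsub>perm_group \<Omega> M\<^esub>} \<or> ?d ` S = T"
  proof (rule M.factor_normal_subset[OF T _ dST])
    have "subgroup (?d ` S) \<B>"
      using group_hom.subgroup_img_is_subgroup[OF conj_hom(2) subgroup_M[OF M.factor_subgroup[OF S(1)]]] .
    then show "subgroup (?d ` S) (perm_group \<Omega> M)" using subgroup_in_M dST factor_subset_M[OF T] by blast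
    fix t n assume t: "t \<in> T" and "n \<in> ?d ` S"
    then obtain s where s: "s \<in> S" "n = ?d s" by blast
    have cs: "?c t \<cdot> s \<cdot> inv\<^bsub>\<B>\<^esub> (?c t) \<in> S"
      using T_conj[OF S(1) _ s(1)] UM t by blast
    have "?d (?c t \<cdot> s \<cdot> inv\<^bsub>\<B>\<^esub> (?c t)) = t \<triangleright> n"
      using d_conj[of "?c t" s] dc[OF TB[OF t]] s(2) SB[OF s(1)] TB[OF t] gB by simp
    then have "t \<triangleright> n \<in> ?d ` S" using imageI[OF cs, of ?d] by simp
    then show "t \<otimes>\<^bsub>perm_group \<Omega> M\<^esub> n \<otimes>\<^bsub>perm_group \<Omega> M\<^esub> inv\<^bsub>perm_group \<Omega> M\<^esub> t \<in> ?d ` S"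
      using M_inv[OF factor_M[OF T t]] by simp
  qed
  moreover have "?d ` S \<noteq> {\<one>\<^bsub>perm_group \<Omega> M\<^esub>}"
  proof
    assume one: "?d ` S = {\<one>\<^bsub>perm_group \<Omega> M\<^esub>}"
    have "s = \<one>\<^bsub>\<B>\<^esub>" if s: "s \<in> S" for s
    proof -
      have "?d s = \<one>\<^bsub>\<B>\<^esub>" using imageI[OF s, of ?d] one by simp
      then have "?c (?d s) = \<one>\<^bsub>\<B>\<^esub>" using gB by simp
      then show ?thesis using cd[OF SB[OF s]] by simp
    qed
    then show False using factor_nontrivial[OF S(1)] by blast
  qed
  ultimately have "?d ` S = T" by blast
  then have "?c ` T \<subseteq> S"
  proof -
    have "?c t \<in> S" if t: "t \<in> T" for t
    proof -
      obtain s where "s \<in> S" "t = ?d s" using t \<open>?d ` S = T\<close> by blast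
      then show ?thesis using cd SB by simp
    qed
    then show ?thesis by blast
  qed
  then have "?c ` T = S" using SU by blast
  then show ?thesis using S(1) by simp
qed

section \<open>Counting the coordinates moved by the simple factors\<close>

definition active :: "('a \<Rightarrow> 'a) set \<Rightarrow> 'a set set set" where
  "active T = {\<Gamma> \<in> \<E>. \<not> (\<forall>t\<in>T. act \<Gamma> t = \<one>\<^bsub>BijGroup \<Gamma>\<^esub>)}"

definition part_stabilizer :: "'a set set \<Rightarrow> ('a \<Rightarrow> 'a) set" where
  "part_stabilizer \<Gamma> = {m \<in> M. act \<Gamma> m (part_of \<Gamma> \<omega>) = part_of \<Gamma> \<omega>}"

lemma act_M_hom: "\<Gamma> \<in> \<E> \<Longrightarrow> group_hom (perm_group \<Omega> M) (BijGroup \<Gamma>) (act \<Gamma>)"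
  using perm_group_hom[OF _ M_subgroup] M_stab by blast

lemma act_M_transitive: "\<Gamma> \<in> \<E> \<Longrightarrow> transitive_on (act \<Gamma> ` M) \<Gamma>"
  using transitive_act[OF _ M_transitive] M_stab by blast

lemma part_stabilizer_subgroup:
  assumes \<Gamma>: "\<Gamma> \<in> \<E>"
  shows "subgroup (part_stabilizer \<Gamma>) (perm_group \<Omega> M)"
proof -
  interpret group_action "perm_group \<Omega> M" \<Gamma> "act \<Gamma>"
    using act_M_hom[OF \<Gamma>] by (simp add: group_action_def)
  show ?thesis
    using stabilizer_subgroup[OF part_of(1)[OF \<Gamma> \<omega>]] by (simp add: stabilizer_def part_stabilizer_def)
qed

lemma card_part_stabilizer:
  assumes \<Gamma>: "\<Gamma> \<in> \<E>"
  shows "card M = card \<Gamma> * card (part_stabilizer \<Gamma>)"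
  using card_transitive_action[OF act_M_hom[OF \<Gamma>] part_of(1)[OF \<Gamma> \<omega>] finite_\<Gamma>[OF \<Gamma>]] act_M_transitive[OF \<Gamma>]
  by (simp add: part_stabilizer_def)

lemma point_stabilizer_subset: "\<Gamma> \<in> \<E> \<Longrightarrow> point_stabilizer \<Omega> M \<omega> \<subseteq> part_stabilizer \<Gamma>"
  using act_part_of[OF _ M_stab \<omega>] by (auto simp: stabilizer_def part_stabilizer_def)

lemma part_stabilizer_onto:
  assumes \<Gamma>: "\<Gamma> \<in> \<E>" and T: "T \<in> \<T>"
  shows "p T ` part_stabilizer \<Gamma> = T"
proof
  show "p T ` part_stabilizer \<Gamma> \<subseteq> T" using M.proj_in[OF T] by (auto simp: part_stabilizer_def)
  show "T \<subseteq> p T ` part_stabilizer \<Gamma>"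
    using stabilizer_onto[OF T] point_stabilizer_subset[OF \<Gamma>] by blast
qed

text \<open>\<open>T\<close> is normal in \<open>M\<close> and \<open>M\<close> is transitive on
  \<Gamma>, so fixing one part means fixing all. This identifies the factors counted by
  \<open>subdirect_card\<close> with those acting non-trivially on \<Gamma>.\<close>

lemma factor_subset_part_stabilizer:
  assumes \<Gamma>: "\<Gamma> \<in> \<E>" and T: "T \<in> \<T>"
  shows "T \<subseteq> part_stabilizer \<Gamma> \<longleftrightarrow> \<Gamma> \<notin> active T"
proof
  assume "\<Gamma> \<notin> active T"
  then have "act \<Gamma> t = \<one>\<^bsub>BijGroup \<Gamma>\<^esub>" if "t \<in> T" for t using \<Gamma> that by (simp add: active_def)
  then show "T \<subseteq> part_stabilizer \<Gamma>"
    using factor_M[OF T] one_BijGroup_apply[OF part_of(1)[OF \<Gamma> \<omega>]] by (auto simp: part_stabilizer_def)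
next
  assume sub: "T \<subseteq> part_stabilizer \<Gamma>"
  have "act \<Gamma> t = \<one>\<^bsub>BijGroup \<Gamma>\<^esub>" if t: "t \<in> T" for t
  proof (rule Bij_eqI[OF act_Bij[OF \<Gamma> M_stab[OF factor_M[OF T t] \<Gamma>]] Bij_one_closed])
    fix \<delta> assume \<delta>: "\<delta> \<in> \<Gamma>"
    let ?\<gamma> = "part_of \<Gamma> \<omega>"
    have \<gamma>: "?\<gamma> \<in> \<Gamma>" using part_of(1)[OF \<Gamma> \<omega>] .
    have "\<exists>a\<in>act \<Gamma> ` M. a ?\<gamma> = \<delta>"
      using act_M_transitive[OF \<Gamma>] \<gamma> \<delta> unfolding transitive_on_def by (metis (no_types))
    then obtain m where m: "m \<in> M" "act \<Gamma> m ?\<gamma> = \<delta>" by blast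
    have mB: "m \<in> Bij \<Omega>" and tB: "t \<in> Bij \<Omega>" using M_Bij m(1) factor_M[OF T t] by auto
    let ?s = "inv\<^bsub>\<B>\<^esub> m \<cdot> t \<cdot> m"
    have im: "inv\<^bsub>\<B>\<^esub> m \<in> M" using subgroup.m_inv_closed[OF M_subgroup m(1)] .
    have s: "?s \<in> T"
      using M.factor_conj_closed[OF T _ t, of "inv\<^bsub>\<B>\<^esub> m"] im M_inv[OF im] mB by simp
    then have s\<gamma>: "act \<Gamma> ?s ?\<gamma> = ?\<gamma>" using sub by (auto simp: part_stabilizer_def)
    have st: "m \<in> stab \<Gamma>" "t \<in> stab \<Gamma>" "?s \<in> stab \<Gamma>" using M_stab[OF _ \<Gamma>] m(1) factor_M[OF T] t s by auto
    note aB = act_Bij[OF \<Gamma> st(1)] act_Bij[OF \<Gamma> st(2)] act_Bij[OF \<Gamma> st(3)]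
    have "t \<cdot> m = m \<cdot> ?s" using mB tB by (simp add: \<B>.m_assoc)
    then have "act \<Gamma> t \<otimes>\<^bsub>BijGroup \<Gamma>\<^esub> act \<Gamma> m = act \<Gamma> m \<otimes>\<^bsub>BijGroup \<Gamma>\<^esub> act \<Gamma> ?s"
      using act_mult[OF \<Gamma> st(2,1)] act_mult[OF \<Gamma> st(1,3)] by simp
    then have "act \<Gamma> t (act \<Gamma> m ?\<gamma>) = act \<Gamma> m (act \<Gamma> ?s ?\<gamma>)"
      using mult_BijGroup_apply[OF aB(2,1) \<gamma>] mult_BijGroup_apply[OF aB(1,3) \<gamma>] by simp
    then show "act \<Gamma> t \<delta> = \<one>\<^bsub>BijGroup \<Gamma>\<^esub> \<delta>" using s\<gamma> m(2) one_BijGroup_apply[OF \<delta>] by simp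
  qed
  then show "\<Gamma> \<notin> active T" by (simp add: active_def)
qed

lemma factor_card_pos: "T \<in> \<T> \<Longrightarrow> card T \<ge> 2"
proof -
  assume T: "T \<in> \<T>"
  have "finite T" using finite_subset[OF factor_subset_M[OF T]] M.fin by simp
  moreover have "T \<noteq> {}" "\<And>x. T \<noteq> {x}"
    using M.factor_nontrivial[OF T] factor_one[OF T] by auto
  ultimately have "card T \<noteq> 0" "card T \<noteq> 1" by (auto simp: card_1_singleton_iff)
  then show ?thesis by simp
qed

text \<open>Double counting of pairs of a factor and a coordinate it moves. If each factor moved at
  least two coordinates, |M|^2 would be at most the product over \<Gamma> of the orders of the
  factors moving it, hence at most |\<Omega>|^2.\<close>

lemma exists_factor_active_le_1: "\<exists>T\<in>\<T>. card (active T) \<le> 1"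
proof (rule ccontr)
  assume "\<not> ?thesis"
  then have ge2: "2 \<le> card (active T)" if "T \<in> \<T>" for T using that by force
  have finM: "finite M" using M.fin by simp
  \<comment> \<open>This is \<open>subdirect_card\<close> for the stabiliser of a part, divided by
    the square of its order, since its index in \<open>M\<close> is |\<Gamma>|.\<close>
  have le: "(\<Prod>T | T \<in> \<T> \<and> \<Gamma> \<in> active T. card T) \<le> (card \<Gamma>)\<^sup>2" if \<Gamma>: "\<Gamma> \<in> \<E>" for \<Gamma>
  proof -
    let ?K = "part_stabilizer \<Gamma>"
    have "?K \<noteq> {}" using subgroup.one_closed[OF part_stabilizer_subgroup[OF \<Gamma>]] by blast
    moreover have "finite ?K" using finM by (simp add: part_stabilizer_def)
    ultimately have K0: "card ?K > 0" by (simp add: card_gt_0_iff)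
    have eq: "{T. T \<in> \<T> \<and> \<not> T \<subseteq> ?K} = {T. T \<in> \<T> \<and> \<Gamma> \<in> active T}"
      using factor_subset_part_stabilizer[OF \<Gamma>] by blast
    have "(\<Prod>T | T \<in> \<T> \<and> \<not> T \<subseteq> ?K. card T) * (card ?K)\<^sup>2 \<le> (card M)\<^sup>2"
      using M.subdirect_card[OF part_stabilizer_subgroup[OF \<Gamma>] part_stabilizer_onto[OF \<Gamma>]] by simp
    also have "(card M)\<^sup>2 = (card \<Gamma>)\<^sup>2 * (card ?K)\<^sup>2" by (simp add: card_part_stabilizer[OF \<Gamma>] power_mult_distrib)
    finally show ?thesis using K0 unfolding eq by simp
  qed
  have cM: "card M = (\<Prod>T\<in>\<T>. card T)" using M.card_span[of \<T>] M.span_all by simp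
  have "(card M)\<^sup>2 = (\<Prod>T\<in>\<T>. (card T)\<^sup>2)" unfolding cM by (simp add: prod_power_distrib)
  also have "\<dots> \<le> (\<Prod>T\<in>\<T>. card T ^ card (active T))"
  proof (rule prod_mono, intro conjI)
    fix T assume T: "T \<in> \<T>"
    show "(card T)\<^sup>2 \<le> card T ^ card (active T)"
      using ge2[OF T] factor_card_pos[OF T] by (intro power_increasing) auto
  qed simp
  also have "\<dots> = (\<Prod>T\<in>\<T>. \<Prod>\<Gamma> | \<Gamma> \<in> \<E> \<and> \<Gamma> \<in> active T. card T)"
  proof (rule prod.cong[OF refl])
    fix T
    have "{\<Gamma>. \<Gamma> \<in> \<E> \<and> \<Gamma> \<in> active T} = active T" by (auto simp: active_def)
    then show "card T ^ card (active T) = (\<Prod>\<Gamma> | \<Gamma> \<in> \<E> \<and> \<Gamma> \<in> active T. card T)" by simp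
  qed
  also have "\<dots> = (\<Prod>\<Gamma>\<in>\<E>. \<Prod>T | T \<in> \<T> \<and> \<Gamma> \<in> active T. card T)"
    by (rule prod.swap_restrict[OF M.finite_factors finite_\<E>])
  also have "\<dots> \<le> (\<Prod>\<Gamma>\<in>\<E>. (card \<Gamma>)\<^sup>2)" using le by (intro prod_mono) auto
  also have "\<dots> = (card \<Omega>)\<^sup>2" unfolding card_\<Omega> by (simp add: prod_power_distrib)
  finally have "card M \<le> card \<Omega>" by simp
  moreover have "card M = card \<Omega> * card {m \<in> M. m \<omega> = \<omega>}"
    using card_transitive_perm_group[OF M_subgroup M_transitive \<omega>] .
  moreover have "card \<Omega> > 0" using finite_\<Omega> nonempty by (simp add: card_gt_0_iff)
  ultimately have "card {m \<in> M. m \<omega> = \<omega>} \<le> 1" by (metis mult.right_neutral mult_le_cancel1)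
  \<comment> \<open>The point stabiliser has order at most 1 by the count, yet it projects onto
    every factor, and each factor has at least two elements.\<close>
  moreover have "card T \<le> card {m \<in> M. m \<omega> = \<omega>}" if "T \<in> \<T>" for T
  proof -
    have "p T ` {m \<in> M. m \<omega> = \<omega>} = T" using stabilizer_onto[OF that] by (simp add: stabilizer_def)
    then show ?thesis using card_image_le[of "{m \<in> M. m \<omega> = \<omega>}" "p T"] finM by simp
  qed
  ultimately show False using factors_nonempty factor_card_pos by fastforce
qed

lemma factor_conj_active:
  assumes T: "T \<in> \<T>" and g: "g \<in> G"
  shows "active ((\<lambda>t. g \<cdot> t \<cdot> inv\<^bsub>\<B>\<^esub> g) ` T) \<subseteq> move_partition g ` active T"
proof
  fix \<Gamma> assume "\<Gamma> \<in> active ((\<lambda>t. g \<cdot> t \<cdot> inv\<^bsub>\<B>\<^esub> g) ` T)"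
  then obtain t where \<Gamma>: "\<Gamma> \<in> \<E>" and t: "t \<in> T" "act \<Gamma> (g \<triangleright> t) \<noteq> \<one>\<^bsub>BijGroup \<Gamma>\<^esub>"
    by (auto simp: active_def)
  have "\<Gamma> \<in> move_partition g ` \<E>" using G_invariant g \<Gamma> by (simp add: invariant_decomposition_def)
  then obtain \<Delta> where \<Delta>: "\<Delta> \<in> \<E>" "move_partition g \<Delta> = \<Gamma>" by blast
  have "act \<Delta> t \<noteq> \<one>\<^bsub>BijGroup \<Delta>\<^esub>"
    using conj_act_one[OF \<Delta>(1) \<Gamma> G_Bij[OF g] \<Delta>(2) M_stab[OF factor_M[OF T t(1)] \<Delta>(1)]] t(2) by simp
  then have "\<Delta> \<in> active T" using \<Delta>(1) t(1) unfolding active_def by blast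
  then show "\<Gamma> \<in> move_partition g ` active T" using \<Delta>(2) by blast
qed

lemma finite_active: "finite (active T)"
  using finite_\<E> by (simp add: active_def)

text \<open>The elements of \<open>M\<close> whose conjugate by g falls in the span form a subgroup;
  it contains every factor in the invariant family, hence their span.\<close>

lemma span_normal_G:
  assumes U: "\<U> \<subseteq> \<T>"
    and conj: "\<And>T g. T \<in> \<U> \<Longrightarrow> g \<in> G \<Longrightarrow> (\<lambda>t. g \<cdot> t \<cdot> inv\<^bsub>\<B>\<^esub> g) ` T \<in> \<U>"
  shows "normal_within \<B> G (M.span \<U>)"
  unfolding normal_within_def
proof (intro conjI ballI)
  show Ds: "subgroup (M.span \<U>) \<B>" using subgroup_M[OF M.span_subgroup] .
  have DM: "M.span \<U> \<subseteq> M" by (auto simp: M.span_def)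
  then show "M.span \<U> \<subseteq> G" using M_G by blast
  fix g x assume g: "g \<in> G" and x: "x \<in> M.span \<U>"
  let ?c = "\<lambda>t. g \<cdot> t \<cdot> inv\<^bsub>\<B>\<^esub> g"
  have gB: "g \<in> Bij \<Omega>" using G_Bij[OF g] .
  let ?A = "{x \<in> M. ?c x \<in> M.span \<U>}"
  have "subgroup ?A \<B>"
  proof (rule \<B>.subgroupI)
    show "?A \<subseteq> carrier \<B>" using M_Bij by auto
    have "\<one>\<^bsub>\<B>\<^esub> \<in> ?A" using subgroup.one_closed[OF M_subgroup] subgroup.one_closed[OF Ds] gB by simp
    then show "?A \<noteq> {}" by blast
  next
    fix a assume a: "a \<in> ?A"
    have "?c (inv\<^bsub>\<B>\<^esub> a) = inv\<^bsub>\<B>\<^esub> (?c a)" using a M_Bij gB by (simp add: \<B>.inv_mult_group \<B>.m_assoc)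
    then show "inv\<^bsub>\<B>\<^esub> a \<in> ?A"
      using a subgroup.m_inv_closed[OF M_subgroup] subgroup.m_inv_closed[OF Ds, of "?c a"] by simp
    fix b assume b: "b \<in> ?A"
    have "?c (a \<cdot> b) = ?c a \<cdot> ?c b" using a b M_Bij gB by (simp add: \<B>.m_assoc)
    then show "a \<cdot> b \<in> ?A"
      using a b subgroup.m_closed[OF M_subgroup] subgroup.m_closed[OF Ds, of "?c a" "?c b"] by simp
  qed
  then have "subgroup ?A (perm_group \<Omega> M)" by (rule subgroup_in_M) blast
  moreover have "T \<subseteq> ?A" if T: "T \<in> \<U>" for T
  proof
    fix t assume t: "t \<in> T"
    have "?c t \<in> M.span \<U>"
      using M.factor_subset_span[OF conj[OF T g] U] imageI[OF t, of ?c] by blast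
    then show "t \<in> ?A" using factor_M[of T t] T U t by blast
  qed
  ultimately have "M.span \<U> \<subseteq> ?A" by (rule M.span_subset_subgroup[OF U])
  then show "?c x \<in> M.span \<U>" using x by blast
qed

text \<open>Conjugation by \<open>G\<close> permutes the factors without increasing the number of
  coordinates they move. So the factors moving at most one coordinate span a normal subgroup of
  \<open>G\<close>, which is non-trivial by \<open>exists_factor_active_le_1\<close> and therefore
  equals \<open>M\<close>.\<close>

lemma active_le_1:
  assumes T: "T \<in> \<T>"
  shows "card (active T) \<le> 1"
proof (rule ccontr)
  assume big: "\<not> card (active T) \<le> 1"
  define \<U> where "\<U> = {T \<in> \<T>. card (active T) \<le> 1}"
  have U: "\<U> \<subseteq> \<T>" by (auto simp: \<U>_def)
  have "normal_within \<B> G (M.span \<U>)"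
  proof (rule span_normal_G[OF U])
    fix S g assume S: "S \<in> \<U>" and g: "g \<in> G"
    let ?S' = "(\<lambda>t. g \<cdot> t \<cdot> inv\<^bsub>\<B>\<^esub> g) ` S"
    have ST: "S \<in> \<T>" "card (active S) \<le> 1" using S by (auto simp: \<U>_def)
    have "card (active ?S') \<le> card (move_partition g ` active S)"
      using factor_conj_active[OF ST(1) g] finite_active by (intro card_mono) auto
    also have "\<dots> \<le> card (active S)" by (rule card_image_le[OF finite_active])
    finally show "?S' \<in> \<U>" using factor_conj[OF ST(1) g] ST(2) by (simp add: \<U>_def)
  qed
  moreover have "M.span \<U> \<subseteq> M" by (auto simp: M.span_def)
  ultimately have "M.span \<U> = {\<one>\<^bsub>\<B>\<^esub>} \<or> M.span \<U> = M" by (rule M_min)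
  then show False
  proof
    assume one: "M.span \<U> = {\<one>\<^bsub>\<B>\<^esub>}"
    obtain S where S: "S \<in> \<T>" "card (active S) \<le> 1" using exists_factor_active_le_1 by blast
    then have "S \<subseteq> {\<one>\<^bsub>\<B>\<^esub>}" using M.factor_subset_span[OF _ U, of S] one by (simp add: \<U>_def)
    then show False using factor_nontrivial[OF S(1)] by blast
  next
    assume all: "M.span \<U> = M"
    obtain t where t: "t \<in> T" "t \<noteq> \<one>\<^bsub>\<B>\<^esub>" using factor_nontrivial[OF T] by blast
    have "t \<in> M.span \<U>" using all factor_M[OF T t(1)] by simp
    moreover have "T \<in> \<T> - \<U>" using T big by (simp add: \<U>_def)
    ultimately have "p T t = \<one>\<^bsub>\<B>\<^esub>" by (simp add: M.span_def)
    then show False using M.proj_self[OF T t(1)] t(2) by simp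
  qed
qed

lemma factor_supported:
  assumes T: "T \<in> \<T>" and \<Gamma>: "\<Gamma> \<in> active T" and t: "t \<in> T"
  shows "supported \<Gamma> t"
  unfolding supported_def
proof (intro conjI ballI)
  show "t \<in> base" using factor_M[OF T t] M_base by blast
  fix \<Delta> assume \<Delta>: "\<Delta> \<in> \<E> - {\<Gamma>}"
  have "\<Delta> \<notin> active T"
  proof
    assume "\<Delta> \<in> active T"
    then have "card {\<Gamma>, \<Delta>} \<le> card (active T)" using \<Gamma> finite_active by (intro card_mono) auto
    moreover have "card {\<Gamma>, \<Delta>} = 2" using \<Delta> by (metis DiffD2 card_2_iff singletonI)
    ultimately show False using active_le_1[OF T] by simp
  qed
  then show "act \<Delta> t = \<one>\<^bsub>BijGroup \<Delta>\<^esub>" using \<Delta> t by (simp add: active_def)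
qed

text \<open>Elements whose \<Gamma>-coordinate can be isolated inside \<open>M\<close> form a
  subgroup, so the simple factors suffice. A factor moving \<Gamma> is already supported on
  \<Gamma>; for any other the identity does the isolating.\<close>

lemma M_splits: "splits M"
  unfolding splits_def
proof (intro conjI ballI M_base)
  fix \<Gamma> m assume \<Gamma>: "\<Gamma> \<in> \<E>" and m: "m \<in> M"
  let ?A = "{m \<in> M. \<exists>n\<in>M. act \<Gamma> n = act \<Gamma> m \<and> supported \<Gamma> n}"
  note sup = supported_subgroup[OF \<Gamma>]
  have sup1: "supported \<Gamma> \<one>\<^bsub>\<B>\<^esub>" using subgroup.one_closed[OF sup] by simp
  have "subgroup ?A \<B>"
  proof (rule \<B>.subgroupI)
    show "?A \<subseteq> carrier \<B>" using M_Bij by auto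
    have "\<one>\<^bsub>\<B>\<^esub> \<in> ?A" using subgroup.one_closed[OF M_subgroup] sup1 by blast
    then show "?A \<noteq> {}" by blast
  next
    fix a assume "a \<in> ?A"
    then obtain n where a: "a \<in> M" and n: "n \<in> M" "act \<Gamma> n = act \<Gamma> a" "supported \<Gamma> n" by blast
    have "act \<Gamma> (inv\<^bsub>\<B>\<^esub> n) = act \<Gamma> (inv\<^bsub>\<B>\<^esub> a)"
      using act_inv[OF \<Gamma> M_stab[OF n(1) \<Gamma>]] act_inv[OF \<Gamma> M_stab[OF a \<Gamma>]] n(2) by simp
    moreover have "supported \<Gamma> (inv\<^bsub>\<B>\<^esub> n)" using subgroup.m_inv_closed[OF sup, of n] n(3) by simp
    ultimately show "inv\<^bsub>\<B>\<^esub> a \<in> ?A"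
      using subgroup.m_inv_closed[OF M_subgroup a] subgroup.m_inv_closed[OF M_subgroup n(1)] by blast
    fix b assume "b \<in> ?A"
    then obtain k where b: "b \<in> M" and k: "k \<in> M" "act \<Gamma> k = act \<Gamma> b" "supported \<Gamma> k" by blast
    have "act \<Gamma> (n \<cdot> k) = act \<Gamma> (a \<cdot> b)"
      using act_mult[OF \<Gamma> M_stab[OF n(1) \<Gamma>] M_stab[OF k(1) \<Gamma>]] act_mult[OF \<Gamma> M_stab[OF a \<Gamma>] M_stab[OF b \<Gamma>]] n(2) k(2) by simp
    moreover have "supported \<Gamma> (n \<cdot> k)" using subgroup.m_closed[OF sup, of n k] n(3) k(3) by simp
    ultimately show "a \<cdot> b \<in> ?A"
      using subgroup.m_closed[OF M_subgroup a b] subgroup.m_closed[OF M_subgroup n(1) k(1)] by blast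
  qed
  then have "subgroup ?A (perm_group \<Omega> M)" by (rule subgroup_in_M) blast
  moreover have "T \<subseteq> ?A" if T: "T \<in> \<T>" for T
  proof
    fix t assume t: "t \<in> T"
    have tM: "t \<in> M" using factor_M[OF T t] .
    show "t \<in> ?A"
    proof (cases "\<Gamma> \<in> active T")
      case True
      then show ?thesis using factor_supported[OF T True t] tM by blast
    next
      case False
      then have "act \<Gamma> \<one>\<^bsub>\<B>\<^esub> = act \<Gamma> t" using \<Gamma> t act_one[OF \<Gamma>] by (simp add: active_def)
      then show ?thesis using tM sup1 subgroup.one_closed[OF M_subgroup] by blast
    qed
  qed
  ultimately have "M.span \<T> \<subseteq> ?A" by (rule M.span_subset_subgroup[OF order_refl])
  then show "\<exists>n\<in>M. act \<Gamma> n = act \<Gamma> m \<and> supported \<Gamma> n" using m M.span_all by auto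
qed

lemma act_M_nontrivial: "\<Gamma> \<in> \<E> \<Longrightarrow> \<exists>m\<in>M. supported \<Gamma> m \<and> act \<Gamma> m \<noteq> \<one>\<^bsub>BijGroup \<Gamma>\<^esub>"
proof -
  assume \<Gamma>: "\<Gamma> \<in> \<E>"
  have "act \<Gamma> ` M \<noteq> {\<one>\<^bsub>BijGroup \<Gamma>\<^esub>}" using transitive_act_nontrivial[OF \<Gamma> act_M_transitive[OF \<Gamma>]] .
  moreover have "\<one>\<^bsub>BijGroup \<Gamma>\<^esub> \<in> act \<Gamma> ` M"
    using subgroup.one_closed[OF M_subgroup] act_one[OF \<Gamma>] by (metis imageI)
  ultimately have "\<exists>a\<in>act \<Gamma> ` M. a \<noteq> \<one>\<^bsub>BijGroup \<Gamma>\<^esub>" by (metis is_singletonI' is_singleton_def singletonD empty_iff)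
  then obtain m0 where "m0 \<in> M" "act \<Gamma> m0 \<noteq> \<one>\<^bsub>BijGroup \<Gamma>\<^esub>" by blast
  then show ?thesis using M_splits \<Gamma> unfolding splits_def by metis
qed

text \<open>The elements of \<open>M\<close> acting trivially off the orbit of \<Gamma> form a
  normal subgroup of \<open>G\<close>. It contains a non-trivial element supported on \<Gamma>, so
  it is all of \<open>M\<close>; but \<open>M\<close> acts non-trivially on every
  coordinate.\<close>

lemma \<E>_transitive: "transitive_decomposition G \<E>"
  unfolding transitive_decomposition_def
proof (intro ballI)
  fix \<Gamma> \<Delta> assume \<Gamma>: "\<Gamma> \<in> \<E>" and \<Delta>: "\<Delta> \<in> \<E>"
  define O' where "O' = (\<lambda>g. move_partition g \<Gamma>) ` G"
  define A where "A = {m \<in> M. \<forall>\<Theta>\<in>\<E> - O'. act \<Theta> m = \<one>\<^bsub>BijGroup \<Theta>\<^esub>}"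
  have "normal_within \<B> G A"
    unfolding normal_within_def
  proof (intro conjI ballI)
    show "subgroup A \<B>"
    proof (rule \<B>.subgroupI)
      show "A \<subseteq> carrier \<B>" using M_Bij by (auto simp: A_def)
      have "\<one>\<^bsub>\<B>\<^esub> \<in> A" using subgroup.one_closed[OF M_subgroup] by (simp add: A_def act_one)
      then show "A \<noteq> {}" by blast
    next
      fix a assume a: "a \<in> A"
      then have aM: "a \<in> M" by (simp add: A_def)
      have "act \<Theta> (inv\<^bsub>\<B>\<^esub> a) = \<one>\<^bsub>BijGroup \<Theta>\<^esub>" if \<Theta>: "\<Theta> \<in> \<E> - O'" for \<Theta>
      proof -
        interpret D: group "BijGroup \<Theta>" by (rule group_BijGroup)
        show ?thesis using act_inv[OF _ M_stab[OF aM]] a \<Theta> by (simp add: A_def)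
      qed
      then show "inv\<^bsub>\<B>\<^esub> a \<in> A" using subgroup.m_inv_closed[OF M_subgroup aM] by (simp add: A_def)
      fix b assume b: "b \<in> A"
      then have bM: "b \<in> M" by (simp add: A_def)
      have "act \<Theta> (a \<cdot> b) = \<one>\<^bsub>BijGroup \<Theta>\<^esub>" if \<Theta>: "\<Theta> \<in> \<E> - O'" for \<Theta>
      proof -
        interpret D: group "BijGroup \<Theta>" by (rule group_BijGroup)
        show ?thesis using act_mult[OF _ M_stab[OF aM] M_stab[OF bM]] a b \<Theta> by (simp add: A_def)
      qed
      then show "a \<cdot> b \<in> A" using subgroup.m_closed[OF M_subgroup aM bM] by (simp add: A_def)
    qed
    show "A \<subseteq> G" using M_G by (auto simp: A_def)
    fix g m assume g: "g \<in> G" and m: "m \<in> A"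
    then have mM: "m \<in> M" by (simp add: A_def)
    have "act \<Theta> (g \<triangleright> m) = \<one>\<^bsub>BijGroup \<Theta>\<^esub>" if \<Theta>: "\<Theta> \<in> \<E> - O'" for \<Theta>
    proof -
      have "\<Theta> \<in> move_partition g ` \<E>" using G_invariant g \<Theta> by (simp add: invariant_decomposition_def)
      then obtain \<Lambda> where \<Lambda>: "\<Lambda> \<in> \<E>" "move_partition g \<Lambda> = \<Theta>" by blast
      have "\<Lambda> \<notin> O'"
      proof
        assume "\<Lambda> \<in> O'"
        then obtain h where h: "h \<in> G" "\<Lambda> = move_partition h \<Gamma>" by (auto simp: O'_def)
        have "move_partition (g \<cdot> h) \<Gamma> = \<Theta>"
          using move_mult[OF G_Bij[OF g] G_Bij[OF h(1)] \<Gamma>] h(2) \<Lambda>(2) by simp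
        then have "\<Theta> \<in> O'" using subgroup.m_closed[OF G_subgroup g h(1)] unfolding O'_def by blast
        then show False using \<Theta> by blast
      qed
      then have "act \<Lambda> m = \<one>\<^bsub>BijGroup \<Lambda>\<^esub>" using m \<Lambda>(1) by (simp add: A_def)
      then show ?thesis
        using conj_act_one[OF \<Lambda>(1) _ G_Bij[OF g] \<Lambda>(2) M_stab[OF mM \<Lambda>(1)]] \<Theta> by simp
    qed
    then show "g \<triangleright> m \<in> A" using M_conj[OF g mM] by (simp add: A_def)
  qed
  moreover have "A \<subseteq> M" by (auto simp: A_def)
  ultimately have "A = {\<one>\<^bsub>\<B>\<^esub>} \<or> A = M" by (rule M_min)
  moreover have "A \<noteq> {\<one>\<^bsub>\<B>\<^esub>}"
  proof
    assume one: "A = {\<one>\<^bsub>\<B>\<^esub>}"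
    obtain m where m: "m \<in> M" "supported \<Gamma> m" "act \<Gamma> m \<noteq> \<one>\<^bsub>BijGroup \<Gamma>\<^esub>" using act_M_nontrivial[OF \<Gamma>] by blast
    have "\<Gamma> \<in> O'" using move_one[OF \<Gamma>] subgroup.one_closed[OF G_subgroup] unfolding O'_def by (metis imageI)
    then have "act \<Theta> m = \<one>\<^bsub>BijGroup \<Theta>\<^esub>" if "\<Theta> \<in> \<E> - O'" for \<Theta>
      using that m(2) unfolding supported_def by blast
    then have "m \<in> A" using m(1) by (simp add: A_def)
    then show False using one m(3) act_one[OF \<Gamma>] by simp
  qed
  ultimately have AM: "A = M" by blast
  have "\<Delta> \<in> O'"
  proof (rule ccontr)
    assume "\<Delta> \<notin> O'"
    moreover obtain m where m: "m \<in> M" "act \<Delta> m \<noteq> \<one>\<^bsub>BijGroup \<Delta>\<^esub>" using act_M_nontrivial[OF \<Delta>] by blast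
    ultimately show False using AM \<Delta> by (auto simp: A_def)
  qed
  then show "\<exists>g\<in>G. move_partition g \<Gamma> = \<Delta>" by (auto simp: O'_def)
qed

section \<open>The component groups and the shape of the point stabiliser\<close>

lemma component_minimal_normal:
  assumes \<Gamma>: "\<Gamma> \<in> \<E>"
  shows "minimal_normal (act \<Gamma> ` M) (perm_group \<Gamma> (component G \<Gamma>))"
  unfolding group.minimal_normal_within[OF group_BijGroup component_subgroup[OF \<Gamma>]]
proof (intro conjI allI impI)
  show "normal_within (BijGroup \<Gamma>) (component G \<Gamma>) (act \<Gamma> ` M)"
    using act_normal[OF \<Gamma> M_normal] M_stab[OF _ \<Gamma>] by blast
  show "act \<Gamma> ` M \<noteq> {\<one>\<^bsub>BijGroup \<Gamma>\<^esub>}" using transitive_act_nontrivial[OF \<Gamma> act_M_transitive[OF \<Gamma>]] .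
  fix K assume "normal_within (BijGroup \<Gamma>) (component G \<Gamma>) K \<and> K \<subseteq> act \<Gamma> ` M"
  then have K: "normal_within (BijGroup \<Gamma>) (component G \<Gamma>) K" "K \<subseteq> act \<Gamma> ` M" by auto
  show "K = {\<one>\<^bsub>BijGroup \<Gamma>\<^esub>} \<or> K = act \<Gamma> ` M"
  proof (cases "K = {\<one>\<^bsub>BijGroup \<Gamma>\<^esub>}")
    case False
    have "\<one>\<^bsub>BijGroup \<Gamma>\<^esub> \<in> K" using K(1) subgroup.one_closed[of K "BijGroup \<Gamma>"] by (simp add: normal_within_def)
    then obtain a where a: "a \<in> K" "a \<noteq> \<one>\<^bsub>BijGroup \<Gamma>\<^esub>" using False by blast
    obtain m where m: "m \<in> lift M \<Gamma> K" "act \<Gamma> m = a"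
      using supported_in_lift[OF \<Gamma> K(1) M_splits a(1)] a(1) K(2) by blast
    \<comment> \<open>The lift of a non-trivial \<open>K\<close> is a non-trivial normal subgroup of
      \<open>G\<close> inside \<open>M\<close>, so minimality of \<open>M\<close> descends to the
      component.\<close>
    have "lift M \<Gamma> K = {\<one>\<^bsub>\<B>\<^esub>} \<or> lift M \<Gamma> K = M"
      using lift_normal[OF \<Gamma> M_normal M_base K(1)] by (rule M_min) (auto simp: lift_def)
    moreover have "m \<noteq> \<one>\<^bsub>\<B>\<^esub>" using m(2) a(2) act_one[OF \<Gamma>] by auto
    ultimately have "lift M \<Gamma> K = M" using m(1) by auto
    then have "act \<Gamma> ` M \<subseteq> K" using lift_act[OF \<Gamma>, of _ M K] M_Bij by blast
    then show ?thesis using K(2) by blast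
  qed simp
qed

lemma act_M_subgroup: "\<Gamma> \<in> \<E> \<Longrightarrow> subgroup (act \<Gamma> ` M) (BijGroup \<Gamma>)"
  using act_subgroup[OF _ M_subgroup] M_stab by blast

text \<open>The surviving images of the factors are the new factors. The stabiliser of \<omega> acts
  on \<Gamma> inside the stabiliser of the part containing \<omega>, so the latter inherits
  surjectivity onto each of them.\<close>

lemma component_simple_product:
  assumes \<Gamma>: "\<Gamma> \<in> \<E>"
  shows "\<exists>\<U> q. simple_product (perm_group \<Gamma> (act \<Gamma> ` M)) \<U> q \<and>
    (\<forall>U\<in>\<U>. q U ` point_stabilizer \<Gamma> (act \<Gamma> ` M) (part_of \<Gamma> \<omega>) = U)"
proof -
  let ?L = "perm_group \<Gamma> (act \<Gamma> ` M)" and ?\<gamma> = "part_of \<Gamma> \<omega>"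
  have "group ?L" using group.subgroup_imp_group[OF group_BijGroup act_M_subgroup[OF \<Gamma>]] .
  then have hom: "group_hom (perm_group \<Omega> M) ?L (act \<Gamma>)"
    using M.is_group act_mult[OF \<Gamma>] M_stab[OF _ \<Gamma>] by (simp add: group_hom_def group_hom_axioms_def hom_def)
  obtain q where q: "simple_product ?L {U \<in> (`) (act \<Gamma>) ` \<T>. U \<noteq> {\<one>\<^bsub>?L\<^esub>}} q"
    and q_act: "\<And>T x. T \<in> \<T> \<Longrightarrow> act \<Gamma> ` T \<noteq> {\<one>\<^bsub>?L\<^esub>} \<Longrightarrow> x \<in> M \<Longrightarrow> q (act \<Gamma> ` T) (act \<Gamma> x) = act \<Gamma> (p T x)"
    using M.image_simple_product[OF hom] by auto
  interpret L: simple_product ?L "{U \<in> (`) (act \<Gamma>) ` \<T>. U \<noteq> {\<one>\<^bsub>?L\<^esub>}}" q by (rule q)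
  have onto: "q U ` point_stabilizer \<Gamma> (act \<Gamma> ` M) ?\<gamma> = U" if U: "U \<in> {U \<in> (`) (act \<Gamma>) ` \<T>. U \<noteq> {\<one>\<^bsub>?L\<^esub>}}" for U
  proof
    show "q U ` point_stabilizer \<Gamma> (act \<Gamma> ` M) ?\<gamma> \<subseteq> U" using L.proj_in[OF U] by (auto simp: stabilizer_def)
    obtain T where T: "T \<in> \<T>" "U = act \<Gamma> ` T" "act \<Gamma> ` T \<noteq> {\<one>\<^bsub>?L\<^esub>}" using U by blast
    show "U \<subseteq> q U ` point_stabilizer \<Gamma> (act \<Gamma> ` M) ?\<gamma>"
    proof
      fix u assume "u \<in> U"
      then obtain t where t: "t \<in> T" "u = act \<Gamma> t" using T(2) by blast
      then obtain k where k: "k \<in> point_stabilizer \<Omega> M \<omega>" "t = p T k" using stabilizer_onto[OF T(1)] by blast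
      have kM: "k \<in> M" using k(1) by (simp add: stabilizer_def)
      have "act \<Gamma> k ?\<gamma> = ?\<gamma>" using point_stabilizer_subset[OF \<Gamma>] k(1) by (auto simp: part_stabilizer_def)
      then have "act \<Gamma> k \<in> point_stabilizer \<Gamma> (act \<Gamma> ` M) ?\<gamma>" using kM by (simp add: stabilizer_def)
      moreover have "q U (act \<Gamma> k) = u" using q_act[OF T(1,3) kM] T(2) t(2) k(2) by simp
      ultimately show "u \<in> q U ` point_stabilizer \<Gamma> (act \<Gamma> ` M) ?\<gamma>" by (metis imageI)
    qed
  qed
  show ?thesis
  proof (intro exI conjI ballI)
    show "simple_product ?L {U \<in> (`) (act \<Gamma>) ` \<T>. U \<noteq> {\<one>\<^bsub>?L\<^esub>}} q" by (rule q)
  qed (rule onto)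
qed

lemma part_point_stabilizer_subgroup:
  assumes \<Gamma>: "\<Gamma> \<in> \<E>"
  shows "subgroup (point_stabilizer \<Gamma> (act \<Gamma> ` M) (part_of \<Gamma> \<omega>)) (perm_group \<Gamma> (act \<Gamma> ` M))"
proof -
  have "group_hom (perm_group \<Gamma> (act \<Gamma> ` M)) (BijGroup \<Gamma>) (\<lambda>g. g)"
    using group.subgroup_imp_group[OF group_BijGroup act_M_subgroup[OF \<Gamma>]] subgroup.subset[OF act_M_subgroup[OF \<Gamma>]]
      group_BijGroup[of \<Gamma>]
    by (auto simp: group_hom_def group_hom_axioms_def hom_def)
  then interpret group_action "perm_group \<Gamma> (act \<Gamma> ` M)" \<Gamma> "\<lambda>g. g" by (simp add: group_action_def)
  show ?thesis by (rule stabilizer_subgroup[OF part_of(1)[OF \<Gamma> \<omega>]])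
qed

text \<open>
  The centraliser of a transitive group corresponds to the normaliser of a point stabiliser modulo that
  stabiliser, and subdirect subgroups are self-normalising.
\<close>

lemma component_centralizer:
  assumes \<Gamma>: "\<Gamma> \<in> \<E>" and c: "c \<in> Bij \<Gamma>"
    and comm: "\<And>a. a \<in> act \<Gamma> ` M \<Longrightarrow> c \<otimes>\<^bsub>BijGroup \<Gamma>\<^esub> a = a \<otimes>\<^bsub>BijGroup \<Gamma>\<^esub> c"
  shows "c = \<one>\<^bsub>BijGroup \<Gamma>\<^esub>"
proof -
  let ?L = "act \<Gamma> ` M" and ?\<gamma> = "part_of \<Gamma> \<omega>"
  let ?K = "point_stabilizer \<Gamma> ?L ?\<gamma>"
  interpret C: group "BijGroup \<Gamma>" by (rule group_BijGroup)
  note Ls = act_M_subgroup[OF \<Gamma>]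
  obtain \<U> q where q: "simple_product (perm_group \<Gamma> ?L) \<U> q" and all: "\<forall>U\<in>\<U>. q U ` ?K = U"
    using component_simple_product[OF \<Gamma>] by (elim exE conjE) (rule that)
  have onto: "q U ` ?K = U" if "U \<in> \<U>" for U using all that by (rule bspec)
  interpret L: simple_product "perm_group \<Gamma> ?L" \<U> q by (rule q)
  have \<gamma>: "?\<gamma> \<in> \<Gamma>" using part_of(1)[OF \<Gamma> \<omega>] .
  have LB: "a \<in> Bij \<Gamma>" if "a \<in> ?L" for a using subgroup.mem_carrier[OF Ls that] by simp
  have trans: "\<exists>a\<in>?L. a ?\<gamma> = \<delta>" if "\<delta> \<in> \<Gamma>" for \<delta>
    using act_M_transitive[OF \<Gamma>] \<gamma> that unfolding transitive_on_def by (metis (no_types))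
  have comm_apply: "c (a \<delta>) = a (c \<delta>)" if "a \<in> ?L" "\<delta> \<in> \<Gamma>" for a \<delta>
    using fun_cong[OF comm[OF that(1)], of \<delta>] mult_BijGroup_apply[OF c LB[OF that(1)] that(2)]
      mult_BijGroup_apply[OF LB[OF that(1)] c that(2)] by simp
  \<comment> \<open>An element of the transitive group imitating \<open>c\<close> at one part. Since
    \<open>c\<close> commutes with the stabiliser of that part, \<open>inv l\<close> normalises this
    stabiliser, hence belongs to it; so \<open>c\<close> fixes the part, and by transitivity every
    part.\<close>
  obtain l where l: "l \<in> ?L" "l ?\<gamma> = c ?\<gamma>" using trans[OF Bij_apply[OF c \<gamma>]] by blast
  let ?x = "inv\<^bsub>BijGroup \<Gamma>\<^esub> l"
  have xL: "?x \<in> ?L" using subgroup.m_inv_closed[OF Ls l(1)] .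
  have inv_L: "inv\<^bsub>perm_group \<Gamma> ?L\<^esub> a = inv\<^bsub>BijGroup \<Gamma>\<^esub> a" if "a \<in> ?L" for a
    using C.m_inv_consistent[OF Ls that] .
  have "?x \<in> ?K"
  proof (rule L.subdirect_self_normalising[OF part_point_stabilizer_subgroup[OF \<Gamma>] onto])
    show "?x \<in> carrier (perm_group \<Gamma> ?L)" using xL by simp
    fix k assume "k \<in> ?K"
    then have k: "k \<in> ?L" "k ?\<gamma> = ?\<gamma>" by (auto simp: stabilizer_def)
    have "k (l ?\<gamma>) = l ?\<gamma>" using comm_apply[OF k(1) \<gamma>] k(2) l(2) by simp
    then have "(?x \<otimes>\<^bsub>BijGroup \<Gamma>\<^esub> k \<otimes>\<^bsub>BijGroup \<Gamma>\<^esub> l) ?\<gamma> = ?\<gamma>"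
      using mult_BijGroup_apply[OF _ LB[OF l(1)] \<gamma>, of "?x \<otimes>\<^bsub>BijGroup \<Gamma>\<^esub> k"]
        mult_BijGroup_apply[OF LB[OF xL] LB[OF k(1)] Bij_apply[OF LB[OF l(1)] \<gamma>]] LB[OF xL] LB[OF k(1)]
        inv_BijGroup_apply(1)[OF LB[OF l(1)] \<gamma>] by simp
    moreover have "?x \<otimes>\<^bsub>BijGroup \<Gamma>\<^esub> k \<otimes>\<^bsub>BijGroup \<Gamma>\<^esub> l \<in> ?L"
      using subgroup.m_closed[OF Ls subgroup.m_closed[OF Ls xL k(1)] l(1)] .
    ultimately show "?x \<otimes>\<^bsub>perm_group \<Gamma> ?L\<^esub> k \<otimes>\<^bsub>perm_group \<Gamma> ?L\<^esub> inv\<^bsub>perm_group \<Gamma> ?L\<^esub> ?x \<in> ?K"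
      using inv_L[OF xL] LB[OF l(1)] by (simp add: stabilizer_def)
  qed
  then have "?x ?\<gamma> = ?\<gamma>" by (simp add: stabilizer_def)
  then have "l ?\<gamma> = ?\<gamma>" using inv_BijGroup_apply(2)[OF LB[OF l(1)] \<gamma>] by simp
  then have c\<gamma>: "c ?\<gamma> = ?\<gamma>" using l(2) by simp
  show ?thesis
  proof (rule Bij_eqI[OF c Bij_one_closed])
    fix \<delta> assume \<delta>: "\<delta> \<in> \<Gamma>"
    obtain a where a: "a \<in> ?L" "a ?\<gamma> = \<delta>" using trans[OF \<delta>] by blast
    then show "c \<delta> = \<one>\<^bsub>BijGroup \<Gamma>\<^esub> \<delta>"
      using comm_apply[OF a(1) \<gamma>] c\<gamma> one_BijGroup_apply[OF \<delta>] by simp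
  qed
qed

text \<open>A second minimal normal subgroup would meet the image of \<open>M\<close> trivially and
  so centralise it, which \<open>component_centralizer\<close> rules out.\<close>

lemma component_socle:
  assumes \<Gamma>: "\<Gamma> \<in> \<E>"
  shows "socle (perm_group \<Gamma> (component G \<Gamma>)) = act \<Gamma> ` M"
proof
  interpret C: group "BijGroup \<Gamma>" by (rule group_BijGroup)
  note C_sub = component_subgroup[OF \<Gamma>] and L = component_minimal_normal[OF \<Gamma>]
  interpret CW: group "perm_group \<Gamma> (component G \<Gamma>)" using C.subgroup_imp_group[OF C_sub] .
  have Ln: "normal_within (BijGroup \<Gamma>) (component G \<Gamma>) (act \<Gamma> ` M)"
    using L by (simp add: C.minimal_normal_within[OF C_sub])
  show "act \<Gamma> ` M \<subseteq> socle (perm_group \<Gamma> (component G \<Gamma>))" by (rule minimal_normal_subset_socle[OF L])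
  show "socle (perm_group \<Gamma> (component G \<Gamma>)) \<subseteq> act \<Gamma> ` M"
    unfolding socle_def
  proof (rule CW.generate_subgroup_incl, rule Union_least)
    show "subgroup (act \<Gamma> ` M) (perm_group \<Gamma> (component G \<Gamma>))"
      using C.subgroup_incl[OF act_M_subgroup[OF \<Gamma>] C_sub] Ln by (simp add: normal_within_def)
    fix N assume "N \<in> {N. minimal_normal N (perm_group \<Gamma> (component G \<Gamma>))}"
    then have N: "normal_within (BijGroup \<Gamma>) (component G \<Gamma>) N" "N \<noteq> {\<one>\<^bsub>BijGroup \<Gamma>\<^esub>}"
      and min: "\<And>K. normal_within (BijGroup \<Gamma>) (component G \<Gamma>) K \<Longrightarrow> K \<subseteq> N \<Longrightarrow> K = {\<one>\<^bsub>BijGroup \<Gamma>\<^esub>} \<or> K = N"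
      by (auto simp: C.minimal_normal_within[OF C_sub])
    have Ns: "subgroup N (BijGroup \<Gamma>)" using N(1) by (simp add: normal_within_def)
    have "N \<inter> act \<Gamma> ` M = {\<one>\<^bsub>BijGroup \<Gamma>\<^esub>} \<or> N \<inter> act \<Gamma> ` M = N"
      by (rule min[OF C.normal_within_Int[OF N(1) Ln]]) blast
    then show "N \<subseteq> act \<Gamma> ` M"
    proof
      assume triv: "N \<inter> act \<Gamma> ` M = {\<one>\<^bsub>BijGroup \<Gamma>\<^esub>}"
      have "n = \<one>\<^bsub>BijGroup \<Gamma>\<^esub>" if n: "n \<in> N" for n
      proof (rule component_centralizer[OF \<Gamma>])
        show "n \<in> Bij \<Gamma>" using subgroup.mem_carrier[OF Ns n] by simp
        show "n \<otimes>\<^bsub>BijGroup \<Gamma>\<^esub> a = a \<otimes>\<^bsub>BijGroup \<Gamma>\<^esub> n" if "a \<in> act \<Gamma> ` M" for a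
          using C.normal_within_commute[OF N(1) Ln triv n that] .
      qed
      then show ?thesis using N(2) subgroup.one_closed[OF Ns] by blast
    qed blast
  qed
qed

lemma blow_up: "blow_up \<Omega> \<E> G M"
  using M_normal M_transitive M_splits component_socle \<E>_transitive invariant_cartesian_axioms
  by (simp add: blow_up_def blow_up_axioms_def)

text \<open>If the stabiliser acted trivially on \<Gamma>, an element of \<open>M\<close> supported
  on \<Gamma> would commute with it, and by subdirectness each component of that element would be
  central in a factor. This contradicts the non-trivial action of \<open>M\<close> on
  \<Gamma>.\<close>

lemma point_stabilizer_supported:
  assumes \<Gamma>: "\<Gamma> \<in> \<E>"
  shows "\<exists>s\<in>point_stabilizer \<Omega> M \<omega>. supported \<Gamma> s \<and> act \<Gamma> s \<noteq> \<one>\<^bsub>BijGroup \<Gamma>\<^esub>"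
proof -
  let ?S = "point_stabilizer \<Omega> M \<omega>"
  have SM: "s \<in> M" if "s \<in> ?S" for s using that by (simp add: stabilizer_def)
  have "\<exists>k\<in>?S. act \<Gamma> k \<noteq> \<one>\<^bsub>BijGroup \<Gamma>\<^esub>"
  proof (rule ccontr)
    assume "\<not> ?thesis"
    then have triv: "act \<Gamma> k = \<one>\<^bsub>BijGroup \<Gamma>\<^esub>" if "k \<in> ?S" for k using that by blast
    obtain y where y: "y \<in> M" "supported \<Gamma> y" "act \<Gamma> y \<noteq> \<one>\<^bsub>BijGroup \<Gamma>\<^esub>" using act_M_nontrivial[OF \<Gamma>] by blast
    have comm: "y \<cdot> k = k \<cdot> y" if k: "k \<in> ?S" for k
    proof (rule base_eqI)
      have kM: "k \<in> M" using SM[OF k] .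
      show "y \<cdot> k \<in> base" "k \<cdot> y \<in> base"
        using subgroup.m_closed[OF M_subgroup] y(1) kM M_base by blast+
      fix \<Delta> assume \<Delta>: "\<Delta> \<in> \<E>"
      interpret D: group "BijGroup \<Delta>" by (rule group_BijGroup)
      note st = M_stab[OF y(1) \<Delta>] M_stab[OF kM \<Delta>]
      have "act \<Delta> y = \<one>\<^bsub>BijGroup \<Delta>\<^esub> \<or> act \<Delta> k = \<one>\<^bsub>BijGroup \<Delta>\<^esub>"
        using triv[OF k] y(2) \<Delta> unfolding supported_def by blast
      then show "act \<Delta> (y \<cdot> k) = act \<Delta> (k \<cdot> y)"
        using act_mult[OF \<Delta> st] act_mult[OF \<Delta> st(2,1)] act_Bij[OF \<Delta> st(1)] act_Bij[OF \<Delta> st(2)] by auto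
    qed
    have "y = \<one>\<^bsub>perm_group \<Omega> M\<^esub>"
    proof (rule M.proj_separate)
      show yc: "y \<in> carrier (perm_group \<Omega> M)" using y(1) by simp
      fix T assume T: "T \<in> \<T>"
      show "p T y = \<one>\<^bsub>perm_group \<Omega> M\<^esub>"
      proof (rule M.factor_center[OF T M.proj_in[OF T yc]])
        fix t assume "t \<in> T"
        then obtain k where k: "k \<in> ?S" "t = p T k" using stabilizer_onto[OF T] by blast
        have kc: "k \<in> carrier (perm_group \<Omega> M)" using SM[OF k(1)] by simp
        show "p T y \<otimes>\<^bsub>perm_group \<Omega> M\<^esub> t = t \<otimes>\<^bsub>perm_group \<Omega> M\<^esub> p T y"
          using M.proj_mult[OF T yc kc] M.proj_mult[OF T kc yc] comm[OF k(1)] k(2) by simp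
      qed
    qed
    then show False using y(3) act_one[OF \<Gamma>] by simp
  qed
  then obtain k where k: "k \<in> ?S" "act \<Gamma> k \<noteq> \<one>\<^bsub>BijGroup \<Gamma>\<^esub>" by blast
  obtain s where s: "s \<in> M" "act \<Gamma> s = act \<Gamma> k" "supported \<Gamma> s"
    using M_splits \<Gamma> SM[OF k(1)] unfolding splits_def by blast
  \<comment> \<open>Isolating the \<Gamma>-coordinate of \<open>k\<close> stays inside the
    stabiliser: on \<Gamma> it fixes the part of \<omega> as \<open>k\<close> does, and elsewhere it
    is trivial.\<close>
  have "s \<omega> = \<omega>"
  proof (rule point_eqI[OF Bij_apply[OF M_Bij[OF s(1)] \<omega>] \<omega>])
    fix \<Delta> assume \<Delta>: "\<Delta> \<in> \<E>"
    have "act \<Delta> s (part_of \<Delta> \<omega>) = part_of \<Delta> \<omega>"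
    proof (cases "\<Delta> = \<Gamma>")
      case True
      then show ?thesis using s(2) point_stabilizer_subset[OF \<Gamma>] k(1) by (auto simp: part_stabilizer_def)
    next
      case False
      then have "act \<Delta> s = \<one>\<^bsub>BijGroup \<Delta>\<^esub>" using s(3) \<Delta> by (simp add: supported_def)
      then show ?thesis using one_BijGroup_apply[OF part_of(1)[OF \<Delta> \<omega>]] by simp
    qed
    then show "part_of \<Delta> (s \<omega>) = part_of \<Delta> \<omega>" using act_part_of[OF \<Delta> M_stab[OF s(1) \<Delta>] \<omega>] by simp
  qed
  then have "s \<in> ?S" using s(1) by (simp add: stabilizer_def)
  then show ?thesis using s k(2) by auto
qed

text \<open>The stabiliser elements supported on \<Gamma> form a normal subgroup. It is non-trivial,
  and it is proper because a second partition \<Delta> supplies a stabiliser element acting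
  non-trivially on \<Delta>.\<close>

lemma point_stabilizer_not_simple: "\<not> simple_group (perm_group \<Omega> (point_stabilizer \<Omega> M \<omega>))"
proof
  let ?S = "point_stabilizer \<Omega> M \<omega>"
  assume simple: "simple_group (perm_group \<Omega> ?S)"
  obtain \<Gamma> where \<Gamma>: "\<Gamma> \<in> \<E>" using \<E>_nonempty by blast
  obtain \<Delta> where \<Delta>: "\<Delta> \<in> \<E>" "\<Delta> \<noteq> \<Gamma>" using two_partitions[OF \<Gamma>] by blast
  have SM: "?S \<subseteq> M" by (auto simp: stabilizer_def)
  have "group_hom (perm_group \<Omega> M) \<B> (\<lambda>g. g)"
    using M.is_group group_BijGroup[of \<Omega>] M_Bij by (auto simp: group_hom_def group_hom_axioms_def hom_def)
  then interpret group_action "perm_group \<Omega> M" \<Omega> "\<lambda>g. g" by (simp add: group_action_def)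
  have Ss: "subgroup ?S \<B>" using subgroup_M[OF stabilizer_subgroup[OF \<omega>]] .
  let ?A = "?S \<inter> {g. supported \<Gamma> g}"
  have "normal_within \<B> ?S ?A"
    unfolding normal_within_def
  proof (intro conjI ballI)
    show As: "subgroup ?A \<B>" using \<B>.subgroups_Inter_pair[OF Ss supported_subgroup[OF \<Gamma>]] .
    show "?A \<subseteq> ?S" by blast
    fix g n assume g: "g \<in> ?S" and n: "n \<in> ?A"
    have gM: "g \<in> M" using g SM by blast
    have "move_partition g \<Gamma> = \<Gamma>" using M_stab[OF gM \<Gamma>] by (simp add: stab_def)
    then have "supported \<Gamma> (g \<triangleright> n)"
      using supported_conj[of g \<Gamma> n \<Gamma>] gM M_G \<Gamma> n by blast
    moreover have "g \<triangleright> n \<in> ?S"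
      using subgroup.m_closed[OF Ss subgroup.m_closed[OF Ss g, of n] subgroup.m_inv_closed[OF Ss g]] n by blast
    ultimately show "g \<triangleright> n \<in> ?A" by blast
  qed
  then have "?A \<lhd> perm_group \<Omega> ?S" using \<B>.normal_iff_normal_within[OF Ss] by blast
  then have "?A = ?S \<or> ?A = {\<one>\<^bsub>\<B>\<^esub>}"
    using simple_group.no_real_normal_subgroup[OF simple, of ?A] by simp
  then show False
  proof
    assume eq: "?A = ?S"
    obtain s where s: "s \<in> ?S" "supported \<Delta> s" "act \<Delta> s \<noteq> \<one>\<^bsub>BijGroup \<Delta>\<^esub>"
      using point_stabilizer_supported[OF \<Delta>(1)] by blast
    then have "supported \<Gamma> s" using eq by blast
    then show False using s(3) \<Delta> by (simp add: supported_def)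
  next
    assume eq: "?A = {\<one>\<^bsub>\<B>\<^esub>}"
    obtain s where s: "s \<in> ?S" "supported \<Gamma> s" "act \<Gamma> s \<noteq> \<one>\<^bsub>BijGroup \<Gamma>\<^esub>"
      using point_stabilizer_supported[OF \<Gamma>] by blast
    then have "s = \<one>\<^bsub>\<B>\<^esub>" using eq by blast
    then show False using s(3) act_one[OF \<Gamma>] by simp
  qed
qed

lemma component_type:
  assumes q: "quasiprimitive \<Omega> G" and \<Gamma>: "\<Gamma> \<in> \<E>"
  shows "type_Sd \<Gamma> (component G \<Gamma>) \<or> type_Cd \<Gamma> (component G \<Gamma>)"
proof -
  let ?L = "act \<Gamma> ` M" and ?\<gamma> = "part_of \<Gamma> \<omega>"
  let ?K = "point_stabilizer \<Gamma> ?L ?\<gamma>"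
  have \<gamma>: "?\<gamma> \<in> \<Gamma>" using part_of(1)[OF \<Gamma> \<omega>] .
  obtain \<U> r where r: "simple_product (perm_group \<Gamma> ?L) \<U> r" and all: "\<forall>U\<in>\<U>. r U ` ?K = U"
    using component_simple_product[OF \<Gamma>] by (elim exE conjE) (rule that)
  have onto: "r U ` ?K = U" if "U \<in> \<U>" for U using all that by (rule bspec)
  interpret L: simple_product "perm_group \<Gamma> ?L" \<U> r by (rule r)
  have Ks: "subgroup ?K (perm_group \<Gamma> ?L)" by (rule part_point_stabilizer_subgroup[OF \<Gamma>])
  obtain m where m: "m \<in> M" "act \<Gamma> m \<noteq> \<one>\<^bsub>BijGroup \<Gamma>\<^esub>" using act_M_nontrivial[OF \<Gamma>] by blast
  have "\<U> \<noteq> {}" using L.proj_separate[of "act \<Gamma> m"] m by auto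
  then obtain U where U: "U \<in> \<U>" by blast
  have not_comm: "\<not> comm_group (perm_group \<Gamma> ?L)"
  proof
    assume "comm_group (perm_group \<Gamma> ?L)"
    then interpret LC: comm_group "perm_group \<Gamma> ?L" .
    obtain s t where st: "s \<in> U" "t \<in> U" "s \<otimes>\<^bsub>perm_group \<Gamma> ?L\<^esub> t \<noteq> t \<otimes>\<^bsub>perm_group \<Gamma> ?L\<^esub> s"
      using L.factor_noncommuting[OF U] .
    then show False using LC.m_comm[OF L.factor_carrier[OF U st(1)] L.factor_carrier[OF U st(2)]] by blast
  qed
  \<comment> \<open>If the image of \<open>M\<close> were simple it would be its own only factor,
    and a stabiliser projecting onto it would be the whole group; transitivity would then leave only
    one part.\<close>
  have not_simple: "\<not> simple_group (perm_group \<Gamma> ?L)"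
  proof
    assume simple: "simple_group (perm_group \<Gamma> ?L)"
    have "U \<lhd> perm_group \<Gamma> ?L"
      using L.normal_invI[OF L.factor_subgroup[OF U]] L.factor_conj_closed[OF U] by blast
    then have UL: "U = ?L"
      using simple_group.no_real_normal_subgroup[OF simple, of U] L.factor_nontrivial[OF U] by auto
    have KL: "?K \<subseteq> ?L" by (auto simp: stabilizer_def)
    have "r U ` ?K = (\<lambda>k. k) ` ?K"
    proof (rule image_cong[OF refl])
      fix k assume "k \<in> ?K"
      then have "k \<in> U" using KL unfolding UL by (rule rev_subsetD)
      then show "r U k = k" by (rule L.proj_self[OF U])
    qed
    then have KL: "?K = ?L" using onto[OF U] UL by simp
    have "\<delta> = ?\<gamma>" if "\<delta> \<in> \<Gamma>" for \<delta>
    proof -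
      have "\<exists>a\<in>?L. a ?\<gamma> = \<delta>"
        using act_M_transitive[OF \<Gamma>] \<gamma> that unfolding transitive_on_def by (metis (no_types))
      then obtain a where a: "a \<in> ?L" "a ?\<gamma> = \<delta>" by blast
      have "a \<in> ?K" using a(1) KL by simp
      then show ?thesis using a(2) by (simp add: stabilizer_def)
    qed
    then show False using two_parts[OF \<Gamma>] by blast
  qed
  have cent: "centralizer (perm_group \<Gamma> (component G \<Gamma>)) ?L = {\<one>\<^bsub>perm_group \<Gamma> (component G \<Gamma>)\<^esub>}"
  proof (intro equalityI subsetI)
    fix c assume "c \<in> centralizer (perm_group \<Gamma> (component G \<Gamma>)) ?L"
    then have c: "c \<in> component G \<Gamma>" "\<And>a. a \<in> ?L \<Longrightarrow> c \<otimes>\<^bsub>BijGroup \<Gamma>\<^esub> a = a \<otimes>\<^bsub>BijGroup \<Gamma>\<^esub> c"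
      by (auto simp: centralizer_def)
    have "c \<in> Bij \<Gamma>" using subgroup.mem_carrier[OF component_subgroup[OF \<Gamma>] c(1)] by simp
    then have "c = \<one>\<^bsub>BijGroup \<Gamma>\<^esub>" using c(2) by (rule component_centralizer[OF \<Gamma>])
    then show "c \<in> {\<one>\<^bsub>perm_group \<Gamma> (component G \<Gamma>)\<^esub>}" by simp
  next
    interpret C: group "BijGroup \<Gamma>" by (rule group_BijGroup)
    fix c assume "c \<in> {\<one>\<^bsub>perm_group \<Gamma> (component G \<Gamma>)\<^esub>}"
    then have c: "c = \<one>\<^bsub>BijGroup \<Gamma>\<^esub>" by simp
    have "c \<otimes>\<^bsub>BijGroup \<Gamma>\<^esub> a = a \<otimes>\<^bsub>BijGroup \<Gamma>\<^esub> c" if "a \<in> ?L" for a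
      using subgroup.mem_carrier[OF act_M_subgroup[OF \<Gamma>] that] unfolding c by simp
    moreover have "c \<in> component G \<Gamma>" unfolding c by (rule subgroup.one_closed[OF component_subgroup[OF \<Gamma>]])
    ultimately show "c \<in> centralizer (perm_group \<Gamma> (component G \<Gamma>)) ?L"
      unfolding centralizer_def by simp
  qed
  have sub: "subdirect (perm_group \<Gamma> ?L) ?K" by (rule L.subdirectI[OF Ks onto])
  have quasi: "quasiprimitive \<Gamma> (component G \<Gamma>)"
    by (rule blow_up.component_quasiprimitive[OF blow_up q \<Gamma>])
  note props = component_minimal_normal[OF \<Gamma>] not_comm not_simple cent
  show ?thesis
  proof (cases "simple_group (perm_group \<Gamma> ?K)")
    case True
    have "type_Sd \<Gamma> (component G \<Gamma>)"
      unfolding type_Sd_def by (intro conjI quasi exI[of _ ?L] bexI[OF _ \<gamma>] props True sub)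
    then show ?thesis ..
  next
    case False
    have "type_Cd \<Gamma> (component G \<Gamma>)"
      unfolding type_Cd_def by (intro conjI quasi exI[of _ ?L] bexI[OF _ \<gamma>] props False sub)
    then show ?thesis ..
  qed
qed

end

lemma (in invariant_cartesian) subdirect_plinth_exists:
  assumes hom: "homogeneous \<E>" and q: "quasiprimitive \<Omega> G"
    and M: "minimal_normal M (perm_group \<Omega> G)" and \<omega>: "\<omega> \<in> \<Omega>"
    and sub: "subdirect (perm_group \<Omega> M) (point_stabilizer \<Omega> M \<omega>)"
  shows "\<exists>\<T> p. subdirect_plinth \<Omega> \<E> G M \<omega> \<T> p"
proof -
  have Mn: "normal_within \<B> G M" "M \<noteq> {\<one>\<^bsub>\<B>\<^esub>}" using M by (auto simp: \<B>.minimal_normal_within[OF G_subgroup])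
  have Ms: "subgroup M \<B>" using Mn by (simp add: normal_within_def)
  have tr: "transitive_on M \<Omega>" using q Mn by (simp add: quasiprimitive_iff[OF G_subgroup])
  have base: "M \<subseteq> base" by (rule minimal_normal_base[OF hom M tr])
  have fin: "finite (carrier (perm_group \<Omega> M))" using finite_subset[OF subgroup.subset[OF Ms]] finite_Bij by simp
  obtain \<T> p where "simple_product (perm_group \<Omega> M) \<T> p" "\<forall>T\<in>\<T>. p T ` point_stabilizer \<Omega> M \<omega> = T"
    by (rule subdirectE[OF sub \<B>.subgroup_imp_group[OF Ms] fin])
  then have "subdirect_plinth \<Omega> \<E> G M \<omega> \<T> p"
    using invariant_cartesian_axioms M tr base \<omega> by (simp add: subdirect_plinth_def subdirect_plinth_axioms_def)
  then show ?thesis by blast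
qed

theorem theorem6p1:
  fixes \<Omega> :: "'a set" and G :: "('a \<Rightarrow> 'a) set"
    and \<E> :: "'a set set set" and \<Gamma>\<^sub>0 :: "'a set set"
  assumes "finite \<Omega>"
    and "subgroup G (BijGroup \<Omega>)"
    and "transitive_on G \<Omega>"
    and "cartesian_decomposition \<Omega> \<E>"
    and "homogeneous \<E>"
    and "invariant_decomposition G \<E>"
    and "\<Gamma>\<^sub>0 \<in> \<E>"
  shows
    "(blow_up_decomposition \<Omega> G \<E> \<and> quasiprimitive \<Omega> G \<longrightarrow>
        quasiprimitive \<Gamma>\<^sub>0 (component G \<Gamma>\<^sub>0) \<and>
        socle (perm_group \<Omega> G) =
          coordinatewise_product \<Omega> \<E> (\<lambda>\<Gamma>. socle (perm_group \<Gamma> (component G \<Gamma>)))) \<and>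
     (blow_up_decomposition \<Omega> G \<E> \<and>
        quasiprimitive \<Gamma>\<^sub>0 (component G \<Gamma>\<^sub>0) \<and> \<not> type_HA \<Gamma>\<^sub>0 (component G \<Gamma>\<^sub>0) \<longrightarrow>
        quasiprimitive \<Omega> G \<and>
        socle (perm_group \<Omega> G) =
          coordinatewise_product \<Omega> \<E> (\<lambda>\<Gamma>. socle (perm_group \<Gamma> (component G \<Gamma>)))) \<and>
     \<not> type_Sd \<Omega> G \<and>
     (type_Cd \<Omega> G \<longrightarrow>
        blow_up_decomposition \<Omega> G \<E> \<and>
        (type_Sd \<Gamma>\<^sub>0 (component G \<Gamma>\<^sub>0) \<or> type_Cd \<Gamma>\<^sub>0 (component G \<Gamma>\<^sub>0)))"
proof -
  interpret invariant_cartesian \<Omega> \<E> G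
    using assms(1,2,4,6) by (simp add: invariant_cartesian_def cartesian_def invariant_cartesian_axioms_def)
  have socle: "socle (perm_group \<Omega> G) =
      coordinatewise_product \<Omega> \<E> (\<lambda>\<Gamma>. socle (perm_group \<Gamma> (component G \<Gamma>)))"
    if M: "blow_up \<Omega> \<E> G M" and q: "quasiprimitive \<Omega> G" for M
    using blow_up.socle_eq[OF M q] blow_up.M_coordinatewise_product[OF M] by simp
  show ?thesis
  proof (intro conjI impI)
    assume h: "blow_up_decomposition \<Omega> G \<E> \<and> quasiprimitive \<Omega> G"
    then obtain M where M: "blow_up \<Omega> \<E> G M" using blow_up_decomposition_iff by blast
    show "quasiprimitive \<Gamma>\<^sub>0 (component G \<Gamma>\<^sub>0)"
      using blow_up.component_quasiprimitive[OF M _ assms(7)] h by blast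
    show "socle (perm_group \<Omega> G) =
        coordinatewise_product \<Omega> \<E> (\<lambda>\<Gamma>. socle (perm_group \<Gamma> (component G \<Gamma>)))"
      using socle[OF M] h by blast
  next
    assume h: "blow_up_decomposition \<Omega> G \<E> \<and>
      quasiprimitive \<Gamma>\<^sub>0 (component G \<Gamma>\<^sub>0) \<and> \<not> type_HA \<Gamma>\<^sub>0 (component G \<Gamma>\<^sub>0)"
    then obtain M where M: "blow_up \<Omega> \<E> G M" using blow_up_decomposition_iff by blast
    show q: "quasiprimitive \<Omega> G"
      using blow_up.quasiprimitive_from_component[OF M assms(7)] h by blast
    show "socle (perm_group \<Omega> G) =
        coordinatewise_product \<Omega> \<E> (\<lambda>\<Gamma>. socle (perm_group \<Gamma> (component G \<Gamma>)))"
      by (rule socle[OF M q])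
  next
    show "\<not> type_Sd \<Omega> G"
    proof
      assume "type_Sd \<Omega> G"
      then obtain M \<omega> where q: "quasiprimitive \<Omega> G" and M: "minimal_normal M (perm_group \<Omega> G)" and \<omega>: "\<omega> \<in> \<Omega>"
        and simple: "simple_group (perm_group \<Omega> (point_stabilizer \<Omega> M \<omega>))"
        and sub: "subdirect (perm_group \<Omega> M) (point_stabilizer \<Omega> M \<omega>)"
        unfolding type_Sd_def by blast
      obtain \<T> p where P: "subdirect_plinth \<Omega> \<E> G M \<omega> \<T> p"
        using subdirect_plinth_exists[OF assms(5) q M \<omega> sub] by blast
      show False using subdirect_plinth.point_stabilizer_not_simple[OF P] simple by simp
    qed
  next
    assume "type_Cd \<Omega> G"
    then obtain M \<omega> where q: "quasiprimitive \<Omega> G" and M: "minimal_normal M (perm_group \<Omega> G)" and \<omega>: "\<omega> \<in> \<Omega>"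
      and sub: "subdirect (perm_group \<Omega> M) (point_stabilizer \<Omega> M \<omega>)"
      unfolding type_Cd_def by blast
    obtain \<T> p where P: "subdirect_plinth \<Omega> \<E> G M \<omega> \<T> p"
      using subdirect_plinth_exists[OF assms(5) q M \<omega> sub] by blast
    show "blow_up_decomposition \<Omega> G \<E>"
      using subdirect_plinth.blow_up[OF P] blow_up_decomposition_iff by blast
    show "type_Sd \<Gamma>\<^sub>0 (component G \<Gamma>\<^sub>0) \<or> type_Cd \<Gamma>\<^sub>0 (component G \<Gamma>\<^sub>0)"
      by (rule subdirect_plinth.component_type[OF P q assms(7)])
  qed
qed

end
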